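(* Let $X$ be an Asplund space, let $\{\Omega_i\}_{i\in T}$ be a system of subsets of $X$ (closed around the points under consideration), let $\bar{x}\in\Omega:=\bigcap_{i\in T}\Omega_i$, and assume that $\{\Omega_i\}_{i\in T}$ satisfies the approximate qualification condition (AQC) at $\bar{x}$. Then for any limiting $R$-normal $x^*$ to $\Omega$ at $\bar{x}$ and any $\varepsilon>0$ we have the inclusion $$x^*\in\operatorname{cl}^*\Big\{\sum_{i\in I}x_i^*+\varepsilon\mathbb{B}^*\ \Big|\ x_i^*\in\widehat{N}(x_i;\Omega_i),\ \|x_i-\bar{x}\|<\varepsilon,\ I\subset T\Big\},$$ where $I\subset T$ is a finite index subset. In particular, if all the limiting (basic) normals to $\Omega$ at $\bar{x}$ are limiting $R$-normals, then $$N(\bar{x};\Omega)\subset\bigcap_{\varepsilon>0}\operatorname{cl}^*\Big\{\sum_{i\in I}x_i^*+\varepsilon\mathbb{B}^*\ \Big|\ x_i^*\in\widehat{N}(x_i;\Omega_i),\ \|x_i-\bar{x}\|<\varepsilon,\ I\subset T\Big\},$$ again with finite index subsets $I\subset T$.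
   Context: A Banach space is Asplund if each of its separable subspaces has a separable dual. $\mathbb{B}^*$ is the closed unit ball of $X^*$; $B(\bar{x},\rho)$ is the closed ball centered at $\bar{x}$ with radius $\rho$; $|I|$ is the number of elements of a finite set $I$; $\operatorname{cl}^*$ is the closure in the weak$^*$ topology of $X^*$. The set in braces is the union, over all finite $I\subset T$ and all choices of $x_i$, $x_i^*$ ($i\in I$) as indicated, of the sets $\sum_{i\in I}x_i^*+\varepsilon\mathbb{B}^*$. Normals: for $\Omega\subset X$ and $\varepsilon\ge0$ put $\widehat{N}_\varepsilon(x;\Omega):=\{x^*\in X^*\mid\limsup_{u\to x,\,u\in\Omega}\frac{\langle x^*,u-x\rangle}{\|u-x\|}\le\varepsilon\}$ if $x\in\Omega$ and $\widehat{N}_\varepsilon(x;\Omega):=\emptyset$ if $x\notin\Omega$; $\widehat{N}(x;\Omega):=\widehat{N}_0(x;\Omega)$ is the Fréchet normal cone. The basic (limiting) normal cone $N(\bar{x};\Omega)$ is the set of all $x^*\in X^*$ for which there are sequences $\varepsilon_k\downarrow0$, $x_k\to\bar{x}$ and $x_k^*\to x^*$ weak$^*$ with $x_k^*\in\widehat{N}_{\varepsilon_k}(x_k;\Omega)$ for all $k\in\mathbb{N}$. A function $R(\cdot):\mathbb{R}_+\to\mathbb{R}_+$ is a rate function if there is a real number $M$ such that $rR(r)\le M$ for all $r$ and $\lim_{r\downarrow0}R(r)=\infty$; rate functions are assumed to be continuous (on $(0,\infty)$). Write $R_r:=R(r)$. Rated normals: $x^*\in X^*$ is an $R$-normal to $\Omega=\bigcap_{i\in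 T}\Omega_i$ at $\bar{x}\in\Omega$ if for any $r\downarrow0$ (i.e., for all sufficiently small $r>0$) there is a finite set $I=I(r)\subset T$, of cardinality $|I(r)|^{3/2}=o(R_r)$ as $r\downarrow0$, such that $\langle x^*,x-\bar{x}\rangle-r\|x-\bar{x}\|<r$ for all $x\in\bigcap_{i\in I}\Omega_i\cap B(\bar{x},rR_r)$. Limiting rated normals: $x^*$ is a limiting $R$-normal to $\Omega=\bigcap_{i\in T}\Omega_i$ at $\bar{x}\in\Omega$ if there is a sequence $\{(x_k,x_k^* )\}_{k\in\mathbb{N}}\subset X\times X^*$ such that $x_k\to\bar{x}$ with $x_k\in\Omega$, $x_k^*\to x^*$ weak$^*$ as $k\to\infty$, and each $x_k^*$ is an $R_k$-normal to $\Omega$ at $x_k$, where $R_k$ is a rate function for $x_k^*$ (these rate functions may be different from each other). AQC: $\{\Omega_i\}_{i\in T}$ satisfies the approximate qualification condition at $\bar{x}$ if for any $\varepsilon\downarrow0$ (i.e., along any sequence of positive numbers $\varepsilon$ decreasing to $0$), any finite index subsets $I_\varepsilon\subset T$, and any Fréchet normals $x_{i\varepsilon}^*\in\widehat{N}(x_{i\varepsilon};\Omega_i)\cap\mathbb{B}^*$ with $\|x_{i\varepsilon}-\bar{x}\|\le\varepsilon$, $i\in I_\varepsilon$, the following implication holds: if $\big\|\sum_{i\in I_\varepsilon}x_{i\varepsilon}^*\big\|\to0$ as $\varepsilon\downarrow0$, then $\sum_{i\in I_\varepsilon}\|x_{i\varepsilon}^*\|^2\to0$ as $\varepsilon\downarrow0$.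 *)

theory Defs
  imports "HOL-Analysis.Analysis" "HOL-Library.Landau_Symbols"
begin

section \<open>Asplund spaces and the weak* topology\<close>

text \<open>
  The dual of a linear subspace \<open>S\<close>, where \<open>S\<close> is a set rather than a type: bounded linear
  functionals on \<open>S\<close>, made unique as HOL functions by extensionality outside \<open>S\<close>.
\<close>

definition subspace_dual :: "'a::real_normed_vector set \<Rightarrow> ('a \<Rightarrow> real) set" where
  "subspace_dual S = {f \<in> extensional S.
     (\<forall>x\<in>S. \<forall>y\<in>S. f (x + y) = f x + f y) \<and>
     (\<forall>c. \<forall>x\<in>S. f (c *\<^sub>R x) = c * f x) \<and>
     (\<exists>K. \<forall>x\<in>S. \<bar>f x\<bar> \<le> K * norm x)}"

definition subspace_dual_norm :: "'a::real_normed_vector set \<Rightarrow> ('a \<Rightarrow> real) \<Rightarrow> real" where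
  "subspace_dual_norm S f = (SUP x\<in>S \<inter> cball 0 1. \<bar>f x\<bar>)"

definition separable_subspace_dual :: "'a::real_normed_vector set \<Rightarrow> bool" where
  "separable_subspace_dual S \<longleftrightarrow>
     (\<exists>D. countable D \<and> D \<subseteq> subspace_dual S \<and>
       (\<forall>f\<in>subspace_dual S. \<forall>e>0. \<exists>g\<in>D. subspace_dual_norm S (\<lambda>x. f x - g x) < e))"

definition asplund_space :: "'a::banach itself \<Rightarrow> bool" where
  "asplund_space _ \<longleftrightarrow>
     (\<forall>S :: 'a set. subspace S \<and> separable_space (top_of_set S) \<longrightarrow> separable_subspace_dual S)"

text \<open>
  For real-valued functionals the strong operator topology is the topology of pointwise
  convergence on the dual, that is, the weak* topology.
\<close>

abbreviation weak_star_topology :: "('a::real_normed_vector \<Rightarrow>\<^sub>L real) topology" where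
  "weak_star_topology \<equiv> strong_operator_topology"


section \<open>Frechet and limiting normals\<close>

text \<open>
  The filter \<open>at x within \<Omega>\<close> excludes \<open>u = x\<close>, where the quotient is undefined. If \<open>x\<close> is
  isolated in \<open>\<Omega>\<close>, the limes superior is \<open>-\<infinity>\<close> and every functional is a normal.
\<close>

definition eps_normals :: "real \<Rightarrow> 'a::real_normed_vector \<Rightarrow> 'a set \<Rightarrow> ('a \<Rightarrow>\<^sub>L real) set" where
  "eps_normals \<epsilon> x \<Omega> =
     (if x \<in> \<Omega>
      then {xs. Limsup (at x within \<Omega>) (\<lambda>u. ereal (blinfun_apply xs (u - x) / norm (u - x))) \<le> ereal \<epsilon>}
      else {})"

definition frechet_normal_cone :: "'a::real_normed_vector \<Rightarrow> 'a set \<Rightarrow> ('a \<Rightarrow>\<^sub>L real) set" where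
  "frechet_normal_cone x \<Omega> = eps_normals 0 x \<Omega>"

definition decreasing_to_zero :: "(nat \<Rightarrow> real) \<Rightarrow> bool" where
  "decreasing_to_zero \<epsilon> \<longleftrightarrow> (\<forall>k. \<epsilon> k > 0) \<and> decseq \<epsilon> \<and> \<epsilon> \<longlonglongrightarrow> 0"

definition basic_normal_cone :: "'a::real_normed_vector \<Rightarrow> 'a set \<Rightarrow> ('a \<Rightarrow>\<^sub>L real) set" where
  "basic_normal_cone xbar \<Omega> =
     {xs. \<exists>\<epsilon> x xsk. decreasing_to_zero \<epsilon> \<and> x \<longlonglongrightarrow> xbar \<and>
        limitin weak_star_topology xsk xs sequentially \<and>
        (\<forall>k. xsk k \<in> eps_normals (\<epsilon> k) (x k) \<Omega>)}"


section \<open>Rated normals to infinite intersections\<close>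

text \<open>Only the values on \<open>{0..}\<close> matter.\<close>

definition rate_function :: "(real \<Rightarrow> real) \<Rightarrow> bool" where
  "rate_function R \<longleftrightarrow>
     (\<forall>r\<ge>0. R r \<ge> 0) \<and> (\<exists>M. \<forall>r\<ge>0. r * R r \<le> M) \<and>
     filterlim R at_top (at_right 0) \<and> continuous_on {0<..} R"

text \<open>For \<open>I r = {}\<close> the intersection over \<open>I r\<close> is the whole space.\<close>

definition R_normal ::
  "(real \<Rightarrow> real) \<Rightarrow> 'i set \<Rightarrow> ('i \<Rightarrow> 'a::real_normed_vector set) \<Rightarrow> 'a \<Rightarrow> ('a \<Rightarrow>\<^sub>L real) \<Rightarrow> bool"
where
  "R_normal R T \<Omega> xbar xs \<longleftrightarrow>
     xbar \<in> (\<Inter>i\<in>T. \<Omega> i) \<and>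
     (\<exists>I :: real \<Rightarrow> 'i set.
        (\<lambda>r. real (card (I r)) powr (3/2)) \<in> o[at_right 0](R) \<and>
        (\<forall>\<^sub>F r in at_right 0. finite (I r) \<and> I r \<subseteq> T \<and>
           (\<forall>x \<in> (\<Inter>i\<in>I r. \<Omega> i) \<inter> cball xbar (r * R r).
              blinfun_apply xs (x - xbar) - r * norm (x - xbar) < r)))"

definition limiting_R_normal ::
  "'i set \<Rightarrow> ('i \<Rightarrow> 'a::real_normed_vector set) \<Rightarrow> 'a \<Rightarrow> ('a \<Rightarrow>\<^sub>L real) \<Rightarrow> bool"
where
  "limiting_R_normal T \<Omega> xbar xs \<longleftrightarrow>
     xbar \<in> (\<Inter>i\<in>T. \<Omega> i) \<and>
     (\<exists>x xsk. x \<longlonglongrightarrow> xbar \<and> (\<forall>k. x k \<in> (\<Inter>i\<in>T. \<Omega> i)) \<and>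
        limitin weak_star_topology xsk xs sequentially \<and>
        (\<forall>k. \<exists>R. rate_function R \<and> R_normal R T \<Omega> (x k) (xsk k)))"


section \<open>Qualification condition and approximating sums\<close>

text \<open>
  Local closedness of the whole system: one ball serves all sets. A radius depending on \<open>i\<close>
  would not be enough for infinite systems, because the sets entering an \<open>R\<close>-normal vary
  with \<open>r\<close> and are all used on balls around points near \<open>xbar\<close>.
\<close>

definition closed_system_around :: "'i set \<Rightarrow> ('i \<Rightarrow> 'a::real_normed_vector set) \<Rightarrow> 'a \<Rightarrow> bool" where
  "closed_system_around T \<Omega> xbar \<longleftrightarrow> (\<exists>\<delta>>0. \<forall>i\<in>T. closed (\<Omega> i \<inter> cball xbar \<delta>))"

definition AQC :: "'i set \<Rightarrow> ('i \<Rightarrow> 'a::real_normed_vector set) \<Rightarrow> 'a \<Rightarrow> bool" where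
  "AQC T \<Omega> xbar \<longleftrightarrow>
     (\<forall>(\<epsilon> :: nat \<Rightarrow> real) (I :: nat \<Rightarrow> 'i set) (x :: nat \<Rightarrow> 'i \<Rightarrow> 'a) (xs :: nat \<Rightarrow> 'i \<Rightarrow> 'a \<Rightarrow>\<^sub>L real).
        decreasing_to_zero \<epsilon> \<and>
        (\<forall>k. finite (I k) \<and> I k \<subseteq> T) \<and>
        (\<forall>k. \<forall>i\<in>I k. xs k i \<in> frechet_normal_cone (x k i) (\<Omega> i) \<inter> cball 0 1 \<and>
                       norm (x k i - xbar) \<le> \<epsilon> k) \<longrightarrow>
        (\<lambda>k. norm (\<Sum>i\<in>I k. xs k i)) \<longlonglongrightarrow> 0 \<longrightarrow>
        (\<lambda>k. \<Sum>i\<in>I k. (norm (xs k i))\<^sup>2) \<longlonglongrightarrow> 0)"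

definition approx_normal_sums ::
  "'i set \<Rightarrow> ('i \<Rightarrow> 'a::real_normed_vector set) \<Rightarrow> 'a \<Rightarrow> real \<Rightarrow> ('a \<Rightarrow>\<^sub>L real) set"
where
  "approx_normal_sums T \<Omega> xbar \<epsilon> =
     {(\<Sum>i\<in>I. xs i) + \<epsilon> *\<^sub>R b | I x xs b.
        finite I \<and> I \<subseteq> T \<and>
        (\<forall>i\<in>I. xs i \<in> frechet_normal_cone (x i) (\<Omega> i) \<and> norm (x i - xbar) < \<epsilon>) \<and>
        b \<in> cball 0 1}"

end

theory Submission
  imports Defs
begin

text \<open>
  Let \<open>x\<^sup>*\<close> be an \<open>R\<close>-normal at \<open>x\<^sub>0\<close>, witnessed for a small \<open>r\<close> by the finite set \<open>I\<close>. On a ball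
  of radius \<open>\<rho> \<le> r R\<^sub>r\<close> the function
  \<open>\<phi>(x, u) = sqrt (max 0 (r' - \<langle>x\<^sup>*, x - x\<^sub>0\<rangle>)\<^sup>2 + (\<Sum>i\<in>I. \<parallel>x - u\<^sub>i\<parallel>\<^sup>2))\<close> with \<open>u\<^sub>i \<in> \<Omega>\<^sub>i\<close> and
  \<open>r' = O(r)\<close> is strictly positive and equals \<open>r'\<close> at \<open>x\<^sub>0\<close>. A variational principle yields a
  minimizer of \<open>\<phi>\<close> up to a perturbation with derivative \<open>O(r/\<rho>)\<close> in each variable. If the norm
  is Frechet smooth, the optimality conditions there provide Frechet normals \<open>x\<^sub>i\<^sup>*\<close> with
  \<open>\<lambda> x\<^sup>* \<approx> (\<Sum>i\<in>I. x\<^sub>i\<^sup>*)\<close> and \<open>\<lambda>\<^sup>2 + (\<Sum>i\<in>I. \<parallel>x\<^sub>i\<^sup>*\<parallel>\<^sup>2)\<close> bounded below; the growth condition on \<open>|I|\<close>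
  makes the error \<open>O(|I| r/\<rho>)\<close> vanish. Along a limiting sequence AQC forbids \<open>\<lambda> \<rightarrow> 0\<close>, and
  dividing by \<open>\<lambda>\<close> gives the inclusion.

  Smoothness is available on separable subspaces \<open>Y\<close>: their duals are separable, so the
  infimal convolution of \<open>\<parallel>z\<parallel>\<^sup>2\<close> with functions \<open>c\<^sub>n \<parallel>z\<parallel>\<^sup>2\<close> restricted to the kernels of a
  dense sequence in \<open>Y\<^sup>*\<close> is the square of an equivalent smooth norm. The subspace \<open>Y\<close> is chosen
  by a Loewenheim-Skolem argument such that functionals on \<open>Y\<close> extend linearly and isometrically
  to the whole space, mapping Frechet normals of \<open>\<Omega>\<^sub>i \<inter> Y\<close> to Frechet normals of \<open>\<Omega>\<^sub>i\<close>.
\<close>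

section \<open>Supporting functionals of sublinear functions\<close>

text \<open>An Asplund space need not have an equivalent smooth norm; hence the minimization is
  confined to a separable subspace, chosen anew for every finite \<open>I\<close>. The functionals
  found there are extended by one linear map fixing \<open>x\<^sup>*\<close>: separate Hahn-Banach
  extensions need preserve neither the approximate equation between
  \<open>\<lambda> x\<^sup>*\<close> and the sum of normals nor normality itself. The euclidean form
  of \<open>\<phi>\<close> matches AQC, which measures normals by the sum of their squares: the
  derivatives of such a root have euclidean size of order one however large \<open>I\<close> is,
  while the perturbations add up linearly in \<open>|I|\<close>. The slack in \<open>r'\<close>
  absorbs the term \<open>r \<parallel>x - x\<^sub>0\<parallel>\<close>, because
  \<open>r R\<^sub>r\<close> is bounded. For one \<open>R\<close>-normal nothing excludes
  \<open>\<lambda> = 0\<close>. Along the limiting sequence infinitely many \<open>\<lambda>\<close>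
  stay away from 0, and each corresponding \<open>x\<^sub>k\<^sup>*\<close> is itself an
  approximating sum; the weak-star closure only serves to pass to the limit.\<close>

definition sublinear :: "('a::real_vector \<Rightarrow> real) \<Rightarrow> bool" where
  "sublinear s \<longleftrightarrow> (\<forall>x y. s (x + y) \<le> s x + s y) \<and> (\<forall>c>0. \<forall>x. s (c *\<^sub>R x) \<le> c * s x)"

lemma sublinear_add: "sublinear s \<Longrightarrow> s (x + y) \<le> s x + s y"
  and sublinear_scale_le: "sublinear s \<Longrightarrow> c > 0 \<Longrightarrow> s (c *\<^sub>R x) \<le> c * s x"
  by (auto simp: sublinear_def)

lemma sublinear_zero: "sublinear s \<Longrightarrow> s 0 = 0"
  using sublinear_add[of s 0 0] sublinear_scale_le[of s "1/2" 0] by simp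

text \<open>The inequality for \<open>1 / c\<close> reverses the one for \<open>c\<close>. Hence the
  definition can ask for an inequality only, which is easier to verify for infima.\<close>

lemma sublinear_scale:
  assumes "sublinear s" "c \<ge> 0"
  shows "s (c *\<^sub>R x) = c * s x"
proof (cases "c = 0")
  case False
  with assms have c: "c > 0" by simp
  have "s ((1/c) *\<^sub>R (c *\<^sub>R x)) \<le> (1/c) * s (c *\<^sub>R x)"
    using c by (intro sublinear_scale_le assms) auto
  hence "c * s x \<le> s (c *\<^sub>R x)" using c by (simp add: field_simps)
  with sublinear_scale_le[OF assms(1) c, of x] show ?thesis by simp
qed (simp add: sublinear_zero assms)

lemma sublinear_minus: "sublinear s \<Longrightarrow> - s (- x) \<le> s x"
  using sublinear_add[of s x "-x"] sublinear_zero[of s] by simp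

text \<open>Zorn's lemma for the reversed pointwise order. The infimum of a chain stays finite
  because every sublinear \<open>s \<le> q\<close> satisfies
  \<open>- q (- x) \<le> s x\<close>.\<close>

lemma sublinear_has_minimal:
  fixes q :: "'a::real_vector \<Rightarrow> real"
  assumes q: "sublinear q"
  obtains m where "sublinear m" "\<And>x. m x \<le> q x"
    "\<And>s. sublinear s \<Longrightarrow> (\<And>x. s x \<le> m x) \<Longrightarrow> s = m"
proof -
  define A where "A = {s. sublinear s \<and> (\<forall>x. s x \<le> q x)}"
  define P :: "('a \<Rightarrow> real) \<Rightarrow> ('a \<Rightarrow> real) \<Rightarrow> bool" where "P = (\<lambda>s t. \<forall>x. t x \<le> s x)"
  have lower: "- q (- x) \<le> s x" if "s \<in> A" for s x
  proof -
    have "- s (- x) \<le> s x" "s (- x) \<le> q (- x)"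
      using that sublinear_minus[of s x] by (auto simp: A_def)
    thus ?thesis by linarith
  qed
  have "\<exists>m\<in>A. \<forall>a\<in>A. P m a \<longrightarrow> a = m"
  proof (rule predicate_Zorn)
    show "partial_order_on A (relation_of P A)"
    proof (rule partial_order_on_relation_ofI)
      show "P a a" if "a \<in> A" for a by (simp add: P_def)
      show "P a c" if "P a b" "P b c" for a b c
        using that by (auto simp: P_def intro: order_trans)
      show "a = b" if "P a b" "P b a" for a b
        using that by (auto simp: P_def intro!: ext antisym)
    qed
  next
    fix C assume C: "C \<in> Chains (relation_of P A)"
    have CA: "C \<subseteq> A"
      using C unfolding Chains_def relation_of_def by auto
    have tot: "P s t \<or> P t s" if "s \<in> C" "t \<in> C" for s t
      using C that unfolding Chains_def relation_of_def by auto
    show "\<exists>u\<in>A. \<forall>a\<in>C. P a u"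
    proof (cases "C = {}")
      case True
      thus ?thesis using q by (auto simp: A_def)
    next
      case ne: False
      define u where "u = (\<lambda>x. INF s\<in>C. s x)"
      have bdd: "bdd_below ((\<lambda>s. s x) ` C)" for x
        using lower CA by (intro bdd_belowI2[of _ "- q (- x)"]) auto
      have u_le: "u x \<le> s x" if "s \<in> C" for s x
        unfolding u_def by (rule cINF_lower[OF bdd that])
      have u_ge: "b \<le> u x" if "\<And>s. s \<in> C \<Longrightarrow> b \<le> s x" for b x
        unfolding u_def by (rule cINF_greatest[OF ne that])
      have "sublinear u"
        unfolding sublinear_def
      proof safe
        fix x y
        \<comment> \<open>An infimum of sublinear functions is in general not subadditive; here the
          smaller of \<open>s\<close> and \<open>t\<close> can be used at both points because
          \<open>C\<close> is a chain.\<close>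
        have *: "u (x + y) \<le> s x + t y" if st: "s \<in> C" "t \<in> C" for s t
        proof -
          obtain k where k: "k \<in> C" "k x \<le> s x" "k y \<le> t y"
            using tot[OF st] st by (auto simp: P_def)
          have "u (x + y) \<le> k (x + y)" by (rule u_le[OF k(1)])
          also have "\<dots> \<le> k x + k y" using k(1) CA by (auto simp: A_def sublinear_def)
          finally show ?thesis using k by linarith
        qed
        have "u (x + y) - u x \<le> u y"
        proof (rule u_ge)
          fix t assume t: "t \<in> C"
          have "u (x + y) - t y \<le> u x"
            using *[OF _ t] by (intro u_ge) (simp add: algebra_simps)
          thus "u (x + y) - u x \<le> t y" by simp
        qed
        thus "u (x + y) \<le> u x + u y" by simp
      next
        fix c :: real and x assume c: "c > 0"
        have "u (c *\<^sub>R x) / c \<le> u x"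
        proof (rule u_ge)
          fix s assume s: "s \<in> C"
          have "u (c *\<^sub>R x) \<le> s (c *\<^sub>R x)" by (rule u_le[OF s])
          also have "\<dots> \<le> c * s x" using s CA c by (auto simp: A_def sublinear_def)
          finally show "u (c *\<^sub>R x) / c \<le> s x" using c by (simp add: field_simps)
        qed
        thus "u (c *\<^sub>R x) \<le> c * u x" using c by (simp add: field_simps)
      qed
      moreover have "u x \<le> q x" for x
        using ne u_le CA by (force simp: A_def intro: order_trans)
      ultimately show ?thesis using u_le by (auto simp: A_def P_def)
    qed
  qed
  then obtain m where "m \<in> A" "\<And>a. a \<in> A \<Longrightarrow> P m a \<Longrightarrow> a = m" by blast
  thus ?thesis
    by (intro that[of m]) (auto simp: A_def P_def intro: order_trans)
qed

text \<open>The function \<open>s\<close> pins down values along \<open>v\<close>: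
  \<open>t = 0\<close> gives \<open>s \<le> q\<close>, and \<open>t = 1\<close> at
  \<open>- v\<close> gives \<open>s (- v) \<le> - q v\<close>. Thus every linear minorant of
  \<open>s\<close> agrees with \<open>q\<close> at \<open>v\<close>.\<close>

lemma sublinear_lower_along:
  fixes q :: "'a::real_vector \<Rightarrow> real"
  assumes q: "sublinear q"
  obtains s where "sublinear s" "\<And>x t. t \<ge> 0 \<Longrightarrow> s x \<le> q (x + t *\<^sub>R v) - t * q v"
proof -
  define s where "s = (\<lambda>x. INF t\<in>{0..}. q (x + t *\<^sub>R v) - t * q v)"
  have bdd: "bdd_below ((\<lambda>t. q (x + t *\<^sub>R v) - t * q v) ` {0..})" for x
  proof (rule bdd_belowI2[of _ "- q (- x)"])
    fix t :: real assume "t \<in> {0..}"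
    hence "t * q v = q ((x + t *\<^sub>R v) + (- x))" by (simp add: sublinear_scale[OF q])
    also have "\<dots> \<le> q (x + t *\<^sub>R v) + q (- x)" by (rule sublinear_add[OF q])
    finally show "- q (- x) \<le> q (x + t *\<^sub>R v) - t * q v" by simp
  qed
  have s_le: "s x \<le> q (x + t *\<^sub>R v) - t * q v" if "t \<ge> 0" for x t
    unfolding s_def using that by (intro cINF_lower[OF bdd]) auto
  have s_ge: "b \<le> s x" if "\<And>t. t \<ge> 0 \<Longrightarrow> b \<le> q (x + t *\<^sub>R v) - t * q v" for b x
    unfolding s_def using that by (intro cINF_greatest) auto
  have "sublinear s"
    unfolding sublinear_def
  proof safe
    fix x y
    have *: "s (x + y) \<le> (q (x + t *\<^sub>R v) - t * q v) + (q (y + r *\<^sub>R v) - r * q v)"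
      if "t \<ge> 0" "r \<ge> 0" for t r
    proof -
      have "s (x + y) \<le> q ((x + y) + (t + r) *\<^sub>R v) - (t + r) * q v"
        using that by (intro s_le) auto
      also have "(x + y) + (t + r) *\<^sub>R v = (x + t *\<^sub>R v) + (y + r *\<^sub>R v)"
        by (simp add: algebra_simps)
      also have "q \<dots> \<le> q (x + t *\<^sub>R v) + q (y + r *\<^sub>R v)"
        by (rule sublinear_add[OF q])
      finally show ?thesis by (simp add: algebra_simps)
    qed
    have "s (x + y) - s x \<le> s y"
    proof (rule s_ge)
      fix r :: real assume r: "r \<ge> 0"
      have "s (x + y) - (q (y + r *\<^sub>R v) - r * q v) \<le> s x"
        using *[OF _ r] by (intro s_ge) (simp add: algebra_simps)
      thus "s (x + y) - s x \<le> q (y + r *\<^sub>R v) - r * q v" by simp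
    qed
    thus "s (x + y) \<le> s x + s y" by simp
  next
    fix c :: real and x assume c: "c > 0"
    have "s (c *\<^sub>R x) / c \<le> s x"
    proof (rule s_ge)
      fix t :: real assume t: "t \<ge> 0"
      have "s (c *\<^sub>R x) \<le> q (c *\<^sub>R x + (c * t) *\<^sub>R v) - (c * t) * q v"
        using c t by (intro s_le) auto
      also have "c *\<^sub>R x + (c * t) *\<^sub>R v = c *\<^sub>R (x + t *\<^sub>R v)"
        by (simp add: algebra_simps)
      also have "q \<dots> \<le> c * q (x + t *\<^sub>R v)" by (rule sublinear_scale_le[OF q c])
      finally show "s (c *\<^sub>R x) / c \<le> q (x + t *\<^sub>R v) - t * q v"
        using c by (simp add: field_simps)
    qed
    thus "s (c *\<^sub>R x) \<le> c * s x" using c by (simp add: field_simps)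
  qed
  with s_le show ?thesis by (rule that[rotated])
qed

text \<open>Lowering a minimal sublinear function along a direction cannot change it; this forces
  additivity.\<close>

lemma sublinear_minorant_linear:
  fixes q :: "'a::real_vector \<Rightarrow> real"
  assumes q: "sublinear q"
  obtains f where "linear f" "\<And>x. f x \<le> q x"
proof -
  obtain m where m: "sublinear m" "\<And>x. m x \<le> q x"
    and min: "\<And>s. sublinear s \<Longrightarrow> (\<And>x. s x \<le> m x) \<Longrightarrow> s = m"
    using sublinear_has_minimal[OF q] by blast
  have super: "m x + m v \<le> m (x + v)" for x v
  proof -
    obtain s where s: "sublinear s" "\<And>x t. t \<ge> 0 \<Longrightarrow> s x \<le> m (x + t *\<^sub>R v) - t * m v"
      using sublinear_lower_along[OF m(1)] by blast
    have "s = m" using s(2)[of 0] by (intro min s(1)) simp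
    thus ?thesis using s(2)[of 1 x] by simp
  qed
  have add: "m (x + v) = m x + m v" for x v
    using super[of x v] sublinear_add[OF m(1), of x v] by simp
  have neg: "m (- x) = - m x" for x
    using add[of x "-x"] sublinear_zero[OF m(1)] by simp
  have "m (c *\<^sub>R x) = c *\<^sub>R m x" for c x
  proof (cases "c \<ge> 0")
    case False
    hence "m ((- c) *\<^sub>R x) = (- c) * m x" by (intro sublinear_scale[OF m(1)]) auto
    thus ?thesis using neg[of "(- c) *\<^sub>R x"] by simp
  qed (simp add: sublinear_scale[OF m(1)])
  with add have "linear m" by (intro linearI) auto
  with m(2) show ?thesis using that by blast
qed

text \<open>The Hahn-Banach support functional at \<open>z\<close>. Applied to an equivalent norm,
  it supplies the candidate for the derivative.\<close>

lemma sublinear_support: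
  fixes q :: "'a::real_vector \<Rightarrow> real"
  assumes q: "sublinear q"
  obtains f where "linear f" "\<And>x. f x \<le> q x" "f z = q z"
proof -
  obtain s where s: "sublinear s" "\<And>x t. t \<ge> 0 \<Longrightarrow> s x \<le> q (x + t *\<^sub>R z) - t * q z"
    using sublinear_lower_along[OF q] by blast
  obtain f where f: "linear f" "\<And>x. f x \<le> s x"
    using sublinear_minorant_linear[OF s(1)] by blast
  have le: "f x \<le> q x" for x using f(2)[of x] s(2)[of 0 x] by simp
  have "f (- z) \<le> - q z"
    using f(2)[of "- z"] s(2)[of 1 "- z"] sublinear_zero[OF q] by simp
  hence "q z \<le> f z" using linear_neg[OF f(1)] by simp
  with le[of z] have "f z = q z" by simp
  with f(1) le show ?thesis using that by blast
qed

section \<open>Smooth norms on subspaces with separable dual\<close>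

text \<open>The norm \<open>conv_norm K\<close> is an infimal convolution. It is Frechet smooth at \<open>z\<close> as soon as the
  support functionals at \<open>z\<close> almost vanish on suitable \<open>K n\<close>.\<close>

definition decomposes :: "(nat \<Rightarrow> 'a::real_normed_vector set) \<Rightarrow> 'a \<Rightarrow> nat \<Rightarrow> (nat \<Rightarrow> 'a) \<Rightarrow> bool" where
  "decomposes K z N \<zeta> \<longleftrightarrow> (\<forall>k. \<zeta> k \<in> K k) \<and> (\<forall>k\<ge>N. \<zeta> k = 0) \<and> (\<Sum>k<N. \<zeta> k) = z"

text \<open>The square is the sum of the \<open>2 ^ k * (norm (\<zeta> k))\<^sup>2\<close>, so the
  weights are the constants of the infimal convolution. Writing the root as an \<open>L2_set\<close>
  makes Minkowski's inequality available for the triangle inequality of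
  \<open>conv_norm\<close>.\<close>

definition decomp_cost :: "(nat \<Rightarrow> 'a::real_normed_vector) \<Rightarrow> nat \<Rightarrow> real" where
  "decomp_cost \<zeta> N = L2_set (\<lambda>k. sqrt (2 ^ k) * norm (\<zeta> k)) {..<N}"

definition conv_norm :: "(nat \<Rightarrow> 'a::real_normed_vector set) \<Rightarrow> 'a \<Rightarrow> real" where
  "conv_norm K z = Inf {decomp_cost \<zeta> N | N \<zeta>. decomposes K z N \<zeta>}"

section \<open>Elementary estimates for decomposition costs\<close>

lemma decomp_cost_nonneg: "decomp_cost \<zeta> N \<ge> 0"
  by (simp add: decomp_cost_def)

lemma decomp_cost_sq: "(decomp_cost \<zeta> N)\<^sup>2 = (\<Sum>k<N. 2 ^ k * (norm (\<zeta> k))\<^sup>2)"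
  by (simp add: decomp_cost_def L2_set_def sum_nonneg power_mult_distrib)

lemma decomp_cost_mono:
  assumes "\<And>k. k \<ge> N \<Longrightarrow> \<zeta> k = 0" "N \<le> M"
  shows "decomp_cost \<zeta> M = decomp_cost \<zeta> N"
proof -
  have "(\<Sum>k<N. (sqrt (2 ^ k) * norm (\<zeta> k))\<^sup>2) = (\<Sum>k<M. (sqrt (2 ^ k) * norm (\<zeta> k))\<^sup>2)"
    using assms by (intro sum.mono_neutral_left) auto
  thus ?thesis by (simp add: decomp_cost_def L2_set_def)
qed

lemma decomposes_mono:
  assumes "decomposes K z N \<zeta>" "N \<le> M"
  shows "decomposes K z M \<zeta>"
proof -
  have "(\<Sum>k<N. \<zeta> k) = (\<Sum>k<M. \<zeta> k)"
    using assms by (intro sum.mono_neutral_left) (auto simp: decomposes_def)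
  thus ?thesis using assms by (auto simp: decomposes_def)
qed

text \<open>Cauchy-Schwarz with the inverse weights \<open>(1/2) ^ k\<close>, whose partial sums are
  at most 2. This is the origin of \<open>sqrt 2\<close> in the comparison of norms.\<close>

lemma norm_sum_le_decomp_cost: "(norm (\<Sum>k<N. \<zeta> k))\<^sup>2 \<le> 2 * (decomp_cost \<zeta> N)\<^sup>2"
proof -
  have "norm (\<Sum>k<N. \<zeta> k) \<le> (\<Sum>k<N. norm (\<zeta> k))" by (rule norm_sum)
  also have "\<dots> = (\<Sum>k<N. (1 / sqrt (2 ^ k)) * (sqrt (2 ^ k) * norm (\<zeta> k)))" by simp
  finally have "(norm (\<Sum>k<N. \<zeta> k))\<^sup>2 \<le> (\<Sum>k<N. (1 / sqrt (2 ^ k)) * (sqrt (2 ^ k) * norm (\<zeta> k)))\<^sup>2"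
    by (intro power_mono) auto
  also have "\<dots> \<le> (\<Sum>k<N. (1 / sqrt (2 ^ k))\<^sup>2) * (\<Sum>k<N. (sqrt (2 ^ k) * norm (\<zeta> k))\<^sup>2)"
    by (rule Cauchy_Schwarz_ineq_sum)
  also have "(\<Sum>k<N. (1 / sqrt (2 ^ k))\<^sup>2) = (\<Sum>k<N. (1/2) ^ k)"
    by (intro sum.cong) (auto simp: power_divide)
  also have "\<dots> * (\<Sum>k<N. (sqrt (2 ^ k) * norm (\<zeta> k))\<^sup>2) \<le> 2 * (\<Sum>k<N. (sqrt (2 ^ k) * norm (\<zeta> k))\<^sup>2)"
    by (intro mult_right_mono sum_nonneg) (auto simp: sum_gp_strict)
  also have "(\<Sum>k<N. (sqrt (2 ^ k) * norm (\<zeta> k))\<^sup>2) = (decomp_cost \<zeta> N)\<^sup>2"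
    by (simp add: decomp_cost_sq power_mult_distrib)
  finally show ?thesis .
qed

section \<open>The infimal convolution as an equivalent norm and its growth in the directions of one
  subspace\<close>

context
  fixes K :: "nat \<Rightarrow> 'a::real_normed_vector set"
  assumes K_sys: "K 0 = UNIV \<and> (\<forall>k. subspace (K k))"
begin

lemma subspace_summand: "subspace (K k)" and summand_0: "K 0 = UNIV"
  using K_sys by auto

lemma decomposes_triv: "decomposes K z 1 (\<lambda>k. if k = 0 then z else 0)"
  using subspace_summand summand_0 by (auto simp: decomposes_def subspace_0)

lemma conv_norm_le: "decomposes K z N \<zeta> \<Longrightarrow> conv_norm K z \<le> decomp_cost \<zeta> N"
  unfolding conv_norm_def
  by (rule cInf_lower) (auto intro!: bdd_belowI[of _ 0] simp: decomp_cost_nonneg)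

lemma conv_norm_ge: "(\<And>N \<zeta>. decomposes K z N \<zeta> \<Longrightarrow> b \<le> decomp_cost \<zeta> N) \<Longrightarrow> b \<le> conv_norm K z"
  unfolding conv_norm_def using decomposes_triv by (intro cInf_greatest) blast+

lemma conv_norm_nonneg: "conv_norm K z \<ge> 0"
  by (rule conv_norm_ge) (rule decomp_cost_nonneg)

lemma conv_norm_le_norm: "conv_norm K z \<le> norm z"
  using conv_norm_le[OF decomposes_triv[of z]] by (simp add: decomp_cost_def L2_set_def)

lemma norm_le_conv_norm: "norm z \<le> sqrt 2 * conv_norm K z"
proof -
  have "norm z / sqrt 2 \<le> conv_norm K z"
  proof (rule conv_norm_ge)
    fix N \<zeta> assume "decomposes K z N \<zeta>"
    hence "(norm z)\<^sup>2 \<le> 2 * (decomp_cost \<zeta> N)\<^sup>2"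
      using norm_sum_le_decomp_cost[of \<zeta> N] by (auto simp: decomposes_def)
    hence "norm z \<le> sqrt (2 * (decomp_cost \<zeta> N)\<^sup>2)" by (rule real_le_rsqrt)
    thus "norm z / sqrt 2 \<le> decomp_cost \<zeta> N"
      by (simp add: real_sqrt_mult decomp_cost_nonneg field_simps)
  qed
  thus ?thesis by (simp add: field_simps)
qed

text \<open>Padding a decomposition with zeros costs nothing, so the length can exceed any
  prescribed \<open>n\<close>. The summand with index \<open>n\<close> is the one perturbed
  later.\<close>

lemma conv_norm_near:
  assumes "\<delta> > 0"
  obtains N \<zeta> where "decomposes K z N \<zeta>" "(decomp_cost \<zeta> N)\<^sup>2 < (conv_norm K z)\<^sup>2 + \<delta>" "n < N"
proof -
  have "\<exists>N \<zeta>. decomposes K z N \<zeta> \<and> (decomp_cost \<zeta> N)\<^sup>2 < (conv_norm K z)\<^sup>2 + \<delta>"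
  proof (rule ccontr)
    assume *: "\<not> ?thesis"
    have "sqrt ((conv_norm K z)\<^sup>2 + \<delta>) \<le> conv_norm K z"
    proof (rule conv_norm_ge)
      fix N \<zeta> assume "decomposes K z N \<zeta>"
      with * have "(conv_norm K z)\<^sup>2 + \<delta> \<le> (decomp_cost \<zeta> N)\<^sup>2" by force
      thus "sqrt ((conv_norm K z)\<^sup>2 + \<delta>) \<le> decomp_cost \<zeta> N"
        by (intro real_le_lsqrt) (auto simp: decomp_cost_nonneg)
    qed
    hence "(conv_norm K z)\<^sup>2 + \<delta> \<le> (conv_norm K z)\<^sup>2"
      using sqrt_le_D by blast
    with assms show False by simp
  qed
  then obtain N \<zeta> where N: "decomposes K z N \<zeta>" "(decomp_cost \<zeta> N)\<^sup>2 < (conv_norm K z)\<^sup>2 + \<delta>"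
    by blast
  have "decomposes K z (max N (Suc n)) \<zeta>" using N(1) by (rule decomposes_mono) simp
  moreover have "decomp_cost \<zeta> (max N (Suc n)) = decomp_cost \<zeta> N"
    using N(1) by (intro decomp_cost_mono) (auto simp: decomposes_def)
  ultimately show ?thesis using N(2) that[of "max N (Suc n)" \<zeta>] by simp
qed

lemma decomposes_add:
  assumes "decomposes K x N \<zeta>" "decomposes K y N \<xi>"
  shows "decomposes K (x + y) N (\<lambda>k. \<zeta> k + \<xi> k)"
  using assms subspace_summand by (auto simp: decomposes_def sum.distrib subspace_add)

lemma decomposes_scale:
  assumes "decomposes K x N \<zeta>"
  shows "decomposes K (c *\<^sub>R x) N (\<lambda>k. c *\<^sub>R \<zeta> k)"
  using assms subspace_summand by (auto simp: decomposes_def scaleR_right.sum subspace_scale)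

lemma conv_norm_scale_le:
  assumes "c \<noteq> 0"
  shows "conv_norm K (c *\<^sub>R x) \<le> \<bar>c\<bar> * conv_norm K x"
proof -
  have "conv_norm K (c *\<^sub>R x) / \<bar>c\<bar> \<le> conv_norm K x"
  proof (rule conv_norm_ge)
    fix N \<zeta> assume "decomposes K x N \<zeta>"
    hence "conv_norm K (c *\<^sub>R x) \<le> decomp_cost (\<lambda>k. c *\<^sub>R \<zeta> k) N"
      by (intro conv_norm_le decomposes_scale)
    also have "\<dots> = \<bar>c\<bar> * decomp_cost \<zeta> N"
      by (simp add: decomp_cost_def L2_set_right_distrib mult_ac)
    finally show "conv_norm K (c *\<^sub>R x) / \<bar>c\<bar> \<le> decomp_cost \<zeta> N"
      using assms by (simp add: field_simps)
  qed
  thus ?thesis using assms by (simp add: field_simps)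
qed

lemma conv_norm_add_le: "conv_norm K (x + y) \<le> conv_norm K x + conv_norm K y"
proof -
  have *: "conv_norm K (x + y) \<le> decomp_cost \<zeta> N + decomp_cost \<xi> M"
    if d: "decomposes K x N \<zeta>" "decomposes K y M \<xi>" for N \<zeta> M \<xi>
  proof -
    define L where "L = max N M"
    have "decomposes K (x + y) L (\<lambda>k. \<zeta> k + \<xi> k)"
      by (intro decomposes_add decomposes_mono[OF d(1)] decomposes_mono[OF d(2)]) (auto simp: L_def)
    hence "conv_norm K (x + y) \<le> decomp_cost (\<lambda>k. \<zeta> k + \<xi> k) L" by (rule conv_norm_le)
    also have "\<dots> \<le> L2_set (\<lambda>k. sqrt (2 ^ k) * norm (\<zeta> k) + sqrt (2 ^ k) * norm (\<xi> k)) {..<L}"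
      unfolding decomp_cost_def
      by (intro L2_set_mono) (auto simp: norm_triangle_ineq simp flip: distrib_left)
    also have "\<dots> \<le> decomp_cost \<zeta> L + decomp_cost \<xi> L"
      unfolding decomp_cost_def by (rule L2_set_triangle_ineq)
    also have "decomp_cost \<zeta> L = decomp_cost \<zeta> N"
      using d by (intro decomp_cost_mono) (auto simp: decomposes_def L_def)
    also have "decomp_cost \<xi> L = decomp_cost \<xi> M"
      using d by (intro decomp_cost_mono) (auto simp: decomposes_def L_def)
    finally show ?thesis .
  qed
  have "conv_norm K (x + y) - conv_norm K y \<le> conv_norm K x"
  proof (rule conv_norm_ge)
    fix N \<zeta> assume d: "decomposes K x N \<zeta>"
    have "conv_norm K (x + y) - decomp_cost \<zeta> N \<le> conv_norm K y"
    proof (rule conv_norm_ge)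
      fix M \<xi> assume "decomposes K y M \<xi>"
      from *[OF d this] show "conv_norm K (x + y) - decomp_cost \<zeta> N \<le> decomp_cost \<xi> M" by simp
    qed
    thus "conv_norm K (x + y) - conv_norm K y \<le> decomp_cost \<zeta> N" by simp
  qed
  thus ?thesis by simp
qed

lemma sublinear_conv_norm: "sublinear (conv_norm K)"
  unfolding sublinear_def
proof (intro conjI allI impI)
  show "conv_norm K (x + y) \<le> conv_norm K x + conv_norm K y" for x y
    by (rule conv_norm_add_le)
  show "conv_norm K (c *\<^sub>R x) \<le> c * conv_norm K x" if "c > 0" for c x
    using conv_norm_scale_le[of c x] that by simp
qed

lemma conv_norm_minus: "conv_norm K (- x) = conv_norm K x"
  using conv_norm_scale_le[of "-1" x] conv_norm_scale_le[of "-1" "-x"] by simp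

text \<open>The single summand \<open>\<zeta> n\<close> can absorb \<open>h\<close> because
  \<open>K n\<close> is a subspace, and only one term of the cost changes.\<close>

lemma conv_norm_perturb_le:
  assumes d: "decomposes K z N \<zeta>" and n: "n < N" and h: "h \<in> K n"
  shows "(conv_norm K (z + h))\<^sup>2 \<le> (decomp_cost \<zeta> N)\<^sup>2 + 2 ^ n * ((norm (\<zeta> n + h))\<^sup>2 - (norm (\<zeta> n))\<^sup>2)"
proof -
  have split: "(\<Sum>k<N. g k) = g n + (\<Sum>k\<in>{..<N} - {n}. g k)" for g :: "nat \<Rightarrow> 'b::comm_monoid_add"
    using n by (intro sum.remove) auto
  define \<xi> where "\<xi> = \<zeta>(n := \<zeta> n + h)"
  have eq: "(\<Sum>k\<in>{..<N} - {n}. g (\<xi> k) k) = (\<Sum>k\<in>{..<N} - {n}. g (\<zeta> k) k)"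
    for g :: "'a \<Rightarrow> nat \<Rightarrow> 'b::comm_monoid_add"
    by (intro sum.cong) (auto simp: \<xi>_def)
  have "(\<Sum>k<N. \<xi> k) = (\<Sum>k<N. \<zeta> k) + h"
    using eq[of "\<lambda>x _. x"] by (simp add: split) (simp add: \<xi>_def)
  hence "decomposes K (z + h) N \<xi>"
    using d n h subspace_summand by (auto simp: decomposes_def \<xi>_def subspace_add)
  hence "conv_norm K (z + h) \<le> decomp_cost \<xi> N" by (rule conv_norm_le)
  hence "(conv_norm K (z + h))\<^sup>2 \<le> (decomp_cost \<xi> N)\<^sup>2"
    by (intro power_mono conv_norm_nonneg)
  also have "\<dots> = (decomp_cost \<zeta> N)\<^sup>2 + 2 ^ n * ((norm (\<zeta> n + h))\<^sup>2 - (norm (\<zeta> n))\<^sup>2)"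
    using eq[of "\<lambda>x k. 2 ^ k * (norm x)\<^sup>2"]
    by (simp add: decomp_cost_sq split) (simp add: \<xi>_def algebra_simps)
  finally show ?thesis .
qed

text \<open>If \<open>\<phi>\<close> is almost zero on \<open>K n\<close>, a nearly optimal
  decomposition has a small summand \<open>\<zeta> n\<close>: deleting it lowers the squared cost by
  \<open>2 ^ n * (norm (\<zeta> n))\<^sup>2\<close>, but lowers the value of \<open>\<phi>\<close>
  by at most \<open>e * norm (\<zeta> n)\<close>. With
  \<open>2 ^ n * norm (\<zeta> n) \<le> 3 * e\<close>, the linear term of the squared norm in the
  perturbation formula is at most \<open>6 * e * norm h\<close>.\<close>

lemma conv_norm_upper_on_K:
  assumes \<phi>: "linear \<phi>" "\<And>x. \<phi> x \<le> conv_norm K x" "\<phi> z = 1" "conv_norm K z = 1"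
    and e: "e > 0" "\<And>h. h \<in> K n \<Longrightarrow> \<phi> h \<le> e * norm h" and h: "h \<in> K n"
  shows "(conv_norm K (z + h))\<^sup>2 \<le> 1 + 6 * e * norm h + 2 ^ n * (norm h)\<^sup>2"
proof (rule field_le_epsilon)
  fix \<eta> :: real assume \<eta>: "\<eta> > 0"
  \<comment> \<open>If \<open>2 ^ n * norm (\<zeta> n)\<close> exceeded \<open>3 * e\<close>,
    deleting \<open>\<zeta> n\<close> would give \<open>e * norm (\<zeta> n) \<le> \<delta>\<close>;
    the second bound on \<open>\<delta>\<close> turns this into a contradiction.\<close>
  define \<delta> where "\<delta> = min \<eta> (3 * e\<^sup>2 / 2 ^ n)"
  have "\<delta> > 0" using \<eta> e by (simp add: \<delta>_def)
  then obtain N \<zeta> where d: "decomposes K z N \<zeta>" "(decomp_cost \<zeta> N)\<^sup>2 < 1 + \<delta>" "n < N"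
    using conv_norm_near[of \<delta> z n] \<phi>(4) by auto
  have \<zeta>n: "\<zeta> n \<in> K n" using d by (auto simp: decomposes_def)
  have small: "2 ^ n * norm (\<zeta> n) \<le> 3 * e"
  proof (rule ccontr)
    assume "\<not> ?thesis"
    hence large: "2 ^ n * norm (\<zeta> n) > 3 * e" by simp
    have "1 - 2 * (e * norm (\<zeta> n)) \<le> (conv_norm K (z - \<zeta> n))\<^sup>2"
    proof -
      have "1 - e * norm (\<zeta> n) \<le> \<phi> (z - \<zeta> n)"
        using e(2)[OF \<zeta>n] \<phi> by (simp add: linear_diff)
      also have "\<dots> \<le> conv_norm K (z - \<zeta> n)" by (rule \<phi>)
      finally have a: "1 - e * norm (\<zeta> n) \<le> conv_norm K (z - \<zeta> n)" .
      have sq: "1 - 2 * t \<le> (1 - t)\<^sup>2" for t :: real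
        by (simp add: power2_eq_square algebra_simps)
      show ?thesis
      proof (cases "1 - e * norm (\<zeta> n) \<ge> 0")
        case True
        have "(1 - e * norm (\<zeta> n))\<^sup>2 \<le> (conv_norm K (z - \<zeta> n))\<^sup>2"
          using a True by (intro power_mono)
        with sq[of "e * norm (\<zeta> n)"] show ?thesis by linarith
      next
        case False
        have "0 \<le> (conv_norm K (z - \<zeta> n))\<^sup>2" by simp
        with False show ?thesis by linarith
      qed
    qed
    also have "\<dots> \<le> (decomp_cost \<zeta> N)\<^sup>2 + 2 ^ n * ((norm (\<zeta> n + - \<zeta> n))\<^sup>2 - (norm (\<zeta> n))\<^sup>2)"
      using conv_norm_perturb_le[OF d(1,3), of "- \<zeta> n"] \<zeta>n subspace_summand by (simp add: subspace_neg)
    finally have "2 ^ n * norm (\<zeta> n) * norm (\<zeta> n) \<le> \<delta> + 2 * (e * norm (\<zeta> n))"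
      using d(2) by (simp add: power2_eq_square algebra_simps)
    moreover have "3 * e * norm (\<zeta> n) \<le> 2 ^ n * norm (\<zeta> n) * norm (\<zeta> n)"
      using large by (intro mult_right_mono) auto
    ultimately have "e * norm (\<zeta> n) \<le> \<delta>" by simp
    hence "e * norm (\<zeta> n) \<le> 3 * e\<^sup>2 / 2 ^ n" by (simp add: \<delta>_def)
    hence "e * (2 ^ n * norm (\<zeta> n)) \<le> e * (3 * e)" by (simp add: field_simps power2_eq_square)
    hence "2 ^ n * norm (\<zeta> n) \<le> 3 * e" using e(1) by simp
    with large show False by simp
  qed
  have "(norm (\<zeta> n + h))\<^sup>2 \<le> (norm (\<zeta> n) + norm h)\<^sup>2"
    by (intro power_mono norm_triangle_ineq) auto
  hence "2 ^ n * ((norm (\<zeta> n + h))\<^sup>2 - (norm (\<zeta> n))\<^sup>2) \<le> 2 ^ n * (2 * norm (\<zeta> n) * norm h + (norm h)\<^sup>2)"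
    by (intro mult_left_mono) (auto simp: power2_eq_square algebra_simps)
  also have "\<dots> = 2 * (2 ^ n * norm (\<zeta> n)) * norm h + 2 ^ n * (norm h)\<^sup>2"
    by (simp add: algebra_simps)
  also have "\<dots> \<le> 2 * (3 * e) * norm h + 2 ^ n * (norm h)\<^sup>2"
    using small by (intro add_right_mono mult_right_mono mult_left_mono) auto
  finally have "2 ^ n * ((norm (\<zeta> n + h))\<^sup>2 - (norm (\<zeta> n))\<^sup>2) \<le> 6 * e * norm h + 2 ^ n * (norm h)\<^sup>2"
    by simp
  moreover have "\<delta> \<le> \<eta>" by (simp add: \<delta>_def)
  ultimately show "(conv_norm K (z + h))\<^sup>2 \<le> 1 + 6 * e * norm h + 2 ^ n * (norm h)\<^sup>2 + \<eta>"
    using conv_norm_perturb_le[OF d(1,3) h] d(2) by linarith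
qed

end


text \<open>The kernel \<open>K n\<close> of \<open>g\<close> has codimension one in
  \<open>Y\<close> and does not contain \<open>z\<close>. Writing \<open>h = a z + k\<close> with
  \<open>k\<close> in the kernel, the direction \<open>z\<close> is handled by homogeneity and
  \<open>k\<close> by the estimate on \<open>K n\<close>; closeness of \<open>\<phi>\<close> and
  \<open>g\<close> makes \<open>a\<close> agree with \<open>\<phi> h\<close> up to a multiple of
  \<open>e * norm h\<close>.\<close>

lemma conv_norm_upper:
  fixes K :: "nat \<Rightarrow> 'a::real_normed_vector set"
  assumes K: "K 0 = UNIV \<and> (\<forall>k. subspace (K k))" and Y: "subspace Y"
    and \<phi>: "linear \<phi>" "\<And>x. \<phi> x \<le> conv_norm K x" "\<phi> z = 1" "conv_norm K z = 1" and z: "z \<in> Y"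
    and g: "\<And>x y. x \<in> Y \<Longrightarrow> y \<in> Y \<Longrightarrow> g (x + y) = g x + g y" "\<And>c x. x \<in> Y \<Longrightarrow> g (c *\<^sub>R x) = c * g x"
    and Kn: "K n = {y \<in> Y. g y = 0}"
    and e: "e > 0" "e \<le> 1/4" "\<And>y. y \<in> Y \<Longrightarrow> \<bar>\<phi> y - g y\<bar> \<le> e * norm y"
  shows "\<exists>d>0. \<forall>h\<in>Y. norm h < d \<longrightarrow> (conv_norm K (z + h))\<^sup>2 \<le> 1 + 2 * \<phi> h + 200 * e * norm h"
proof -
  \<comment> \<open>The quadratic error consists of \<open>a\<^sup>2\<close> with
    \<open>\<bar>a\<bar> \<le> 4 * norm h\<close>, and of \<open>2 ^ n * (norm k)\<^sup>2\<close>
    with \<open>norm k \<le> 9 * norm h\<close>.\<close>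
  define C :: real where "C = 16 + 81 * 2 ^ n"
  have C: "C > 0" unfolding C_def by (intro add_pos_pos) auto
  have normz: "norm z \<le> 2"
  proof -
    have "norm z \<le> sqrt 2 * 1" using norm_le_conv_norm[OF K, of z] \<phi>(4) by simp
    also have "sqrt 2 \<le> sqrt 4" by (intro real_sqrt_le_mono) simp
    finally show ?thesis by simp
  qed
  have gz: "g z \<ge> 1/2"
  proof -
    have "\<bar>\<phi> z - g z\<bar> \<le> (1/4) * 2"
      using e(3)[OF z] mult_mono[OF e(2) normz] by simp
    with \<phi>(3) show ?thesis by linarith
  qed
  have \<phi>_le: "\<bar>\<phi> h\<bar> \<le> norm h" for h
    using \<phi>(2)[of h] \<phi>(2)[of "-h"] conv_norm_le_norm[OF K, of h] conv_norm_le_norm[OF K, of "-h"]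
      linear_neg[OF \<phi>(1), of h] by (simp add: abs_le_iff)
  have main: "(conv_norm K (z + h))\<^sup>2 \<le> 1 + 2 * \<phi> h + 150 * e * norm h + C * (norm h)\<^sup>2"
    if h: "h \<in> Y" "norm h < 1/8" for h
  proof -
    define a where "a = g h / g z"
    define k where "k = h - a *\<^sub>R z"
    have gh: "\<bar>g h\<bar> \<le> 2 * norm h"
    proof -
      have "e * norm h \<le> 1 * norm h" using e(2) by (intro mult_right_mono) auto
      thus ?thesis using e(3)[OF h(1)] \<phi>_le[of h] by linarith
    qed
    have a: "\<bar>a\<bar> \<le> 4 * norm h"
    proof -
      have "\<bar>g h\<bar> / g z \<le> (2 * norm h) / (1/2)"
        using gh gz by (intro frac_le) auto
      thus ?thesis using gz by (simp add: a_def)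
    qed
    hence a2: "\<bar>a\<bar> \<le> 1/2" using h by simp
    have kY: "k \<in> Y" using h z Y by (simp add: k_def subspace_diff subspace_scale)
    have "g h = g (k + a *\<^sub>R z)" by (simp add: k_def)
    also have "\<dots> = g k + a * g z" using kY z Y by (simp add: g subspace_scale)
    finally have gk: "g k = 0" using gz by (simp add: a_def)
    have normk: "norm k \<le> 9 * norm h"
    proof -
      have "norm k \<le> norm h + \<bar>a\<bar> * norm z" unfolding k_def by (rule order_trans[OF norm_triangle_ineq4]) simp
      also have "\<bar>a\<bar> * norm z \<le> (4 * norm h) * 2" using a normz by (intro mult_mono) auto
      finally show ?thesis by simp
    qed
    \<comment> \<open>The factorization \<open>z + h = b (z + l)\<close> with \<open>l\<close> in
      \<open>K n\<close> reduces the claim to a perturbation of \<open>z\<close> inside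
      \<open>K n\<close>.\<close>
    define b where "b = 1 + a"
    have b: "1/2 \<le> b" "b \<le> 2" using a2 by (auto simp: b_def abs_le_iff)
    define l where "l = (1/b) *\<^sub>R k"
    have lK: "l \<in> K n" using kY gk Y by (auto simp: Kn l_def subspace_scale g)
    have "b *\<^sub>R (z + l) = b *\<^sub>R z + k" using b by (simp add: l_def scaleR_add_right)
    hence "z + h = b *\<^sub>R (z + l)" by (simp add: b_def k_def scaleR_add_left)
    hence "conv_norm K (z + h) = b * conv_norm K (z + l)"
      using b by (simp add: sublinear_scale[OF sublinear_conv_norm[OF K]])
    hence "(conv_norm K (z + h))\<^sup>2 = b\<^sup>2 * (conv_norm K (z + l))\<^sup>2"
      by (simp add: power_mult_distrib)
    also have "\<dots> \<le> b\<^sup>2 * (1 + 6 * e * norm l + 2 ^ n * (norm l)\<^sup>2)"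
      using e(3) by (intro mult_left_mono conv_norm_upper_on_K[OF K \<phi> e(1) _ lK])
        (force simp: Kn)+
    also have "\<dots> = b\<^sup>2 + 6 * e * b * norm k + 2 ^ n * (norm k)\<^sup>2"
      using b by (simp add: l_def field_simps power2_eq_square)
    also have "\<dots> \<le> b\<^sup>2 + 6 * e * 2 * (9 * norm h) + 2 ^ n * (9 * norm h)\<^sup>2"
      using b e normk by (intro add_mono mult_mono power_mono) auto
    also have "b\<^sup>2 = 1 + 2 * a + a\<^sup>2" by (simp add: b_def power2_eq_square algebra_simps)
    finally have "(conv_norm K (z + h))\<^sup>2 \<le> 1 + 2 * a + a\<^sup>2 + 108 * (e * norm h) + 81 * 2 ^ n * (norm h)\<^sup>2"
      by (simp add: power_mult_distrib algebra_simps)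
    moreover have "a\<^sup>2 \<le> (4 * norm h)\<^sup>2" using a by (metis abs_ge_zero power2_abs power_mono)
    moreover have "a \<le> \<phi> h + e * (9 * norm h)"
    proof -
      have "\<phi> h = \<phi> (k + a *\<^sub>R z)" by (simp add: k_def)
      also have "\<dots> = \<phi> k + a" using \<phi> by (simp add: linear_add linear_scale)
      finally have "a = \<phi> h - \<phi> k" by simp
      moreover have "- \<phi> k \<le> e * norm k" using e(3)[OF kY] gk by (simp add: abs_le_iff)
      moreover have "e * norm k \<le> e * (9 * norm h)" using normk e by (intro mult_left_mono) auto
      ultimately show ?thesis by linarith
    qed
    moreover have "0 \<le> e * norm h" using e(1) by simp
    ultimately show ?thesis by (simp add: C_def power_mult_distrib algebra_simps)
  qed
  show ?thesis
  \<comment> \<open>On this ball the quadratic error is at most \<open>e * norm h\<close>, which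
    fits into the gap between 150 and 200.\<close>
  proof (intro exI[of _ "min (1/8) (e / C)"] conjI ballI impI)
    show "min (1/8) (e / C) > 0" using e C by simp
  next
    fix h assume h: "h \<in> Y" "norm h < min (1/8) (e / C)"
    hence "C * norm h \<le> e" using C by (simp add: field_simps)
    hence "C * (norm h)\<^sup>2 \<le> e * norm h"
      using mult_right_mono[of "C * norm h" e "norm h"] by (simp add: power2_eq_square mult_ac)
    moreover have "0 \<le> 49 * (e * norm h)" using e(1) by simp
    ultimately show "(conv_norm K (z + h))\<^sup>2 \<le> 1 + 2 * \<phi> h + 200 * e * norm h"
      using main[of h] h by (simp add: algebra_simps)
  qed
qed

text \<open>The bound with \<open>K\<close> makes the supremum over the unit ball of
  \<open>S\<close> a genuine one; homogeneity then transfers it to all of \<open>S\<close>.\<close>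

lemma le_subspace_dual_norm:
  assumes S: "subspace S" and f: "\<And>c x. x \<in> S \<Longrightarrow> f (c *\<^sub>R x) = c * f x"
    and K: "\<And>x. x \<in> S \<Longrightarrow> \<bar>f x\<bar> \<le> K * norm x" and x: "x \<in> S"
  shows "\<bar>f x\<bar> \<le> subspace_dual_norm S f * norm x"
proof (cases "x = 0")
  case True
  thus ?thesis using f[of x 0] x by simp
next
  case False
  define y where "y = (1 / norm x) *\<^sub>R x"
  have y: "y \<in> S \<inter> cball 0 1" using x S False by (simp add: y_def subspace_scale)
  have "bdd_above ((\<lambda>x. \<bar>f x\<bar>) ` (S \<inter> cball 0 1))"
  proof (rule bdd_aboveI2)
    fix z assume z: "z \<in> S \<inter> cball 0 1"
    have "\<bar>f z\<bar> \<le> K * norm z" using z K by simp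
    also have "\<dots> \<le> \<bar>K\<bar> * 1" using z by (intro mult_mono) auto
    finally show "\<bar>f z\<bar> \<le> \<bar>K\<bar>" by simp
  qed
  hence "\<bar>f y\<bar> \<le> subspace_dual_norm S f"
    unfolding subspace_dual_norm_def by (intro cSUP_upper y)
  moreover have "\<bar>f y\<bar> = \<bar>f x\<bar> / norm x" using x False by (simp add: y_def f abs_mult)
  ultimately show ?thesis using False by (simp add: field_simps)
qed

text \<open>Nonnegativity and definiteness are contained in the last conjunct.\<close>

definition equiv_norm :: "('a::real_normed_vector \<Rightarrow> real) \<Rightarrow> bool" where
  "equiv_norm \<nu> \<longleftrightarrow> sublinear \<nu> \<and> (\<forall>x. \<nu> (- x) = \<nu> x) \<and> (\<forall>x. \<nu> x \<le> norm x) \<and> (\<forall>x. norm x \<le> sqrt 2 * \<nu> x)"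

text \<open>An upper estimate suffices for Frechet differentiability of the convex function \<open>\<nu>\<^sup>2\<close>,
  and it is all that minimization arguments use.\<close>

definition frechet_smooth_on :: "'a::real_normed_vector set \<Rightarrow> ('a \<Rightarrow> real) \<Rightarrow> bool" where
  "frechet_smooth_on Y \<nu> \<longleftrightarrow> (\<forall>z\<in>Y. \<exists>f :: 'a \<Rightarrow>\<^sub>L real. blinfun_apply f z = (\<nu> z)\<^sup>2 \<and>
     (\<forall>h. \<bar>blinfun_apply f h\<bar> \<le> \<nu> z * \<nu> h) \<and>
     (\<forall>e>0. \<exists>d>0. \<forall>h\<in>Y. norm h < d \<longrightarrow> (\<nu> (z + h))\<^sup>2 \<le> (\<nu> z)\<^sup>2 + 2 * blinfun_apply f h + e * norm h))"

text \<open>Smoothness at \<open>z\<close> to accuracy \<open>e\<close> needs only one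
  \<open>g n\<close> close on \<open>Y\<close> to the support functional at \<open>z\<close>.
  Density of the sequence provides it, with an \<open>n\<close> depending on \<open>z\<close> and
  \<open>e\<close>, while the norm itself is the same for all of them.\<close>

lemma smooth_norm_exists:
  fixes Y :: "'a::real_normed_vector set"
  assumes Y: "subspace Y" and sep: "separable_subspace_dual Y"
  obtains \<nu> where "equiv_norm \<nu>" "frechet_smooth_on Y \<nu>"
proof -
  obtain D where D: "countable D" "D \<subseteq> subspace_dual Y"
    "\<And>f e. f \<in> subspace_dual Y \<Longrightarrow> e > 0 \<Longrightarrow> \<exists>g\<in>D. subspace_dual_norm Y (\<lambda>x. f x - g x) < e"
    using sep by (auto simp: separable_subspace_dual_def)
  have restrict_dual: "restrict f Y \<in> subspace_dual Y" if "linear f" "\<And>x. \<bar>f x\<bar> \<le> norm x" for f :: "'a \<Rightarrow> real"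
    using that Y
    by (auto simp: subspace_dual_def linear_add linear_scale subspace_add subspace_scale intro!: exI[of _ 1])
  have "D \<noteq> {}"
    using D(3)[OF restrict_dual[of "\<lambda>_. 0"], of 1] by (auto simp: linear_0 linear_zero)
  define g where "g = from_nat_into D"
  have gD: "g n \<in> subspace_dual Y" for n
    using from_nat_into[OF \<open>D \<noteq> {}\<close>] D(2) by (auto simp: g_def)
  have g_add: "g n (x + y) = g n x + g n y" if "x \<in> Y" "y \<in> Y" for n x y
    using gD[of n] that by (auto simp: subspace_dual_def)
  have g_scale: "g n (c *\<^sub>R x) = c * g n x" if "x \<in> Y" for n x c
    using gD[of n] that by (auto simp: subspace_dual_def)
  \<comment> \<open>Index 0 is reserved for the whole space, which guarantees that decompositions
    exist; hence \<open>g n\<close> belongs to \<open>K (Suc n)\<close>.\<close>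
  define K where "K = (\<lambda>n. case n of 0 \<Rightarrow> UNIV | Suc m \<Rightarrow> {y \<in> Y. g m y = 0})"
  have K: "K 0 = UNIV \<and> (\<forall>n. subspace (K n))"
    using Y g_add g_scale g_scale[of 0 _ 0]
    by (auto simp: K_def subspace_def split: nat.splits)
  define \<nu> where "\<nu> = conv_norm K"
  note sub = sublinear_conv_norm[OF K, folded \<nu>_def]
  have \<nu>: "equiv_norm \<nu>"
    using sub conv_norm_minus[OF K] conv_norm_le_norm[OF K] norm_le_conv_norm[OF K]
    by (simp add: equiv_norm_def \<nu>_def)
  have \<nu>_nonneg: "\<nu> x \<ge> 0" for x using conv_norm_nonneg[OF K] by (simp add: \<nu>_def)
  have "frechet_smooth_on Y \<nu>"
    unfolding frechet_smooth_on_def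
  proof
    fix z assume z: "z \<in> Y"
    show "\<exists>f :: 'a \<Rightarrow>\<^sub>L real. blinfun_apply f z = (\<nu> z)\<^sup>2 \<and>
     (\<forall>h. \<bar>blinfun_apply f h\<bar> \<le> \<nu> z * \<nu> h) \<and>
     (\<forall>e>0. \<exists>d>0. \<forall>h\<in>Y. norm h < d \<longrightarrow> (\<nu> (z + h))\<^sup>2 \<le> (\<nu> z)\<^sup>2 + 2 * blinfun_apply f h + e * norm h)"
    proof (cases "z = 0")
      case True
      have "(\<nu> h)\<^sup>2 \<le> e * norm h" if "norm h < e" for h e
      proof -
        have "(\<nu> h)\<^sup>2 \<le> (norm h)\<^sup>2" using \<nu> \<nu>_nonneg by (intro power_mono) (auto simp: equiv_norm_def)
        also have "\<dots> \<le> e * norm h" using that by (simp add: power2_eq_square mult_right_mono)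
        finally show ?thesis .
      qed
      thus ?thesis
        using True sublinear_zero[OF sub] by (intro exI[of _ 0]) auto
    next
      case False
      define t where "t = \<nu> z"
      have t: "t > 0"
      proof -
        have "norm z \<le> sqrt 2 * t" using \<nu> by (auto simp: equiv_norm_def t_def)
        with False have "0 < sqrt 2 * t" by (smt (verit) zero_less_norm_iff)
        thus ?thesis by (simp add: zero_less_mult_iff)
      qed
      obtain \<phi> where \<phi>: "linear \<phi>" "\<And>x. \<phi> x \<le> \<nu> x" "\<phi> z = \<nu> z"
        using sublinear_support[OF sub] by blast
      have \<phi>_abs: "\<bar>\<phi> h\<bar> \<le> \<nu> h" for h
        using \<phi>(2)[of h] \<phi>(2)[of "-h"] \<nu> linear_neg[OF \<phi>(1), of h]
        by (auto simp: equiv_norm_def abs_le_iff)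
      have \<phi>_norm: "\<bar>\<phi> h\<bar> \<le> norm h" for h
        using \<phi>_abs[of h] \<nu> by (auto simp: equiv_norm_def intro: order_trans)
      have bl: "bounded_linear (\<lambda>h. t * \<phi> h)"
      proof (rule bounded_linear_intro[where K = t])
        show "norm (t * \<phi> h) \<le> norm h * t" for h
          using \<phi>_norm[of h] t by (simp add: abs_mult mult.commute)
      qed (use \<phi>(1) in \<open>auto simp: linear_add linear_scale algebra_simps\<close>)
      \<comment> \<open>Half the derivative of \<open>\<nu>\<^sup>2\<close> at \<open>z\<close>: the
        norm has derivative \<open>\<phi>\<close>, and \<open>t\<close> is its value at
        \<open>z\<close>.\<close>
      define f where "f = Blinfun (\<lambda>h. t * \<phi> h)"
      have f: "blinfun_apply f h = t * \<phi> h" for h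
        using bl by (simp add: f_def bounded_linear_Blinfun_apply)
      define z' where "z' = (1/t) *\<^sub>R z"
      have z': "z' \<in> Y" "\<phi> z' = 1" "\<nu> z' = 1"
        using z Y \<phi> t by (auto simp: z'_def subspace_scale linear_scale sublinear_scale[OF sub] t_def)
      have "\<exists>d>0. \<forall>h\<in>Y. norm h < d \<longrightarrow> (\<nu> (z + h))\<^sup>2 \<le> (\<nu> z)\<^sup>2 + 2 * blinfun_apply f h + e * norm h"
        if e: "e > 0" for e
      proof -
        \<comment> \<open>The estimate is proved at \<open>z / t\<close> and multiplied by
          \<open>t\<^sup>2\<close>, which turns the error \<open>200 * e'\<close> into
          \<open>200 * e' * t\<close>. The cap \<open>1/4\<close> is required by
          \<open>conv_norm_upper\<close>.\<close>
        define e' where "e' = min (1/4) (e / (200 * t))"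
        have e': "e' > 0" "e' \<le> 1/4" using e t by (auto simp: e'_def)
        obtain u where u: "u \<in> D" "subspace_dual_norm Y (\<lambda>x. restrict \<phi> Y x - u x) < e'"
          using D(3)[OF restrict_dual[OF \<phi>(1) \<phi>_norm] e'(1)] by blast
        obtain n where n: "u = g n"
          using u(1) D(1) by (metis from_nat_into_surj g_def)
        obtain M where M: "\<And>x. x \<in> Y \<Longrightarrow> \<bar>g n x\<bar> \<le> M * norm x"
          using gD[of n] unfolding subspace_dual_def by blast
        have close: "\<bar>\<phi> y - g n y\<bar> \<le> e' * norm y" if y: "y \<in> Y" for y
        proof -
          have "\<bar>restrict \<phi> Y y - u y\<bar> \<le> subspace_dual_norm Y (\<lambda>x. restrict \<phi> Y x - u x) * norm y"
          proof (rule le_subspace_dual_norm[OF Y _ _ y, where f = "\<lambda>x. restrict \<phi> Y x - u x" and K = "1 + M"])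
            fix x assume x: "x \<in> Y"
            show "\<bar>restrict \<phi> Y x - u x\<bar> \<le> (1 + M) * norm x"
              using M[OF x] \<phi>_norm[of x] x by (simp add: n algebra_simps)
            show "restrict \<phi> Y (c *\<^sub>R x) - u (c *\<^sub>R x) = c * (restrict \<phi> Y x - u x)" for c
              using x Y \<phi>(1) g_scale[OF x] by (simp add: n subspace_scale linear_scale algebra_simps)
          qed
          also have "\<dots> \<le> e' * norm y" using u(2) by (intro mult_right_mono) auto
          finally show ?thesis using y by (simp add: n)
        qed
        have "\<exists>d>0. \<forall>h\<in>Y. norm h < d \<longrightarrow> (\<nu> (z' + h))\<^sup>2 \<le> 1 + 2 * \<phi> h + 200 * e' * norm h"
          unfolding \<nu>_def
        proof (rule conv_norm_upper[OF K Y \<phi>(1), where g = "g n" and n = "Suc n"])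
          show "\<phi> x \<le> conv_norm K x" for x using \<phi>(2) by (simp add: \<nu>_def)
          show "conv_norm K z' = 1" using z'(3) by (simp add: \<nu>_def)
        qed (use z' e' g_add g_scale close in \<open>auto simp: K_def\<close>)
        then obtain d where d: "d > 0"
          "\<And>h. h \<in> Y \<Longrightarrow> norm h < d \<Longrightarrow> (\<nu> (z' + h))\<^sup>2 \<le> 1 + 2 * \<phi> h + 200 * e' * norm h"
          by blast
        show ?thesis
        proof (intro exI[of _ "t * d"] conjI ballI impI)
          show "t * d > 0" using t d by simp
          fix h assume h: "h \<in> Y" "norm h < t * d"
          define k where "k = (1/t) *\<^sub>R h"
          have k: "k \<in> Y" "norm k < d" using h t Y by (auto simp: k_def subspace_scale field_simps)
          have "z + h = t *\<^sub>R (z' + k)" using t by (simp add: z'_def k_def algebra_simps)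
          hence "(\<nu> (z + h))\<^sup>2 = t\<^sup>2 * (\<nu> (z' + k))\<^sup>2"
            using t by (simp add: sublinear_scale[OF sub] power_mult_distrib)
          also have "\<dots> \<le> t\<^sup>2 * (1 + 2 * \<phi> k + 200 * e' * norm k)"
            using d(2)[OF k] by (intro mult_left_mono) auto
          also have "\<dots> = t\<^sup>2 + 2 * (t * \<phi> h) + (200 * e' * t) * norm h"
            using t \<phi>(1) by (simp add: k_def linear_scale field_simps power2_eq_square)
          also have "200 * e' * t \<le> e" using t by (simp add: e'_def min_def field_simps)
          hence "(200 * e' * t) * norm h \<le> e * norm h" by (intro mult_right_mono) auto
          finally show "(\<nu> (z + h))\<^sup>2 \<le> (\<nu> z)\<^sup>2 + 2 * blinfun_apply f h + e * norm h"
            by (simp add: f t_def)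
        qed
      qed
      moreover have "blinfun_apply f z = (\<nu> z)\<^sup>2" by (simp add: f \<phi>(3) t_def power2_eq_square)
      moreover have "\<bar>blinfun_apply f h\<bar> \<le> \<nu> z * \<nu> h" for h
        using \<phi>_abs[of h] t by (simp add: f abs_mult t_def)
      ultimately show ?thesis by blast
    qed
  qed
  with \<nu> show ?thesis by (rule that)
qed

section \<open>Separable reduction of Frechet normals\<close>

text \<open>Clearing the denominator lets \<open>u = x\<close> in, where both sides vanish. Isolated
  points, at which the limes superior is taken along the trivial filter, then need no separate
  treatment.\<close>

lemma frechet_normal_cone_iff:
  "xs \<in> frechet_normal_cone x S \<longleftrightarrow>
     x \<in> S \<and> (\<forall>e>0. \<exists>d>0. \<forall>u\<in>S. norm (u - x) < d \<longrightarrow> blinfun_apply xs (u - x) \<le> e * norm (u - x))"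
proof -
  let ?q = "\<lambda>u. blinfun_apply xs (u - x) / norm (u - x)"
  have "(Limsup (at x within S) (\<lambda>u. ereal (?q u)) \<le> 0) \<longleftrightarrow>
      (\<forall>e>0. \<forall>\<^sub>F u in at x within S. ?q u < e)"
    unfolding Limsup_le_iff
  proof safe
    fix e :: real assume "\<forall>y>0. \<forall>\<^sub>F u in at x within S. ereal (?q u) < y" "0 < e"
    moreover have "0 < ereal e" using \<open>0 < e\<close> by simp
    ultimately have "\<forall>\<^sub>F u in at x within S. ereal (?q u) < ereal e" by blast
    thus "\<forall>\<^sub>F u in at x within S. ?q u < e" by simp
  next
    fix y :: ereal assume *: "\<forall>e>0. \<forall>\<^sub>F u in at x within S. ?q u < e" and "0 < y"
    then obtain e where e: "0 < ereal e" "ereal e < y" using ereal_dense2 by blast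
    hence "\<forall>\<^sub>F u in at x within S. ?q u < e" using * by simp
    thus "\<forall>\<^sub>F u in at x within S. ereal (?q u) < y"
      proof eventually_elim
      case (elim u)
      hence "ereal (?q u) < ereal e" by simp
      with e(2) show ?case by (rule less_trans[rotated])
    qed
  qed
  also have "\<dots> \<longleftrightarrow> (\<forall>e>0. \<exists>d>0. \<forall>u\<in>S. norm (u - x) < d \<longrightarrow> blinfun_apply xs (u - x) \<le> e * norm (u - x))"
    (is "?L \<longleftrightarrow> ?R")
  proof
    assume L: ?L
    show ?R
    proof safe
      fix e :: real assume "e > 0"
      with L obtain d where d: "d > 0" "\<And>u. u \<in> S \<Longrightarrow> u \<noteq> x \<Longrightarrow> dist u x < d \<Longrightarrow> ?q u < e"
        unfolding eventually_at by blast
      have "blinfun_apply xs (u - x) \<le> e * norm (u - x)" if "u \<in> S" "norm (u - x) < d" for u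
        using d(2)[of u] that by (cases "u = x") (auto simp: dist_norm divide_less_eq blinfun.zero_right)
      with d(1) show "\<exists>d>0. \<forall>u\<in>S. norm (u - x) < d \<longrightarrow> blinfun_apply xs (u - x) \<le> e * norm (u - x)"
        by blast
    qed
  next
    assume R: ?R
    show ?L
    proof safe
      fix e :: real assume e: "e > 0"
      with R obtain d where d: "d > 0"
        "\<And>u. u \<in> S \<Longrightarrow> norm (u - x) < d \<Longrightarrow> blinfun_apply xs (u - x) \<le> (e/2) * norm (u - x)"
        by (metis half_gt_zero)
      have "?q u < e" if "u \<in> S" "u \<noteq> x" "dist u x < d" for u
      proof -
        have "blinfun_apply xs (u - x) \<le> (e/2) * norm (u - x)" using d(2) that by (simp add: dist_norm)
        also have "\<dots> < e * norm (u - x)" using e that by simp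
        finally show ?thesis using that by (simp add: divide_less_eq)
      qed
      thus "\<forall>\<^sub>F u in at x within S. ?q u < e"
        unfolding eventually_at using d(1) by blast
    qed
  qed
  finally show ?thesis
    by (simp add: frechet_normal_cone_def eps_normals_def flip: zero_ereal_def)
qed

lemma frechet_normal_cone_scale:
  assumes "xs \<in> frechet_normal_cone x S" "c > 0"
  shows "c *\<^sub>R xs \<in> frechet_normal_cone x S"
  unfolding frechet_normal_cone_iff
proof safe
  show "x \<in> S" using assms by (simp add: frechet_normal_cone_iff)
  fix e :: real assume "e > 0"
  hence "e / c > 0" using assms by simp
  then obtain d where d: "d > 0"
    "\<And>u. u \<in> S \<Longrightarrow> norm (u - x) < d \<Longrightarrow> blinfun_apply xs (u - x) \<le> (e / c) * norm (u - x)"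
    using assms(1) unfolding frechet_normal_cone_iff by meson
  have "blinfun_apply (c *\<^sub>R xs) (u - x) \<le> e * norm (u - x)" if "u \<in> S" "norm (u - x) < d" for u
    using d(2)[OF that] assms(2) by (simp add: blinfun.scaleR_left field_simps)
  with d(1) show "\<exists>d>0. \<forall>u\<in>S. norm (u - x) < d \<longrightarrow> blinfun_apply (c *\<^sub>R xs) (u - x) \<le> e * norm (u - x)"
    by blast
qed

text \<open>All values \<open>\<phi> v\<close> together form a point of the second-countable space
  of real sequences. One chosen preimage for each basic open set suffices, although the points
  \<open>v\<close> themselves carry no topology.\<close>

lemma countable_approximating_set:
  fixes \<Phi> :: "('b \<Rightarrow> real) set"
  assumes "countable \<Phi>"
  obtains W where "countable W"
    "\<And>v S \<eta>. finite S \<Longrightarrow> S \<subseteq> \<Phi> \<Longrightarrow> \<eta> > 0 \<Longrightarrow> \<exists>w\<in>W. \<forall>\<phi>\<in>S. \<bar>\<phi> w - \<phi> v\<bar> < \<eta>"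
proof -
  define g :: "'b \<Rightarrow> nat \<Rightarrow> real" where "g = (\<lambda>v n. from_nat_into \<Phi> n v)"
  obtain B :: "(nat \<Rightarrow> real) set set" where B: "countable B" "topological_basis B"
    using ex_countable_basis by blast
  define W where "W = (\<lambda>b. SOME v. g v \<in> b) ` B"
  show ?thesis
  proof (rule that)
    show "countable W" using B by (simp add: W_def)
  next
    fix v S and \<eta> :: real assume S: "finite S" "S \<subseteq> \<Phi>" and \<eta>: "\<eta> > 0"
    define U where "U = {h :: nat \<Rightarrow> real. \<forall>n\<in>to_nat_on \<Phi> ` S. \<bar>h n - g v n\<bar> < \<eta>}"
    have "open {h :: nat \<Rightarrow> real. \<bar>h n - c\<bar> < \<eta>}" for n c
      by (intro open_Collect_less continuous_intros continuous_on_product_coordinates)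
    moreover have "U = (\<Inter>n\<in>to_nat_on \<Phi> ` S. {h. \<bar>h n - g v n\<bar> < \<eta>})"
      by (auto simp: U_def)
    ultimately have "open U" using S by auto
    moreover have "g v \<in> U" using \<eta> by (simp add: U_def)
    ultimately obtain b where b: "b \<in> B" "g v \<in> b" "b \<subseteq> U"
      using B(2) topological_basisE by metis
    define w where "w = (SOME v. g v \<in> b)"
    have "g w \<in> b" unfolding w_def by (rule someI[of _ v]) (rule b)
    hence "g w \<in> U" using b by blast
    hence "\<forall>\<phi>\<in>S. \<bar>\<phi> w - \<phi> v\<bar> < \<eta>"
      using S assms by (auto simp: U_def g_def subset_eq)
    moreover have "w \<in> W" using b by (auto simp: W_def w_def)
    ultimately show "\<exists>w\<in>W. \<forall>\<phi>\<in>S. \<bar>\<phi> w - \<phi> v\<bar> < \<eta>" by blast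
  qed
qed

text \<open>An approximate form of being an elementary substructure: a finite tuple
  \<open>v 0, ..., v (N - 1)\<close> is imitated by a tuple in \<open>Y\<close>. Membership in the
  sets \<open>\<Omega> i\<close> is kept exactly, but in one direction only. The three-term
  expressions with rational \<open>q\<close> are those that express additivity and rational
  homogeneity in the limit.\<close>

definition reflecting :: "('i \<Rightarrow> 'a::real_normed_vector set) \<Rightarrow> 'i set \<Rightarrow> ('a \<Rightarrow> real) \<Rightarrow> 'a set \<Rightarrow> bool" where
  "reflecting \<Omega> I f Y \<longleftrightarrow> (\<forall>v :: nat \<Rightarrow> 'a. \<forall>E Q J N \<eta>. finite E \<longrightarrow> E \<subseteq> Y \<longrightarrow> finite Q \<longrightarrow> finite J \<longrightarrow> J \<subseteq> I \<longrightarrow> \<eta> > 0 \<longrightarrow>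
     (\<exists>w. \<forall>l<N. w l \<in> Y \<and> \<bar>f (w l) - f (v l)\<bar> < \<eta> \<and> (\<forall>i\<in>J. v l \<in> \<Omega> i \<longrightarrow> w l \<in> \<Omega> i) \<and>
        (\<forall>y\<in>E. \<bar>norm (w l - y) - norm (v l - y)\<bar> < \<eta>) \<and>
        (\<forall>m<N. \<forall>n<N. \<forall>q\<in>Q. \<bar>norm (w l - real_of_rat q *\<^sub>R w m - w n) - norm (v l - real_of_rat q *\<^sub>R v m - v n)\<bar> < \<eta>)))"

text \<open>A Loewenheim-Skolem closure argument: each step adds approximate witnesses for all finite
  systems of conditions with parameters in the countable set reached so far.\<close>

lemma reflecting_exists:
  fixes \<Omega> :: "'i \<Rightarrow> 'a::real_normed_vector set" and A :: "'a set"
  assumes I: "countable I" and A: "countable A"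
  obtains Y where "countable Y" "A \<subseteq> Y" "reflecting \<Omega> I f Y"
proof -
  define dst where "dst = (\<lambda>(l::nat, y) (v::nat \<Rightarrow> 'a). norm (v l - y))"
  define cmb where "cmb = (\<lambda>(l::nat, m::nat, n::nat, q) (v::nat \<Rightarrow> 'a). norm (v l - real_of_rat q *\<^sub>R v m - v n))"
  define evl where "evl = (\<lambda>(l::nat) (v::nat \<Rightarrow> 'a). f (v l))"
  define mem where "mem = (\<lambda>(l::nat, i) (v::nat \<Rightarrow> 'a). if v l \<in> \<Omega> i then 1 else (0::real))"
  define \<Phi> where "\<Phi> = (\<lambda>B. dst ` (UNIV \<times> B) \<union> range cmb \<union> range evl \<union> mem ` (UNIV \<times> I))"
  have "countable (\<Phi> B)" if "countable B" for B
    using that I by (auto simp: \<Phi>_def)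
  hence "\<exists>W. countable W \<and> (\<forall>v S \<eta>. finite S \<longrightarrow> S \<subseteq> \<Phi> B \<longrightarrow> \<eta> > 0 \<longrightarrow> (\<exists>w\<in>W. \<forall>\<phi>\<in>S. \<bar>\<phi> w - \<phi> v\<bar> < \<eta>))"
    if "countable B" for B
    using countable_approximating_set[of "\<Phi> B"] that by metis
  then obtain W where W: "\<And>B. countable B \<Longrightarrow> countable (W B)"
    "\<And>B v S \<eta>. countable B \<Longrightarrow> finite S \<Longrightarrow> S \<subseteq> \<Phi> B \<Longrightarrow> \<eta> > 0 \<Longrightarrow> \<exists>w\<in>W B. \<forall>\<phi>\<in>S. \<bar>\<phi> w - \<phi> v\<bar> < \<eta>"
    by metis
  define C where "C = rec_nat A (\<lambda>_ B. B \<union> (\<Union>w\<in>W B. range w))"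
  have C0: "C 0 = A" and CS: "C (Suc n) = C n \<union> (\<Union>w\<in>W (C n). range w)" for n
    by (simp_all add: C_def)
  have cC: "countable (C n)" for n
    by (induction n) (use A W in \<open>auto simp: C0 CS\<close>)
  have mono: "C m \<subseteq> C n" if "m \<le> n" for m n
    using that by (induction n rule: dec_induct) (auto simp: CS)
  define Y where "Y = (\<Union>n. C n)"
  show ?thesis
  proof (rule that)
    show "countable Y" using cC by (simp add: Y_def)
    show "A \<subseteq> Y" using C0 by (auto simp: Y_def)
    show "reflecting \<Omega> I f Y"
      unfolding reflecting_def
    proof (intro allI impI)
      fix v :: "nat \<Rightarrow> 'a" and E J N and Q :: "rat set" and \<eta> :: real
      assume E: "finite E" "E \<subseteq> Y" and Q: "finite Q" and J: "finite J" "J \<subseteq> I" and \<eta>: "\<eta> > 0"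
      have "\<exists>n. E \<subseteq> C n"
        using E
      proof (induction E rule: finite_induct)
        case (insert e E)
        then obtain n k where "E \<subseteq> C n" "e \<in> C k" by (auto simp: Y_def)
        with mono[of n "max n k"] mono[of k "max n k"] have "insert e E \<subseteq> C (max n k)" by auto
        thus ?case by blast
      qed auto
      then obtain n where n: "E \<subseteq> C n" by blast
      define S where "S = dst ` ({..<N} \<times> E) \<union> cmb ` ({..<N} \<times> {..<N} \<times> {..<N} \<times> Q) \<union> evl ` {..<N}
        \<union> mem ` ({..<N} \<times> J)"
      have S: "finite S" "S \<subseteq> \<Phi> (C n)"
        using E Q J n unfolding S_def \<Phi>_def by (blast intro!: finite_UnI finite_imageI finite_cartesian_product finite_lessThan)+
      \<comment> \<open>Accuracy below 1 preserves the 0/1-valued functions \<open>mem\<close>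
        exactly.\<close>
      have "min \<eta> 1 > 0" using \<eta> by simp
      from W(2)[OF cC S this, of v] obtain w where w: "w \<in> W (C n)" "\<And>\<phi>. \<phi> \<in> S \<Longrightarrow> \<bar>\<phi> w - \<phi> v\<bar> < min \<eta> 1"
        by blast
      show "\<exists>w. \<forall>l<N. w l \<in> Y \<and> \<bar>f (w l) - f (v l)\<bar> < \<eta> \<and> (\<forall>i\<in>J. v l \<in> \<Omega> i \<longrightarrow> w l \<in> \<Omega> i) \<and>
        (\<forall>y\<in>E. \<bar>norm (w l - y) - norm (v l - y)\<bar> < \<eta>) \<and>
        (\<forall>m<N. \<forall>n<N. \<forall>q\<in>Q. \<bar>norm (w l - real_of_rat q *\<^sub>R w m - w n) - norm (v l - real_of_rat q *\<^sub>R v m - v n)\<bar> < \<eta>)"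
      proof (intro exI[of _ w] allI impI conjI ballI)
        fix l assume l: "l < N"
        have "w l \<in> C (Suc n)" using w(1) by (auto simp: CS)
        thus "w l \<in> Y" by (auto simp: Y_def)
        have "evl l \<in> S" using l by (auto simp: S_def)
        thus "\<bar>f (w l) - f (v l)\<bar> < \<eta>" using w(2)[of "evl l"] by (simp add: evl_def)
        show "w l \<in> \<Omega> i" if i: "i \<in> J" "v l \<in> \<Omega> i" for i
        proof -
          have "mem (l, i) \<in> S" using l i by (auto simp: S_def)
          hence "\<bar>mem (l, i) w - mem (l, i) v\<bar> < 1" using w(2)[of "mem (l, i)"] by simp
          thus ?thesis using i by (auto simp: mem_def split: if_splits)
        qed
        show "\<bar>norm (w l - y) - norm (v l - y)\<bar> < \<eta>" if "y \<in> E" for y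
        proof -
          have "dst (l, y) \<in> S" using l that by (auto simp: S_def)
          thus ?thesis using w(2)[of "dst (l, y)"] by (simp add: dst_def)
        qed
        show "\<bar>norm (w l - real_of_rat q *\<^sub>R w m - w n) - norm (v l - real_of_rat q *\<^sub>R v m - v n)\<bar> < \<eta>"
          if "m < N" "n < N" "q \<in> Q" for m n q
        proof -
          have "cmb (l, m, n, q) \<in> S" using l that unfolding S_def by blast
          thus ?thesis using w(2)[of "cmb (l, m, n, q)"] by (simp add: cmb_def)
        qed
      qed
    qed
  qed
qed

text \<open>Reflect the triple \<open>a + q b\<close>, \<open>b\<close>, \<open>a\<close> with
  \<open>a\<close> and \<open>b\<close> as parameters: the last two images are close to
  \<open>b\<close> and \<open>a\<close>, and the first is close to the corresponding combination of
  them. Hence a point of \<open>Y\<close> approximates \<open>a + q b\<close>; real scalars and the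
  closure follow by limits.\<close>

lemma reflecting_closure_subspace:
  fixes Y :: "'a::real_normed_vector set"
  assumes Y: "reflecting \<Omega> I f Y" and 0: "0 \<in> Y"
  shows "subspace (closure Y)"
proof -
  have rat: "a + real_of_rat q *\<^sub>R b \<in> closure Y" if ab: "a \<in> Y" "b \<in> Y" for a b q
    unfolding closure_approachable
  proof safe
    fix e :: real assume e: "e > 0"
    \<comment> \<open>The three approximations contribute \<open>\<eta>\<close>,
      \<open>\<bar>q\<bar> * \<eta>\<close> and \<open>\<eta>\<close>.\<close>
    define M where "M = \<bar>real_of_rat q\<bar> + 2"
    define \<eta> where "\<eta> = e / M"
    have M: "M > 0" unfolding M_def by (intro add_nonneg_pos abs_ge_zero) simp
    hence \<eta>: "\<eta> > 0" using e by (simp add: \<eta>_def)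
    define v where "v = (\<lambda>l::nat. if l = 0 then a + real_of_rat q *\<^sub>R b else if l = 1 then b else a)"
    obtain w where w: "\<And>l. l < 3 \<Longrightarrow> w l \<in> Y"
      "\<And>l y. l < 3 \<Longrightarrow> y \<in> {a, b} \<Longrightarrow> \<bar>norm (w l - y) - norm (v l - y)\<bar> < \<eta>"
      "\<And>l m n. l < 3 \<Longrightarrow> m < 3 \<Longrightarrow> n < 3 \<Longrightarrow>
        \<bar>norm (w l - real_of_rat q *\<^sub>R w m - w n) - norm (v l - real_of_rat q *\<^sub>R v m - v n)\<bar> < \<eta>"
      using Y[unfolded reflecting_def, rule_format, of "{a, b}" "{q}" "{}" \<eta> 3 v] ab \<eta> by auto
    have 1: "norm (w 1 - b) < \<eta>" using w(2)[of 1 b] by (simp add: v_def)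
    have 2: "norm (w 2 - a) < \<eta>" using w(2)[of 2 a] by (simp add: v_def)
    have 3: "norm (w 0 - real_of_rat q *\<^sub>R w 1 - w 2) < \<eta>" using w(3)[of 0 1 2] by (simp add: v_def)
    have "w 0 - (a + real_of_rat q *\<^sub>R b) = (w 0 - real_of_rat q *\<^sub>R w 1 - w 2) + (real_of_rat q *\<^sub>R (w 1 - b) + (w 2 - a))"
      by (simp add: algebra_simps)
    also have "norm \<dots> \<le> norm (w 0 - real_of_rat q *\<^sub>R w 1 - w 2) + (\<bar>real_of_rat q\<bar> * norm (w 1 - b) + norm (w 2 - a))"
      by (intro order_trans[OF norm_triangle_ineq] add_mono order_refl) simp
    also have "\<dots> < \<eta> + (\<bar>real_of_rat q\<bar> * \<eta> + \<eta>)"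
      using 1 2 3 by (intro add_less_le_mono add_mono mult_left_mono) auto
    also have "\<dots> = M * \<eta>" by (simp add: M_def algebra_simps)
    also have "\<dots> = e" using M by (simp add: \<eta>_def)
    finally have "dist (w 0) (a + real_of_rat q *\<^sub>R b) < e" by (simp add: dist_norm)
    thus "\<exists>y\<in>Y. dist y (a + real_of_rat q *\<^sub>R b) < e" using w(1)[of 0] by auto
  qed
  have main: "x + c *\<^sub>R y \<in> closure Y" if xy: "x \<in> closure Y" "y \<in> closure Y" for x y and c :: real
  proof -
    obtain a b where a: "\<And>n. a n \<in> Y" "a \<longlonglongrightarrow> x" and b: "\<And>n. b n \<in> Y" "b \<longlonglongrightarrow> y"
      using xy unfolding closure_sequential by blast
    have "\<exists>q. \<bar>real_of_rat q - c\<bar> < 1 / Suc n" for n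
    proof -
      have "c - 1 / Suc n < c + 1 / Suc n" by (simp add: field_simps add_pos_pos)
      from of_rat_dense[OF this] obtain q where "c - 1 / Suc n < real_of_rat q" "real_of_rat q < c + 1 / Suc n"
        by blast
      thus ?thesis by (intro exI[of _ q]) (simp add: abs_less_iff)
    qed
    then obtain q where q: "\<And>n. \<bar>real_of_rat (q n) - c\<bar> < 1 / Suc n" by metis
    have "(\<lambda>n. real_of_rat (q n) - c) \<longlonglongrightarrow> 0"
      by (rule Lim_null_comparison[OF _ LIMSEQ_inverse_real_of_nat])
        (use q in \<open>auto intro!: always_eventually less_imp_le simp: inverse_eq_divide\<close>)
    hence "(\<lambda>n. real_of_rat (q n)) \<longlonglongrightarrow> c" by (simp add: LIM_zero_iff)
    hence "(\<lambda>n. a n + real_of_rat (q n) *\<^sub>R b n) \<longlonglongrightarrow> x + c *\<^sub>R y"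
      using a b by (intro tendsto_intros)
    moreover have "a n + real_of_rat (q n) *\<^sub>R b n \<in> closure Y" for n using rat a b by blast
    ultimately show ?thesis using closed_sequentially[OF closed_closure, of "\<lambda>n. a n + real_of_rat (q n) *\<^sub>R b n"] by simp
  qed
  have "0 \<in> closure Y" using 0 closure_subset by blast
  show ?thesis
    unfolding subspace_def
  proof safe
    show "0 \<in> closure Y" by fact
    show "x + y \<in> closure Y" if "x \<in> closure Y" "y \<in> closure Y" for x y
      using main[OF that, of 1] by simp
    show "c *\<^sub>R x \<in> closure Y" if "x \<in> closure Y" for c x
      using main[OF \<open>0 \<in> closure Y\<close> that, of c] by simp
  qed
qed

text \<open>Tychonoff's theorem: the family is one map into a compact product of intervals, and a
  cluster point of the image filter becomes a limit along a finer filter. It replaces an ultrafilter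
  limit, and the same filter serves all \<open>k\<close> at once.\<close>

lemma bounded_family_limit_along_subfilter:
  fixes g :: "'k \<Rightarrow> 'p \<Rightarrow> real"
  assumes "F \<noteq> bot" and "eventually (\<lambda>p. \<forall>k. \<bar>g k p\<bar> \<le> B k) F"
  obtains H l where "H \<noteq> bot" "H \<le> F" "\<And>k. (g k \<longlongrightarrow> l k) H"
proof -
  define U where "U = Pi\<^sub>E UNIV (\<lambda>k. {- B k..B k})"
  have "compactin (product_topology (\<lambda>_. euclidean) UNIV) U"
    unfolding U_def compactin_PiE by simp
  hence "compact U" by (simp add: euclidean_product_topology flip: compactin_euclidean_iff)
  define G where "G = filtermap (\<lambda>p k. g k p) F"
  have "G \<noteq> bot" using assms(1) by (simp add: G_def filtermap_bot_iff)
  moreover have "eventually (\<lambda>x. x \<in> U) G"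
    unfolding G_def eventually_filtermap using assms(2)
    by eventually_elim (auto simp: U_def abs_le_iff minus_le_iff)
  ultimately obtain l where l: "inf (nhds l) G \<noteq> bot"
    using \<open>compact U\<close> unfolding compact_filter by blast
  define H where "H = inf F (filtercomap (\<lambda>p k. g k p) (nhds l))"
  show ?thesis
  proof (rule that)
    show "H \<le> F" by (simp add: H_def)
    show "H \<noteq> bot"
    proof
      assume "H = bot"
      hence "eventually (\<lambda>_. False) H" by simp
      then obtain P Q where PQ: "eventually P F" "eventually Q (filtercomap (\<lambda>p k. g k p) (nhds l))"
        "\<And>p. P p \<Longrightarrow> Q p \<Longrightarrow> False"
        unfolding H_def eventually_inf by blast
      obtain R where R: "eventually R (nhds l)" "\<And>p. R (\<lambda>k. g k p) \<Longrightarrow> Q p"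
        using PQ(2) unfolding eventually_filtercomap by blast
      have "eventually (\<lambda>x. \<not> R x) G"
        unfolding G_def eventually_filtermap using PQ(1) by eventually_elim (use PQ R in blast)
      with R(1) have "eventually (\<lambda>_. False) (inf (nhds l) G)"
        unfolding eventually_inf by blast
      with l show False by (simp add: trivial_limit_def)
    qed
    show "(g k \<longlongrightarrow> l k) H" for k
    proof -
      have "filterlim (\<lambda>p k. g k p) (nhds l) H"
        unfolding H_def by (rule filterlim_mono[OF filterlim_filtercomap order_refl]) simp
      moreover have "filterlim (\<lambda>f. f k) (nhds (l k)) (nhds l)"
      proof (rule topological_tendstoI)
        fix S assume S: "open S" "l k \<in> S"
        have "open ((\<lambda>f :: 'k \<Rightarrow> real. f k) -` S)"
          using S(1) continuous_on_product_coordinates[of k] by (intro open_vimage) auto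
        thus "eventually (\<lambda>f. f k \<in> S) (nhds l)"
          using S(2) eventually_nhds_in_open[of "(\<lambda>f. f k) -` S" l] by simp
      qed
      ultimately show ?thesis by (rule filterlim_compose[rotated])
    qed
  qed
qed


text \<open>The bound gives continuity at 0, which extends homogeneity from rational to real
  scalars.\<close>

lemma linear_of_rational_linear:
  fixes g :: "'a::real_normed_vector \<Rightarrow> real"
  assumes add: "\<And>x y q. g (y + real_of_rat q *\<^sub>R x) = g y + real_of_rat q * g x"
    and bd: "\<And>x. \<bar>g x\<bar> \<le> B * norm x"
  shows "linear g"
proof -
  have g0: "g 0 = 0" using bd[of 0] by simp
  have plus: "g (x + y) = g x + g y" for x y using add[of x 1 y] by simp
  have B: "\<bar>g x\<bar> \<le> \<bar>B\<bar> * norm x" for x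
    by (rule order_trans[OF bd]) (intro mult_right_mono abs_ge_self norm_ge_zero)
  have "g (c *\<^sub>R x) = c * g x" for c x
  proof (rule ccontr)
    assume ne: "g (c *\<^sub>R x) \<noteq> c * g x"
    \<comment> \<open>Approximating \<open>c\<close> by a rational within \<open>\<eta>\<close>
      leaves an error of at most \<open>\<eta> * (D - 1)\<close>; the summand 1 makes the final
      comparison with \<open>\<eta> * D\<close> strict.\<close>
    define D where "D = \<bar>B\<bar> * norm x + \<bar>g x\<bar> + 1"
    have D: "D > 0" unfolding D_def by (intro add_nonneg_pos add_nonneg_nonneg mult_nonneg_nonneg) auto
    define \<eta> where "\<eta> = \<bar>g (c *\<^sub>R x) - c * g x\<bar> / D"
    have \<eta>: "\<eta> > 0" using ne D by (simp add: \<eta>_def)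
    obtain q where "c < real_of_rat q" "real_of_rat q < c + \<eta>"
      using of_rat_dense[of c "c + \<eta>"] \<eta> by auto
    hence q: "\<bar>c - real_of_rat q\<bar> < \<eta>" by simp
    have "g (c *\<^sub>R x) = g ((c - real_of_rat q) *\<^sub>R x + real_of_rat q *\<^sub>R x)"
      by (simp add: algebra_simps)
    also have "\<dots> = g ((c - real_of_rat q) *\<^sub>R x) + real_of_rat q * g x" by (rule add)
    finally have "\<bar>g (c *\<^sub>R x) - c * g x\<bar> = \<bar>g ((c - real_of_rat q) *\<^sub>R x) - (c - real_of_rat q) * g x\<bar>"
      by (simp add: algebra_simps)
    also have "\<dots> \<le> \<bar>g ((c - real_of_rat q) *\<^sub>R x)\<bar> + \<bar>(c - real_of_rat q) * g x\<bar>"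
      by (rule abs_triangle_ineq4)
    also have "\<dots> \<le> \<bar>B\<bar> * (\<bar>c - real_of_rat q\<bar> * norm x) + \<bar>c - real_of_rat q\<bar> * \<bar>g x\<bar>"
      using B[of "(c - real_of_rat q) *\<^sub>R x"] by (simp add: abs_mult)
    also have "\<dots> = \<bar>c - real_of_rat q\<bar> * (D - 1)" by (simp add: D_def algebra_simps)
    also have "\<dots> \<le> \<eta> * (D - 1)"
      using q by (intro mult_right_mono) (auto simp: D_def)
    also have "\<dots> < \<eta> * D" using \<eta> by simp
    also have "\<dots> = \<bar>g (c *\<^sub>R x) - c * g x\<bar>" using D by (simp add: \<eta>_def)
    finally show False by simp
  qed
  with plus show ?thesis by (intro linearI) auto
qed

text \<open>Finite approximation tasks are directed, and each is solved by some map, so the solution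
  sets generate a proper filter. The norm bound holds for all \<open>v\<close> under a single map;
  this uniformity is what allows compactness to be applied to all functionals and points
  simultaneously.\<close>

lemma reflecting_retraction_filter:
  fixes \<Omega> :: "'i \<Rightarrow> 'a::real_normed_vector set"
  assumes Y: "reflecting \<Omega> I f Y" and 0: "0 \<in> Y"
  obtains F :: "('a \<Rightarrow> 'a) filter" where "F \<noteq> bot"
    "eventually (\<lambda>\<pi>. \<forall>v. norm (\<pi> v) \<le> norm v + 1) F"
    "\<And>v. eventually (\<lambda>\<pi>. \<pi> v \<in> Y) F"
    "\<And>i v. i \<in> I \<Longrightarrow> v \<in> \<Omega> i \<Longrightarrow> eventually (\<lambda>\<pi>. \<pi> v \<in> \<Omega> i) F"
    "\<And>v. ((\<lambda>\<pi>. f (\<pi> v)) \<longlongrightarrow> f v) F"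
    "\<And>v y. y \<in> Y \<Longrightarrow> ((\<lambda>\<pi>. norm (\<pi> v - y)) \<longlongrightarrow> norm (v - y)) F"
    "\<And>x y z q. ((\<lambda>\<pi>. norm (\<pi> x - real_of_rat q *\<^sub>R \<pi> y - \<pi> z)) \<longlongrightarrow> norm (x - real_of_rat q *\<^sub>R y - z)) F"
proof -
  define good :: "'a set \<times> 'i set \<times> nat \<Rightarrow> ('a \<Rightarrow> 'a) set" where
    "good = (\<lambda>(V, J, n). {\<pi>. (\<forall>v. norm (\<pi> v) \<le> norm v + 1) \<and> (\<forall>v\<in>V. \<pi> v \<in> Y \<and>
       \<bar>f (\<pi> v) - f v\<bar> < 1 / Suc n \<and> (\<forall>i\<in>J. v \<in> \<Omega> i \<longrightarrow> \<pi> v \<in> \<Omega> i) \<and>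
       (\<forall>y\<in>V \<inter> Y. \<bar>norm (\<pi> v - y) - norm (v - y)\<bar> < 1 / Suc n) \<and>
       (\<forall>x\<in>V. \<forall>y\<in>V. \<forall>k\<le>n. \<bar>norm (\<pi> v - real_of_rat (from_nat k) *\<^sub>R \<pi> x - \<pi> y)
           - norm (v - real_of_rat (from_nat k) *\<^sub>R x - y)\<bar> < 1 / Suc n))})"
  define P where "P = {(V::'a set, J, n::nat). finite V \<and> finite J \<and> J \<subseteq> I}"
  have ne: "good p \<noteq> {}" if p: "p \<in> P" for p
  proof -
    obtain V0 J n where p': "p = (V0, J, n)" "finite V0" "finite J" "J \<subseteq> I"
      using p by (auto simp: P_def)
    \<comment> \<open>With 0 among the parameters, \<open>norm (\<pi> v)\<close> is close to
      \<open>norm v\<close>, which yields the global bound on \<open>V\<close>.\<close>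
    define V where "V = insert 0 V0"
    have V: "finite V" using p' by (simp add: V_def)
    then obtain e :: "'a \<Rightarrow> nat" and N where e: "e ` V = {..<N}" "inj_on e V"
      using finite_imp_inj_to_nat_seg by (metis lessThan_def)
    define v where "v = inv_into V e"
    have v: "e x < N" "v (e x) = x" if "x \<in> V" for x
      using that e by (auto simp: v_def inv_into_f_f)
    obtain w where w: "\<And>l. l < N \<Longrightarrow> w l \<in> Y \<and> \<bar>f (w l) - f (v l)\<bar> < 1 / Suc n \<and> (\<forall>i\<in>J. v l \<in> \<Omega> i \<longrightarrow> w l \<in> \<Omega> i) \<and>
        (\<forall>y\<in>V \<inter> Y. \<bar>norm (w l - y) - norm (v l - y)\<bar> < 1 / Suc n) \<and>
        (\<forall>m<N. \<forall>k<N. \<forall>q\<in>from_nat ` {..n}. \<bar>norm (w l - real_of_rat q *\<^sub>R w m - w k) - norm (v l - real_of_rat q *\<^sub>R v m - v k)\<bar> < 1 / Suc n)"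
      using Y[unfolded reflecting_def, rule_format, of "V \<inter> Y" "from_nat ` {..n}" J "1 / Suc n" N v] V p' by auto
    \<comment> \<open>The value 0 off \<open>V\<close> respects the norm bound at the points on
      which the task imposes nothing else.\<close>
    define \<pi> where "\<pi> = (\<lambda>x. if x \<in> V then w (e x) else 0)"
    have "norm (\<pi> x) \<le> norm x + 1" for x
    proof (cases "x \<in> V")
      case True
      have "0 \<in> V \<inter> Y" using 0 by (simp add: V_def)
      with w[OF v(1)[OF True]] v(2)[OF True] have "\<bar>norm (w (e x) - 0) - norm (x - 0)\<bar> < 1 / Suc n"
        by metis
      moreover have "1 / Suc n \<le> 1" by simp
      ultimately have "\<bar>norm (w (e x) - 0) - norm (x - 0)\<bar> < 1" by (rule less_le_trans)
      thus ?thesis using True by (simp add: \<pi>_def)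
    qed (simp add: \<pi>_def)
    moreover have "\<pi> x \<in> Y \<and>
       \<bar>f (\<pi> x) - f x\<bar> < 1 / Suc n \<and> (\<forall>i\<in>J. x \<in> \<Omega> i \<longrightarrow> \<pi> x \<in> \<Omega> i) \<and>
       (\<forall>y\<in>V \<inter> Y. \<bar>norm (\<pi> x - y) - norm (x - y)\<bar> < 1 / Suc n)" if "x \<in> V" for x
      using w[OF v(1)[OF that]] v(2)[OF that] that by (simp add: \<pi>_def)
    moreover have "\<bar>norm (\<pi> x - real_of_rat (from_nat k) *\<^sub>R \<pi> y - \<pi> z)
           - norm (x - real_of_rat (from_nat k) *\<^sub>R y - z)\<bar> < 1 / Suc n"
      if xyz: "x \<in> V" "y \<in> V" "z \<in> V" and k: "k \<le> n" for x y z k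
    proof -
      have "(from_nat k :: rat) \<in> from_nat ` {..n}" using k by simp
      with w[OF v(1)[OF xyz(1)]] v(1)[OF xyz(2)] v(1)[OF xyz(3)]
      have "\<bar>norm (w (e x) - real_of_rat (from_nat k) *\<^sub>R w (e y) - w (e z))
           - norm (v (e x) - real_of_rat (from_nat k) *\<^sub>R v (e y) - v (e z))\<bar> < 1 / Suc n" by blast
      thus ?thesis using xyz v by (simp add: \<pi>_def)
    qed
    moreover have "V0 \<subseteq> V" by (auto simp: V_def)
    ultimately have "\<pi> \<in> good p"
      unfolding p'(1) good_def by (simp add: subset_eq)
    thus ?thesis by blast
  qed
  define F where "F = (INF p\<in>P. principal (good p))"
  have anti: "good (V', J', n') \<subseteq> good (V, J, n)" if "V \<subseteq> V'" "J \<subseteq> J'" "n \<le> n'" for V V' J J' n n'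
  proof
    fix \<pi> assume *: "\<pi> \<in> good (V', J', n')"
    have le: "1 / real (Suc n') \<le> 1 / real (Suc n)" using that by (simp add: frac_le)
    note lt = less_le_trans[OF _ le]
    have h: "\<forall>v. norm (\<pi> v) \<le> norm v + 1"
      "\<And>v. v \<in> V \<Longrightarrow> \<pi> v \<in> Y"
      "\<And>v. v \<in> V \<Longrightarrow> \<bar>f (\<pi> v) - f v\<bar> < 1 / Suc n'"
      "\<And>v i. v \<in> V \<Longrightarrow> i \<in> J \<Longrightarrow> v \<in> \<Omega> i \<Longrightarrow> \<pi> v \<in> \<Omega> i"
      "\<And>v y. v \<in> V \<Longrightarrow> y \<in> V \<inter> Y \<Longrightarrow> \<bar>norm (\<pi> v - y) - norm (v - y)\<bar> < 1 / Suc n'"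
      "\<And>v x y k. v \<in> V \<Longrightarrow> x \<in> V \<Longrightarrow> y \<in> V \<Longrightarrow> k \<le> n \<Longrightarrow>
        \<bar>norm (\<pi> v - real_of_rat (from_nat k) *\<^sub>R \<pi> x - \<pi> y)
           - norm (v - real_of_rat (from_nat k) *\<^sub>R x - y)\<bar> < 1 / Suc n'"
      using * that unfolding good_def by (auto simp: subset_eq)
    show "\<pi> \<in> good (V, J, n)"
      unfolding good_def using h(1,2,4) lt[OF h(3)] lt[OF h(5)] lt[OF h(6)] by auto
  qed
  have ev: "eventually Q F \<longleftrightarrow> (\<exists>p\<in>P. \<forall>\<pi>\<in>good p. Q \<pi>)" for Q
    unfolding F_def
  proof (subst eventually_INF_base)
    show "P \<noteq> {}" by (auto simp: P_def)
    fix a b assume ab: "a \<in> P" "b \<in> P"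
    obtain V J n V' J' n' where p: "a = (V, J, n)" "b = (V', J', n')" by (metis prod_cases3)
    have "(V \<union> V', J \<union> J', max n n') \<in> P" using ab by (auto simp: P_def p)
    moreover have "good (V \<union> V', J \<union> J', max n n') \<subseteq> good a" "good (V \<union> V', J \<union> J', max n n') \<subseteq> good b"
      unfolding p by (intro anti; simp)+
    ultimately show "\<exists>x\<in>P. principal (good x) \<le> inf (principal (good a)) (principal (good b))"
      by (intro bexI[of _ "(V \<union> V', J \<union> J', max n n')"]) auto
  qed (auto simp: eventually_principal)
  have evI: "eventually Q F" if "finite V" "finite J" "J \<subseteq> I" "\<And>\<pi>. \<pi> \<in> good (V, J, n) \<Longrightarrow> Q \<pi>" for Q V J n
    unfolding ev using that by (intro bexI[of _ "(V, J, n)"]) (auto simp: P_def)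
  have small: "\<exists>n. 1 / Suc n < e \<and> n \<ge> k" if e: "e > 0" for e :: real and k
  proof -
    obtain n where n: "1 / real (Suc n) < e" by (rule nat_approx_posE[OF e])
    have "1 / Suc (max n k) \<le> 1 / Suc n" by (simp add: frac_le)
    with n show ?thesis by (intro exI[of _ "max n k"]) auto
  qed
  show ?thesis
  proof (rule that)
    show "F \<noteq> bot" unfolding trivial_limit_def ev using ne by blast
    show "eventually (\<lambda>\<pi>. \<forall>v. norm (\<pi> v) \<le> norm v + 1) F"
      by (rule evI[of "{}" "{}" 0]) (auto simp: good_def)
    show "eventually (\<lambda>\<pi>. \<pi> v \<in> Y) F" for v
      by (rule evI[of "{v}" "{}" 0]) (auto simp: good_def)
    show "eventually (\<lambda>\<pi>. \<pi> v \<in> \<Omega> i) F" if "i \<in> I" "v \<in> \<Omega> i" for i v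
      by (rule evI[of "{v}" "{i}" 0]) (use that in \<open>auto simp: good_def\<close>)
    show "((\<lambda>\<pi>. f (\<pi> v)) \<longlongrightarrow> f v) F" for v
    proof (rule tendstoI)
      fix e :: real assume "e > 0"
      then obtain n where n: "1 / Suc n < e" using small by blast
      show "eventually (\<lambda>\<pi>. dist (f (\<pi> v)) (f v) < e) F"
      proof (intro evI[of "{v}" "{}" n])
        fix \<pi> assume "\<pi> \<in> good ({v}, {}, n)"
        hence "\<bar>f (\<pi> v) - f v\<bar> < 1 / Suc n" unfolding good_def by blast
        with n show "dist (f (\<pi> v)) (f v) < e" unfolding dist_real_def by linarith
      qed auto
    qed
    show "((\<lambda>\<pi>. norm (\<pi> v - y)) \<longlongrightarrow> norm (v - y)) F" if "y \<in> Y" for v y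
    proof (rule tendstoI)
      fix e :: real assume "e > 0"
      then obtain n where n: "1 / Suc n < e" using small by blast
      show "eventually (\<lambda>\<pi>. dist (norm (\<pi> v - y)) (norm (v - y)) < e) F"
      proof (intro evI[of "{v, y}" "{}" n])
        fix \<pi> assume "\<pi> \<in> good ({v, y}, {}, n)"
        hence "\<forall>z\<in>{v, y} \<inter> Y. \<bar>norm (\<pi> v - z) - norm (v - z)\<bar> < 1 / Suc n" unfolding good_def by blast
        hence "\<bar>norm (\<pi> v - y) - norm (v - y)\<bar> < 1 / Suc n" using that by blast
        with n show "dist (norm (\<pi> v - y)) (norm (v - y)) < e" unfolding dist_real_def by linarith
      qed auto
    qed
    show "((\<lambda>\<pi>. norm (\<pi> x - real_of_rat q *\<^sub>R \<pi> y - \<pi> z)) \<longlongrightarrow> norm (x - real_of_rat q *\<^sub>R y - z)) F" for x y z q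
    proof (rule tendstoI)
      fix e :: real assume "e > 0"
      then obtain n where n: "1 / Suc n < e" "to_nat q \<le> n" using small[of e "to_nat q"] by blast
      show "eventually (\<lambda>\<pi>. dist (norm (\<pi> x - real_of_rat q *\<^sub>R \<pi> y - \<pi> z)) (norm (x - real_of_rat q *\<^sub>R y - z)) < e) F"
      proof (rule evI[of "{x, y, z}" "{}" n])
        fix \<pi> assume "\<pi> \<in> good ({x, y, z}, {}, n)"
        hence "\<forall>k\<le>n. \<bar>norm (\<pi> x - real_of_rat (from_nat k) *\<^sub>R \<pi> y - \<pi> z)
           - norm (x - real_of_rat (from_nat k) *\<^sub>R y - z)\<bar> < 1 / Suc n"
          unfolding good_def by blast
        from this[rule_format, OF n(2)]
        have "\<bar>norm (\<pi> x - real_of_rat q *\<^sub>R \<pi> y - \<pi> z) - norm (x - real_of_rat q *\<^sub>R y - z)\<bar> < 1 / Suc n"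
          by (simp only: from_nat_to_nat)
        with n(1) show "dist (norm (\<pi> x - real_of_rat q *\<^sub>R \<pi> y - \<pi> z)) (norm (x - real_of_rat q *\<^sub>R y - z)) < e"
          unfolding dist_real_def by linarith
      qed auto
    qed
  qed
qed


text \<open>Functionals are extended by \<open>L g v = lim g (\<pi> v)\<close>, where the maps \<open>\<pi>\<close> into \<open>Y\<close> become
  linear, isometric and compatible with all sets \<open>\<Omega> i\<close> along the filter.\<close>

theorem separable_reduction:
  fixes \<Omega> :: "'i \<Rightarrow> 'a::real_normed_vector set" and xs :: "'a \<Rightarrow>\<^sub>L real"
  assumes I: "countable I" and A: "countable A"
  obtains Y and L :: "('a \<Rightarrow>\<^sub>L real) \<Rightarrow> ('a \<Rightarrow>\<^sub>L real)" where
    "A \<subseteq> Y" "closed Y" "subspace Y" "separable_space (top_of_set Y)" "linear L" "L xs = xs"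
    "\<And>g y. y \<in> Y \<Longrightarrow> blinfun_apply (L g) y = blinfun_apply g y"
    "\<And>g c. c \<ge> 0 \<Longrightarrow> (\<And>y. y \<in> Y \<Longrightarrow> \<bar>blinfun_apply g y\<bar> \<le> c * norm y) \<Longrightarrow> norm (L g) \<le> c"
    "\<And>g i x. i \<in> I \<Longrightarrow> x \<in> Y \<Longrightarrow> g \<in> frechet_normal_cone x (\<Omega> i \<inter> Y) \<Longrightarrow> L g \<in> frechet_normal_cone x (\<Omega> i)"
proof -
  obtain Y0 where Y0: "countable Y0" "insert 0 A \<subseteq> Y0" "reflecting \<Omega> I (blinfun_apply xs) Y0"
    using reflecting_exists[OF I, of "insert 0 A" \<Omega> "blinfun_apply xs"] A by auto
  have 0: "0 \<in> Y0" using Y0 by simp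
  define Y where "Y = closure Y0"
  have Y: "subspace Y" unfolding Y_def by (rule reflecting_closure_subspace[OF Y0(3) 0])
  have sep: "separable_space (top_of_set Y)"
    unfolding separable_space_def Y_def
    using Y0(1) closure_subset[of Y0] by (intro exI[of _ Y0]) (auto simp: closure_of_subtopology Int_absorb1)
  obtain F :: "('a \<Rightarrow> 'a) filter" where F: "F \<noteq> bot"
    "eventually (\<lambda>\<pi>. \<forall>v. norm (\<pi> v) \<le> norm v + 1) F"
    "\<And>v. eventually (\<lambda>\<pi>. \<pi> v \<in> Y0) F"
    "\<And>i v. i \<in> I \<Longrightarrow> v \<in> \<Omega> i \<Longrightarrow> eventually (\<lambda>\<pi>. \<pi> v \<in> \<Omega> i) F"
    "\<And>v. ((\<lambda>\<pi>. blinfun_apply xs (\<pi> v)) \<longlongrightarrow> blinfun_apply xs v) F"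
    "\<And>v y. y \<in> Y0 \<Longrightarrow> ((\<lambda>\<pi>. norm (\<pi> v - y)) \<longlongrightarrow> norm (v - y)) F"
    "\<And>x y z q. ((\<lambda>\<pi>. norm (\<pi> x - real_of_rat q *\<^sub>R \<pi> y - \<pi> z)) \<longlongrightarrow> norm (x - real_of_rat q *\<^sub>R y - z)) F"
    using reflecting_retraction_filter[OF Y0(3) 0] by blast
  \<comment> \<open>Indexing by all pairs of a functional and a point yields one filter for every
    extension; this makes the extension linear in \<open>g\<close> as well as in
    \<open>v\<close>.\<close>
  define G :: "('a \<Rightarrow>\<^sub>L real) \<times> 'a \<Rightarrow> ('a \<Rightarrow> 'a) \<Rightarrow> real" where "G = (\<lambda>(g, v) \<pi>. blinfun_apply g (\<pi> v))"
  have "eventually (\<lambda>\<pi>. \<forall>k. \<bar>G k \<pi>\<bar> \<le> norm (fst k) * (norm (snd k) + 1)) F"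
    using F(2)
  proof eventually_elim
    case (elim \<pi>)
    show ?case
    proof
      fix k :: "('a \<Rightarrow>\<^sub>L real) \<times> 'a"
      have "\<bar>G k \<pi>\<bar> \<le> norm (fst k) * norm (\<pi> (snd k))"
        using norm_blinfun[of "fst k" "\<pi> (snd k)"] by (simp add: G_def split_beta)
      also have "\<dots> \<le> norm (fst k) * (norm (snd k) + 1)" using elim by (intro mult_left_mono) auto
      finally show "\<bar>G k \<pi>\<bar> \<le> norm (fst k) * (norm (snd k) + 1)" .
    qed
  qed
  from bounded_family_limit_along_subfilter[OF F(1) this]
  obtain H l where H: "H \<noteq> bot" "H \<le> F" "\<And>k. (G k \<longlongrightarrow> l k) H" by blast
  have lim: "((\<lambda>\<pi>. blinfun_apply g (\<pi> v)) \<longlongrightarrow> l (g, v)) H" for g v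
    using H(3)[of "(g, v)"] by (simp add: G_def)
  note evH = filter_leD[OF H(2)] and limH = tendsto_mono[OF H(2)]
  \<comment> \<open>Distances are 1-Lipschitz in the parameter, so convergence extends from
    \<open>Y0\<close> to its closure.\<close>
  have limY: "((\<lambda>\<pi>. norm (\<pi> v - y)) \<longlongrightarrow> norm (v - y)) H" if y: "y \<in> Y" for v y
  proof (rule tendstoI)
    fix e :: real assume e: "e > 0"
    obtain y' where y': "y' \<in> Y0" "dist y' y < e/3"
      using y e unfolding Y_def closure_approachable by (meson divide_pos_pos zero_less_numeral)
    have tri: "\<bar>norm (u - y) - norm (u - y')\<bar> < e/3" for u
      using norm_triangle_ineq3[of "u - y" "u - y'"] y'(2) by (simp add: dist_norm)
    have "eventually (\<lambda>\<pi>. dist (norm (\<pi> v - y')) (norm (v - y')) < e/3) H"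
      using e by (intro tendstoD[OF limH[OF F(6)[OF y'(1)]]]) simp
    thus "eventually (\<lambda>\<pi>. dist (norm (\<pi> v - y)) (norm (v - y)) < e) H"
    proof eventually_elim
      case (elim \<pi>)
      thus ?case using tri[of "\<pi> v"] tri[of v] unfolding dist_real_def by linarith
    qed
  qed
  have 0: "0 \<in> Y" by (rule subspace_0[OF Y])
  have lim_norm: "((\<lambda>\<pi>. norm (\<pi> v)) \<longlongrightarrow> norm v) H" for v using limY[OF 0, of v] by simp
  have evY: "eventually (\<lambda>\<pi>. \<pi> v \<in> Y) H" for v
    using evH[OF F(3)] by eventually_elim (use closure_subset in \<open>auto simp: Y_def\<close>)
  have l_bound: "\<bar>l (g, v)\<bar> \<le> c * norm v" if "\<And>y. y \<in> Y \<Longrightarrow> \<bar>blinfun_apply g y\<bar> \<le> c * norm y" for g v c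
  proof (rule tendsto_le[OF H(1)])
    show "((\<lambda>\<pi>. c * norm (\<pi> v)) \<longlongrightarrow> c * norm v) H" by (intro tendsto_intros lim_norm)
    show "((\<lambda>\<pi>. \<bar>blinfun_apply g (\<pi> v)\<bar>) \<longlongrightarrow> \<bar>l (g, v)\<bar>) H" by (intro tendsto_intros lim)
    show "eventually (\<lambda>\<pi>. \<bar>blinfun_apply g (\<pi> v)\<bar> \<le> c * norm (\<pi> v)) H"
      using evY by eventually_elim (rule that)
  qed
  have l_norm: "\<bar>l (g, v)\<bar> \<le> norm g * norm v" for g v
    using norm_blinfun[of g] by (intro l_bound) simp
  have l_lin: "l (g, y + real_of_rat q *\<^sub>R x) = l (g, y) + real_of_rat q * l (g, x)" for g x y q
  proof -
    let ?r = "real_of_rat q" and ?z = "y + real_of_rat q *\<^sub>R x"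
    have "((\<lambda>\<pi>. norm (\<pi> ?z - ?r *\<^sub>R \<pi> x - \<pi> y)) \<longlongrightarrow> 0) H"
      using limH[OF F(7)[of ?z q x y]] by simp
    hence *: "((\<lambda>\<pi>. norm g * norm (\<pi> ?z - ?r *\<^sub>R \<pi> x - \<pi> y)) \<longlongrightarrow> 0) H"
      by (rule tendsto_mult_right_zero)
    have "((\<lambda>\<pi>. blinfun_apply g (\<pi> ?z - ?r *\<^sub>R \<pi> x - \<pi> y)) \<longlongrightarrow> 0) H"
      by (rule Lim_null_comparison[OF _ *]) (intro always_eventually allI norm_blinfun)
    moreover have "((\<lambda>\<pi>. blinfun_apply g (\<pi> ?z - ?r *\<^sub>R \<pi> x - \<pi> y)) \<longlongrightarrow> l (g, ?z) - ?r * l (g, x) - l (g, y)) H"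
      by (simp add: blinfun.diff_right blinfun.scaleR_right) (intro tendsto_intros lim)
    ultimately have "0 = l (g, ?z) - ?r * l (g, x) - l (g, y)" using tendsto_unique[OF H(1)] by blast
    thus ?thesis by simp
  qed
  have l_linear: "linear (\<lambda>v. l (g, v))" for g
    by (rule linear_of_rational_linear[OF l_lin l_norm])
  have bl: "bounded_linear (\<lambda>v. l (g, v))" for g
    using l_norm[of g]
    by (intro bounded_linear_intro[where K = "norm g"])
      (auto simp: linear_add[OF l_linear] linear_scale[OF l_linear] mult.commute)
  define L where "L = (\<lambda>g. Blinfun (\<lambda>v. l (g, v)))"
  have L: "blinfun_apply (L g) v = l (g, v)" for g v
    by (simp add: L_def bounded_linear_Blinfun_apply[OF bl])
  have L_lim: "((\<lambda>\<pi>. blinfun_apply g (\<pi> v)) \<longlongrightarrow> blinfun_apply (L g) v) H" for g v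
    using lim by (simp add: L)
  note uniq = tendsto_unique[OF H(1)]
  have LY: "blinfun_apply (L g) y = blinfun_apply g y" if "y \<in> Y" for g y
  proof (rule uniq[OF L_lim])
    have "((\<lambda>\<pi>. norm (\<pi> y - y)) \<longlongrightarrow> 0) H" using limY[OF that, of y] by simp
    hence "((\<lambda>\<pi>. \<pi> y) \<longlongrightarrow> y) H" by (simp add: tendsto_norm_zero_iff LIM_zero_iff)
    thus "((\<lambda>\<pi>. blinfun_apply g (\<pi> y)) \<longlongrightarrow> blinfun_apply g y) H"
      by (intro blinfun.tendsto tendsto_const)
  qed
  show ?thesis
  proof (rule that[of Y L])
    show "A \<subseteq> Y" using Y0(2) closure_subset by (auto simp: Y_def)
    show "closed Y" by (simp add: Y_def)
    show "subspace Y" "separable_space (top_of_set Y)" by (fact Y sep)+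
    show "linear L"
    proof (rule linearI)
      show "L (g + h) = L g + L h" for g h
      proof (rule blinfun_eqI)
        fix v
        have "((\<lambda>\<pi>. blinfun_apply (g + h) (\<pi> v)) \<longlongrightarrow> blinfun_apply (L g + L h) v) H"
          by (simp add: blinfun.add_left) (intro tendsto_add L_lim)
        thus "blinfun_apply (L (g + h)) v = blinfun_apply (L g + L h) v" by (rule uniq[OF L_lim])
      qed
      show "L (c *\<^sub>R g) = c *\<^sub>R L g" for c g
      proof (rule blinfun_eqI)
        fix v
        have "((\<lambda>\<pi>. blinfun_apply (c *\<^sub>R g) (\<pi> v)) \<longlongrightarrow> blinfun_apply (c *\<^sub>R L g) v) H"
          by (simp add: blinfun.scaleR_left) (intro tendsto_mult tendsto_const L_lim)
        thus "blinfun_apply (L (c *\<^sub>R g)) v = blinfun_apply (c *\<^sub>R L g) v" by (rule uniq[OF L_lim])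
      qed
    qed
    \<comment> \<open>\<open>xs\<close> is the function with respect to which \<open>Y0\<close> is
      reflecting, so its values survive the limit even outside \<open>Y\<close>.\<close>
    show "L xs = xs"
      by (rule blinfun_eqI) (rule uniq[OF L_lim limH[OF F(5)]])
    show "blinfun_apply (L g) y = blinfun_apply g y" if "y \<in> Y" for g y by (rule LY[OF that])
    show "norm (L g) \<le> c" if "c \<ge> 0" "\<And>y. y \<in> Y \<Longrightarrow> \<bar>blinfun_apply g y\<bar> \<le> c * norm y" for g c
      using l_bound[OF that(2)] by (intro norm_blinfun_bound that(1)) (simp add: L)
    show "L g \<in> frechet_normal_cone x (\<Omega> i)"
      if i: "i \<in> I" and x: "x \<in> Y" and g: "g \<in> frechet_normal_cone x (\<Omega> i \<inter> Y)" for g i x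
      unfolding frechet_normal_cone_iff
    proof safe
      show "x \<in> \<Omega> i" using g by (simp add: frechet_normal_cone_iff)
      fix e :: real assume "e > 0"
      then obtain d where d: "d > 0"
        "\<And>u. u \<in> \<Omega> i \<inter> Y \<Longrightarrow> norm (u - x) < d \<Longrightarrow> blinfun_apply g (u - x) \<le> e * norm (u - x)"
        using g unfolding frechet_normal_cone_iff by meson
      \<comment> \<open>The point \<open>u\<close> may lie outside \<open>Y\<close>, but
        \<open>\<pi> u\<close> eventually lies in \<open>\<Omega> i \<inter> Y\<close> and within
        \<open>d\<close> of \<open>x\<close>. The inequality known there passes to the limit along
        \<open>H\<close>.\<close>
      have "blinfun_apply (L g) (u - x) \<le> e * norm (u - x)" if u: "u \<in> \<Omega> i" "norm (u - x) < d" for u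
      proof (rule tendsto_le[OF H(1)])
        show "((\<lambda>\<pi>. e * norm (\<pi> u - x)) \<longlongrightarrow> e * norm (u - x)) H" by (intro tendsto_intros limY x)
        show "((\<lambda>\<pi>. blinfun_apply g (\<pi> u - x)) \<longlongrightarrow> blinfun_apply (L g) (u - x)) H"
          using LY[OF x, of g] by (simp add: blinfun.diff_right) (intro tendsto_diff tendsto_const L_lim)
        have "eventually (\<lambda>\<pi>. norm (\<pi> u - x) < d) H"
          by (rule order_tendstoD(2)[OF limY[OF x] u(2)])
        moreover have "eventually (\<lambda>\<pi>. \<pi> u \<in> \<Omega> i) H" by (rule evH[OF F(4)[OF i u(1)]])
        ultimately show "eventually (\<lambda>\<pi>. blinfun_apply g (\<pi> u - x) \<le> e * norm (\<pi> u - x)) H"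
          using evY by eventually_elim (use d(2) in auto)
      qed
      with d(1) show "\<exists>d>0. \<forall>u\<in>\<Omega> i. norm (u - x) < d \<longrightarrow> blinfun_apply (L g) (u - x) \<le> e * norm (u - x)"
        by blast
    qed
  qed
qed

section \<open>A smooth variational principle\<close>

lemma equiv_norm_sublinear: "equiv_norm \<nu> \<Longrightarrow> sublinear \<nu>"
  and equiv_norm_le_norm: "equiv_norm \<nu> \<Longrightarrow> \<nu> x \<le> norm x"
  and norm_le_equiv_norm: "equiv_norm \<nu> \<Longrightarrow> norm x \<le> sqrt 2 * \<nu> x"
  by (simp_all add: equiv_norm_def)

lemma equiv_norm_nonneg: "equiv_norm \<nu> \<Longrightarrow> \<nu> x \<ge> 0"
  using norm_le_equiv_norm[of \<nu> x] by (smt (verit) norm_ge_zero real_sqrt_gt_0_iff zero_le_mult_iff)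

lemma equiv_norm_triangle: "equiv_norm \<nu> \<Longrightarrow> \<nu> (x + y) \<le> \<nu> x + \<nu> y"
  by (rule sublinear_add[OF equiv_norm_sublinear])

lemma equiv_norm_zero: "equiv_norm \<nu> \<Longrightarrow> \<nu> 0 = 0"
  by (rule sublinear_zero[OF equiv_norm_sublinear])

lemma norm_le_2_equiv_norm:
  assumes "equiv_norm \<nu>"
  shows "norm x \<le> 2 * \<nu> x"
proof -
  have "sqrt 2 \<le> 2" by (rule real_le_lsqrt) auto
  hence "sqrt 2 * \<nu> x \<le> 2 * \<nu> x" by (intro mult_right_mono equiv_norm_nonneg assms)
  with norm_le_equiv_norm[OF assms, of x] show ?thesis by simp
qed

lemma equiv_norm_diff_le:
  assumes "equiv_norm \<nu>"
  shows "\<bar>\<nu> x - \<nu> y\<bar> \<le> norm (x - y)"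
proof -
  have "\<nu> x - \<nu> y \<le> norm (x - y)" for x y
    using equiv_norm_triangle[OF assms, of "x - y" y] equiv_norm_le_norm[OF assms, of "x - y"] by simp
  from this[of x y] this[of y x] show ?thesis by (simp add: norm_minus_commute abs_le_iff)
qed

lemma equiv_norm_tendsto:
  assumes "equiv_norm \<nu>" "(f \<longlongrightarrow> l) F"
  shows "((\<lambda>x. \<nu> (f x)) \<longlongrightarrow> \<nu> l) F"
proof -
  have *: "((\<lambda>x. norm (f x - l)) \<longlongrightarrow> 0) F" using assms(2) by (simp add: LIM_zero tendsto_norm_zero)
  have "((\<lambda>x. \<nu> (f x) - \<nu> l) \<longlongrightarrow> 0) F"
    by (rule Lim_null_comparison[OF _ *]) (use equiv_norm_diff_le[OF assms(1)] in \<open>auto intro!: always_eventually\<close>)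
  thus ?thesis by (simp add: LIM_zero_iff)
qed

lemma near_minimizer_exists:
  fixes G :: "'b \<Rightarrow> real"
  assumes "Z \<noteq> {}" "\<And>z. z \<in> Z \<Longrightarrow> b \<le> G z" "e > 0"
  obtains z where "z \<in> Z" "\<And>z'. z' \<in> Z \<Longrightarrow> G z \<le> G z' + e"
proof -
  have bdd: "bdd_below (G ` Z)" using assms(2) by (intro bdd_belowI2) auto
  have "Inf (G ` Z) < Inf (G ` Z) + e" using assms by simp
  then obtain z where "z \<in> Z" "G z < Inf (G ` Z) + e"
    using cInf_lessD[of "G ` Z" "Inf (G ` Z) + e"] assms(1) by blast
  moreover have "Inf (G ` Z) \<le> G z'" if "z' \<in> Z" for z' using that by (intro cInf_lower bdd) auto
  ultimately show ?thesis by (intro that[of z]) force+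
qed

text \<open>The Borwein-Preiss construction; values of points outside \<open>J\<close> are irrelevant.\<close>

lemma variational_principle:
  fixes S :: "'j \<Rightarrow> 'a::banach set" and F :: "('j \<Rightarrow> 'a) \<Rightarrow> real"
  assumes J: "finite J" and S: "\<And>j. j \<in> J \<Longrightarrow> closed (S j)" and z0: "\<And>j. j \<in> J \<Longrightarrow> z0 j \<in> S j"
    and \<nu>: "equiv_norm \<nu>" and nonneg: "\<And>z. F z \<ge> 0"
    and cont: "\<And>zs z. (\<And>j. j \<in> J \<Longrightarrow> (\<lambda>k. zs k j) \<longlonglongrightarrow> z j) \<Longrightarrow> (\<lambda>k. F (zs k)) \<longlonglongrightarrow> F z"
    and r: "F z0 \<le> r" "r > 0" and \<sigma>: "\<sigma> > 0"
  obtains z zs where "\<And>j. j \<in> J \<Longrightarrow> z j \<in> S j" "\<And>j k. j \<in> J \<Longrightarrow> zs k j \<in> S j"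
    "\<And>j. j \<in> J \<Longrightarrow> norm (z j - z0 j) \<le> 4 * \<sigma>" "\<And>j k. j \<in> J \<Longrightarrow> norm (zs k j - z0 j) \<le> 4 * \<sigma>"
    "\<And>z'. (\<And>j. j \<in> J \<Longrightarrow> z' j \<in> S j) \<Longrightarrow>
       F z + (\<Sum>j\<in>J. \<Sum>k. 2 * r / \<sigma>\<^sup>2 * (1/2) ^ k * (\<nu> (z j - zs k j))\<^sup>2) \<le>
       F z' + (\<Sum>j\<in>J. \<Sum>k. 2 * r / \<sigma>\<^sup>2 * (1/2) ^ k * (\<nu> (z' j - zs k j))\<^sup>2)"
proof -
  define Z where "Z = {z. \<forall>j\<in>J. z j \<in> S j}"
  define \<mu> where "\<mu> = (\<lambda>k. 2 * r / \<sigma>\<^sup>2 * (1/2) ^ k)"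
  \<comment> \<open>Tolerances shrink like \<open>(1/16) ^ k\<close> against weights of order
    \<open>(1/2) ^ k\<close>, so consecutive points differ by at most
    \<open>\<sigma> * (1/2) ^ k\<close> in \<open>\<nu>\<close>. The factor 2 between the norms and
    the geometric series then give the radius \<open>4 * \<sigma>\<close>.\<close>
  define e where "e = (\<lambda>k. r * (1/16) ^ k)"
  have \<mu>: "\<mu> k > 0" for k using r \<sigma> by (simp add: \<mu>_def)
  have e: "e k > 0" for k using r by (simp add: e_def)
  define P where "P = (\<lambda>w z. \<Sum>j\<in>J. (\<nu> (z j - w j))\<^sup>2)"
  have P: "P w z \<ge> 0" for w z by (simp add: P_def sum_nonneg)
  have \<mu>P: "0 \<le> \<mu> k * P w z" for k w z by (intro mult_nonneg_nonneg P less_imp_le \<mu>)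
  define near where "near = (\<lambda>(G :: ('j \<Rightarrow> 'a) \<Rightarrow> real) (d :: real) z. z \<in> Z \<and> (\<forall>z'\<in>Z. G z \<le> G z' + d))"
  define st where "st = rec_nat (F, z0) (\<lambda>k (G, w). (\<lambda>z. G z + \<mu> k * P w z, SOME z. near (\<lambda>z. G z + \<mu> k * P w z) (e (Suc k)) z))"
  define G where "G = (\<lambda>k. fst (st k))"
  define zs where "zs = (\<lambda>k. snd (st k))"
  have G0: "G 0 = F" "zs 0 = z0" by (simp_all add: G_def zs_def st_def)
  have GS: "G (Suc k) = (\<lambda>z. G k z + \<mu> k * P (zs k) z)" for k
    by (simp add: G_def zs_def st_def split_beta)
  have zsS: "zs (Suc k) = (SOME z. near (G (Suc k)) (e (Suc k)) z)" for k
    unfolding GS by (simp add: G_def zs_def st_def split_beta)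
  have G_sum: "G k z = F z + (\<Sum>i<k. \<mu> i * P (zs i) z)" for k z
    by (induction k) (auto simp: G0 GS)
  have G_nonneg: "G k z \<ge> 0" for k z
    unfolding G_sum by (intro add_nonneg_nonneg sum_nonneg \<mu>P nonneg)
  have "z0 \<in> Z" using z0 by (simp add: Z_def)
  have near: "near (G k) (e k) (zs k)" for k
  proof (cases k)
    case 0
    have "F z0 \<le> F z' + r" for z' using nonneg[of z'] r by simp
    thus ?thesis using 0 \<open>z0 \<in> Z\<close> by (simp add: near_def G0 e_def)
  next
    case (Suc m)
    have "\<exists>z. near (G (Suc m)) (e (Suc m)) z"
    proof (rule near_minimizer_exists)
      show "Z \<noteq> {}" using \<open>z0 \<in> Z\<close> by blast
      show "0 \<le> G (Suc m) z" for z by (rule G_nonneg)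
      show "0 < e (Suc m)" by (rule e)
      fix z assume "z \<in> Z" "\<And>z'. z' \<in> Z \<Longrightarrow> G (Suc m) z \<le> G (Suc m) z' + e (Suc m)"
      thus ?thesis by (auto simp: near_def)
    qed
    thus ?thesis unfolding Suc zsS by (rule someI_ex)
  qed
  have zsZ: "zs k j \<in> S j" if "j \<in> J" for k j using near[of k] that by (simp add: near_def Z_def)
  have P_self: "P w w = 0" for w by (simp add: P_def equiv_norm_zero[OF \<nu>])
  have step: "norm (zs (Suc k) j - zs k j) \<le> 2 * \<sigma> * (1/2) ^ k" if j: "j \<in> J" for k j
  proof -
    have "G k (zs (Suc k)) + \<mu> k * P (zs k) (zs (Suc k)) = G (Suc k) (zs (Suc k))" by (simp add: GS)
    also have "\<dots> \<le> G (Suc k) (zs k) + e (Suc k)" using near[of k] near[of "Suc k"] by (simp add: near_def)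
    also have "\<dots> = G k (zs k) + e (Suc k)" by (simp add: GS P_self)
    also have "G k (zs k) \<le> G k (zs (Suc k)) + e k" using near[of k] near[of "Suc k"] by (simp add: near_def)
    finally have "\<mu> k * P (zs k) (zs (Suc k)) \<le> e k + e (Suc k)" by simp
    also have "\<dots> \<le> 2 * e k" using r by (simp add: e_def)
    also have "\<dots> \<le> \<mu> k * (\<sigma> * (1/2) ^ k)\<^sup>2"
    proof -
      have "(1/16 :: real) ^ k \<le> (1/8) ^ k" by (intro power_mono) auto
      hence "2 * e k \<le> 2 * r * (1/8) ^ k" using r by (simp add: e_def)
      also have "(1/8 :: real) ^ k = (1/2) ^ k * ((1/2) ^ k)\<^sup>2"
        by (simp add: power2_eq_square flip: power_mult_distrib)
      also have "2 * r * \<dots> = \<mu> k * (\<sigma> * (1/2) ^ k)\<^sup>2"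
        using \<sigma> by (simp add: \<mu>_def power_mult_distrib)
      finally show ?thesis .
    qed
    finally have "P (zs k) (zs (Suc k)) \<le> (\<sigma> * (1/2) ^ k)\<^sup>2" using \<mu>[of k] by simp
    moreover have "(\<nu> (zs (Suc k) j - zs k j))\<^sup>2 \<le> P (zs k) (zs (Suc k))"
      unfolding P_def using J j by (intro member_le_sum) auto
    ultimately have "(\<nu> (zs (Suc k) j - zs k j))\<^sup>2 \<le> (\<sigma> * (1/2) ^ k)\<^sup>2" by simp
    hence "\<nu> (zs (Suc k) j - zs k j) \<le> \<sigma> * (1/2) ^ k"
      by (rule power2_le_imp_le) (use \<sigma> in simp)
    with norm_le_2_equiv_norm[OF \<nu>, of "zs (Suc k) j - zs k j"] show ?thesis by simp
  qed
  have geom: "(\<lambda>k. 2 * \<sigma> * (1/2) ^ k) sums (4 * \<sigma>)"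
    using sums_mult[OF geometric_sums[of "1/2 :: real"], of "2 * \<sigma>"] by simp
  define z where "z = (\<lambda>j. z0 j + (\<Sum>k. zs (Suc k) j - zs k j))"
  have summ: "summable (\<lambda>k. norm (zs (Suc k) j - zs k j))" if "j \<in> J" for j
    by (rule summable_comparison_test[OF _ sums_summable[OF geom]]) (use step[OF that] in auto)
  have partial: "(\<Sum>i<k. zs (Suc i) j - zs i j) = zs k j - z0 j" for k j
    using sum_lessThan_telescope[of "\<lambda>i. zs i j" k] by (simp add: G0)
  have lim: "(\<lambda>k. zs k j) \<longlonglongrightarrow> z j" if "j \<in> J" for j
  proof -
    have "(\<lambda>k. z0 j + (\<Sum>i<k. zs (Suc i) j - zs i j)) \<longlonglongrightarrow> z j"
      unfolding z_def by (intro tendsto_intros summable_LIMSEQ summable_norm_cancel[OF summ[OF that]])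
    thus ?thesis by (simp add: partial)
  qed
  have zs_bd: "norm (zs k j - z0 j) \<le> 4 * \<sigma>" if "j \<in> J" for k j
  proof -
    have "norm (zs k j - z0 j) \<le> (\<Sum>i<k. norm (zs (Suc i) j - zs i j))"
      unfolding partial[symmetric] by (rule norm_sum)
    also have "\<dots> \<le> (\<Sum>i<k. 2 * \<sigma> * (1/2) ^ i)" by (intro sum_mono step that)
    also have "\<dots> \<le> (\<Sum>i. 2 * \<sigma> * (1/2) ^ i)"
      using \<sigma> by (intro sum_le_suminf sums_summable[OF geom]) auto
    also have "\<dots> = 4 * \<sigma>" using geom by (simp add: sums_iff)
    finally show ?thesis .
  qed
  have z_bd: "norm (z j - z0 j) \<le> 4 * \<sigma>" if "j \<in> J" for j
    by (rule Lim_norm_ubound[OF _ tendsto_diff[OF lim[OF that] tendsto_const]]) (use zs_bd[OF that] in auto)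
  have zS: "z j \<in> S j" if "j \<in> J" for j
    using closed_sequentially[OF S[OF that], of "\<lambda>k. zs k j"] zsZ[OF that] lim[OF that] by blast
  have summ_pert: "summable (\<lambda>k. \<mu> k * (\<nu> (y - zs k j))\<^sup>2)" if "j \<in> J" for y j
  proof (rule summable_comparison_test)
    show "summable (\<lambda>k. 2 * r / \<sigma>\<^sup>2 * (norm (y - z0 j) + 4 * \<sigma>)\<^sup>2 * (1/2) ^ k)"
      by (intro summable_mult summable_geometric) simp
    have "norm (\<mu> k * (\<nu> (y - zs k j))\<^sup>2) \<le> 2 * r / \<sigma>\<^sup>2 * (norm (y - z0 j) + 4 * \<sigma>)\<^sup>2 * (1/2) ^ k" for k
    proof -
      have "\<nu> (y - zs k j) \<le> norm (y - z0 j) + norm (zs k j - z0 j)"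
        using equiv_norm_le_norm[OF \<nu>, of "y - zs k j"] norm_triangle_ineq4[of "y - z0 j" "zs k j - z0 j"] by simp
      also have "\<dots> \<le> norm (y - z0 j) + 4 * \<sigma>" using zs_bd[OF that] by simp
      finally have "(\<nu> (y - zs k j))\<^sup>2 \<le> (norm (y - z0 j) + 4 * \<sigma>)\<^sup>2"
        by (intro power_mono equiv_norm_nonneg \<nu>)
      hence "norm (\<mu> k * (\<nu> (y - zs k j))\<^sup>2) \<le> \<mu> k * (norm (y - z0 j) + 4 * \<sigma>)\<^sup>2"
        using \<mu>[of k] by (simp add: abs_mult)
      thus ?thesis by (simp add: \<mu>_def mult_ac)
    qed
    thus "\<exists>N. \<forall>n\<ge>N. norm (\<mu> n * (\<nu> (y - zs n j))\<^sup>2) \<le> 2 * r / \<sigma>\<^sup>2 * (norm (y - z0 j) + 4 * \<sigma>)\<^sup>2 * (1/2) ^ n"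
      by blast
  qed
  define Pinf where "Pinf = (\<lambda>z. \<Sum>j\<in>J. \<Sum>k. \<mu> k * (\<nu> (z j - zs k j))\<^sup>2)"
  have Pinf: "(\<lambda>k. \<mu> k * P (zs k) z) sums Pinf z" for z
    unfolding Pinf_def P_def sum_distrib_left by (intro sums_sum summable_sums summ_pert)
  have G_lim: "(\<lambda>k. G k z) \<longlonglongrightarrow> F z + Pinf z" for z
    using Pinf[of z] unfolding G_sum sums_def by (intro tendsto_intros)
  have G_le: "G k z \<le> F z + Pinf z" for k z
  proof -
    have "(\<Sum>i<k. \<mu> i * P (zs i) z) \<le> (\<Sum>i. \<mu> i * P (zs i) z)"
      using Pinf[of z] by (intro sum_le_suminf) (auto simp: sums_iff \<mu>P)
    thus ?thesis using Pinf[of z] by (simp add: G_sum sums_iff)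
  qed
  have G_mono: "G m z \<le> G n z" if "m \<le> n" for m n z
    unfolding G_sum using that
    by (intro add_left_mono sum_mono2) (auto simp: \<mu>P)
  have min: "F z + Pinf z \<le> F z' + Pinf z'" if "z' \<in> Z" for z'
  proof -
    \<comment> \<open>Since \<open>zs n\<close> nearly minimizes \<open>G n \<ge> G m\<close>,
      letting \<open>n\<close> grow at fixed \<open>m\<close> uses only continuity of the finite sum
      \<open>G m\<close>; the limit in \<open>m\<close> is taken afterwards.\<close>
    have "G m z \<le> F z' + Pinf z'" for m
    proof (rule LIMSEQ_le)
      show "(\<lambda>n. G m (zs n)) \<longlonglongrightarrow> G m z"
        unfolding G_sum P_def by (intro tendsto_intros cont lim equiv_norm_tendsto[OF \<nu>])
      have "e \<longlonglongrightarrow> 0" unfolding e_def by (intro tendsto_mult_right_zero LIMSEQ_realpow_zero) auto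
      thus "(\<lambda>n. F z' + Pinf z' + e n) \<longlonglongrightarrow> F z' + Pinf z'"
        using tendsto_add[OF tendsto_const[of "F z' + Pinf z'"], of e 0] by simp
      have "G m (zs n) \<le> F z' + Pinf z' + e n" if "n \<ge> m" for n
      proof -
        have "G m (zs n) \<le> G n (zs n)" by (rule G_mono[OF that])
        also have "\<dots> \<le> G n z' + e n" using near[of n] \<open>z' \<in> Z\<close> by (simp add: near_def)
        also have "G n z' \<le> F z' + Pinf z'" by (rule G_le)
        finally show ?thesis by simp
      qed
      thus "\<exists>N. \<forall>n\<ge>N. G m (zs n) \<le> F z' + Pinf z' + e n" by blast
    qed
    thus ?thesis by (intro LIMSEQ_le_const2[OF G_lim]) auto
  qed
  show ?thesis
  proof (rule that[of z zs])
    fix z' assume "\<And>j. j \<in> J \<Longrightarrow> z' j \<in> S j"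
    hence "z' \<in> Z" by (simp add: Z_def)
    from min[OF this] show "F z + (\<Sum>j\<in>J. \<Sum>k. 2 * r / \<sigma>\<^sup>2 * (1/2) ^ k * (\<nu> (z j - zs k j))\<^sup>2) \<le>
       F z' + (\<Sum>j\<in>J. \<Sum>k. 2 * r / \<sigma>\<^sup>2 * (1/2) ^ k * (\<nu> (z' j - zs k j))\<^sup>2)"
      by (simp add: Pinf_def \<mu>_def)
  qed (use zS zsZ z_bd zs_bd in auto)
qed

section \<open>Upper gradients\<close>

text \<open>A Frechet supergradient along directions in \<open>Y\<close>. Such one-sided bounds add
  up, pass through the square root, and are exactly what a minimum turns into normals.\<close>

definition upper_gradient :: "'a::real_normed_vector set \<Rightarrow> ('a \<Rightarrow> real) \<Rightarrow> 'a \<Rightarrow> ('a \<Rightarrow>\<^sub>L real) \<Rightarrow> bool" where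
  "upper_gradient Y g x \<theta> \<longleftrightarrow>
     (\<forall>e>0. \<exists>d>0. \<forall>h\<in>Y. norm h < d \<longrightarrow> g (x + h) \<le> g x + blinfun_apply \<theta> h + e * norm h)"

lemma upper_gradientD:
  assumes "upper_gradient Y g x \<theta>" "e > 0"
  obtains d where "d > 0" "\<And>h. h \<in> Y \<Longrightarrow> norm h < d \<Longrightarrow> g (x + h) \<le> g x + blinfun_apply \<theta> h + e * norm h"
  using assms unfolding upper_gradient_def by blast

lemma upper_gradient_add:
  assumes "upper_gradient Y f x \<theta>" "upper_gradient Y g x \<eta>"
  shows "upper_gradient Y (\<lambda>x. f x + g x) x (\<theta> + \<eta>)"
  unfolding upper_gradient_def
proof (intro allI impI)
  fix e :: real assume "e > 0"
  hence e: "e/2 > 0" by simp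
  obtain d where d: "d > 0" "\<And>h. h \<in> Y \<Longrightarrow> norm h < d \<Longrightarrow> f (x + h) \<le> f x + blinfun_apply \<theta> h + e/2 * norm h"
    by (rule upper_gradientD[OF assms(1) e]) blast
  obtain d' where d': "d' > 0" "\<And>h. h \<in> Y \<Longrightarrow> norm h < d' \<Longrightarrow> g (x + h) \<le> g x + blinfun_apply \<eta> h + e/2 * norm h"
    by (rule upper_gradientD[OF assms(2) e]) blast
  show "\<exists>d>0. \<forall>h\<in>Y. norm h < d \<longrightarrow> f (x + h) + g (x + h) \<le> f x + g x + blinfun_apply (\<theta> + \<eta>) h + e * norm h"
  proof (intro exI[of _ "min d d'"] conjI ballI impI)
    show "min d d' > 0" using d d' by simp
    fix h assume "h \<in> Y" "norm h < min d d'"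
    thus "f (x + h) + g (x + h) \<le> f x + g x + blinfun_apply (\<theta> + \<eta>) h + e * norm h"
      using d(2)[of h] d'(2)[of h] by (simp add: blinfun.add_left)
  qed
qed

lemma upper_gradient_const: "upper_gradient Y (\<lambda>_. c) x 0"
  unfolding upper_gradient_def by (auto intro: exI[of _ 1])

lemma upper_gradient_sum:
  assumes "\<And>i. i \<in> I \<Longrightarrow> upper_gradient Y (f i) x (\<theta> i)"
  shows "upper_gradient Y (\<lambda>x. \<Sum>i\<in>I. f i x) x (\<Sum>i\<in>I. \<theta> i)"
  using assms
  by (induction I rule: infinite_finite_induct) (auto simp: upper_gradient_const intro: upper_gradient_add)

text \<open>Concavity of the root, in the form \<open>2 * s * t \<le> s\<^sup>2 + t\<^sup>2\<close>
  with \<open>t\<close> the perturbed root, turns an upper bound for \<open>g\<close> into one for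
  its root.\<close>

lemma upper_gradient_sqrt:
  assumes g: "upper_gradient Y g x \<theta>" and nonneg: "\<And>y. g y \<ge> 0" and pos: "g x > 0"
  shows "upper_gradient Y (\<lambda>x. sqrt (g x)) x ((1 / (2 * sqrt (g x))) *\<^sub>R \<theta>)"
  unfolding upper_gradient_def
proof (intro allI impI)
  fix e :: real assume e: "e > 0"
  define s where "s = sqrt (g x)"
  have s: "s > 0" "s\<^sup>2 = g x" using pos by (auto simp: s_def)
  have "e * (2 * s) > 0" using e s by simp
  then obtain d where d: "d > 0"
    "\<And>h. h \<in> Y \<Longrightarrow> norm h < d \<Longrightarrow> g (x + h) \<le> g x + blinfun_apply \<theta> h + e * (2 * s) * norm h"
    using upper_gradientD[OF g] by blast
  have "sqrt (g (x + h)) \<le> sqrt (g x) + blinfun_apply ((1 / (2 * sqrt (g x))) *\<^sub>R \<theta>) h + e * norm h"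
    if h: "h \<in> Y" "norm h < d" for h
  proof -
    have "0 \<le> (sqrt (g (x + h)) - s)\<^sup>2" by simp
    also have "\<dots> = g (x + h) - 2 * s * sqrt (g (x + h)) + s\<^sup>2"
      using nonneg by (simp add: power2_diff)
    finally have "2 * s * sqrt (g (x + h)) \<le> 2 * s\<^sup>2 + (g (x + h) - g x)" using s by simp
    also have "\<dots> \<le> 2 * s\<^sup>2 + (blinfun_apply \<theta> h + e * (2 * s) * norm h)" using d(2)[OF h] by simp
    also have "\<dots> = 2 * s * (s + blinfun_apply \<theta> h / (2 * s) + e * norm h)"
      using s by (simp add: field_simps power2_eq_square)
    finally have "sqrt (g (x + h)) \<le> s + blinfun_apply \<theta> h / (2 * s) + e * norm h"
      using s by simp
    thus ?thesis by (simp add: s_def blinfun.scaleR_left)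
  qed
  with d(1) show "\<exists>d>0. \<forall>h\<in>Y. norm h < d \<longrightarrow>
      sqrt (g (x + h)) \<le> sqrt (g x) + blinfun_apply ((1 / (2 * sqrt (g x))) *\<^sub>R \<theta>) h + e * norm h" by blast
qed

text \<open>Squaring smooths the kink of the positive part: the first-order upper expansion has
  error at most the square of the increment, also where the sign changes.\<close>

lemma upper_gradient_hinge_sq:
  fixes xs :: "'a::real_normed_vector \<Rightarrow>\<^sub>L real" and r :: real and x0 :: 'a
  defines "g \<equiv> \<lambda>x. (max 0 (r - blinfun_apply xs (x - x0)))\<^sup>2"
  shows "upper_gradient Y g x ((- 2 * max 0 (r - blinfun_apply xs (x - x0))) *\<^sub>R xs)"
  unfolding upper_gradient_def
proof (intro allI impI)
  fix e :: real assume e: "e > 0"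
  define d where "d = e / ((norm xs)\<^sup>2 + 1)"
  have pos: "(norm xs)\<^sup>2 + 1 > 0" by (intro add_nonneg_pos) auto
  have d: "d > 0" using e pos by (simp add: d_def)
  have "g (x + h) \<le> g x + blinfun_apply ((- 2 * max 0 (r - blinfun_apply xs (x - x0))) *\<^sub>R xs) h + e * norm h"
    if h: "norm h < d" for h
  proof -
    define t where "t = r - blinfun_apply xs (x - x0)"
    define s where "s = blinfun_apply xs h"
    have eq: "r - blinfun_apply xs (x + h - x0) = t - s"
      by (simp add: t_def s_def blinfun.diff_right blinfun.add_right)
    have hinge: "(max 0 (t - s))\<^sup>2 \<le> (max 0 t)\<^sup>2 - 2 * max 0 t * s + s\<^sup>2"
    proof (cases "t \<ge> 0")
      case True
      have "(max 0 (t - s))\<^sup>2 \<le> (t - s)\<^sup>2" by (simp add: max_def)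
      thus ?thesis using True by (simp add: power2_diff)
    next
      case False
      have "(max 0 (t - s))\<^sup>2 \<le> \<bar>s\<bar>\<^sup>2" using False by (intro power_mono) auto
      thus ?thesis using False by simp
    qed
    have "s\<^sup>2 \<le> (norm xs * norm h)\<^sup>2"
      using norm_blinfun[of xs h] by (simp add: s_def abs_le_square_iff[symmetric])
    also have "\<dots> = (norm xs)\<^sup>2 * norm h * norm h" by (simp add: power2_eq_square)
    also have "\<dots> \<le> ((norm xs)\<^sup>2 + 1) * norm h * norm h" by (intro mult_right_mono) auto
    also have "((norm xs)\<^sup>2 + 1) * norm h \<le> e" using h pos by (simp add: d_def field_simps)
    hence "((norm xs)\<^sup>2 + 1) * norm h * norm h \<le> e * norm h" by (intro mult_right_mono) auto
    finally have "s\<^sup>2 \<le> e * norm h" .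
    with hinge show ?thesis
      unfolding g_def eq by (simp add: blinfun.scaleR_left blinfun.minus_left t_def[symmetric] s_def[symmetric])
  qed
  with d show "\<exists>d>0. \<forall>h\<in>Y. norm h < d \<longrightarrow>
      g (x + h) \<le> g x + blinfun_apply ((- 2 * max 0 (r - blinfun_apply xs (x - x0))) *\<^sub>R xs) h + e * norm h"
    by blast
qed

lemma upper_gradient_smooth_norm_sq:
  assumes "frechet_smooth_on Y \<nu>" "z \<in> Y"
  obtains f where "blinfun_apply f z = (\<nu> z)\<^sup>2" "\<And>h. \<bar>blinfun_apply f h\<bar> \<le> \<nu> z * \<nu> h"
    "upper_gradient Y (\<lambda>z. (\<nu> z)\<^sup>2) z (2 *\<^sub>R f)"
  using assms unfolding frechet_smooth_on_def upper_gradient_def blinfun.scaleR_left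
  by auto

lemma upper_gradient_shift:
  assumes "upper_gradient Y g (x - w) \<theta>"
  shows "upper_gradient Y (\<lambda>x. g (x - w)) x \<theta>"
  using assms unfolding upper_gradient_def by (simp add: algebra_simps)

lemma upper_gradient_reflect:
  assumes "upper_gradient Y g (w - x) \<theta>" "subspace Y"
  shows "upper_gradient Y (\<lambda>x. g (w - x)) x (- \<theta>)"
  unfolding upper_gradient_def
proof (intro allI impI)
  fix e :: real assume "e > 0"
  then obtain d where d: "d > 0"
    "\<And>h. h \<in> Y \<Longrightarrow> norm h < d \<Longrightarrow> g (w - x + h) \<le> g (w - x) + blinfun_apply \<theta> h + e * norm h"
    using upper_gradientD[OF assms(1)] by blast
  have "g (w - (x + h)) \<le> g (w - x) + blinfun_apply (- \<theta>) h + e * norm h" if "h \<in> Y" "norm h < d" for h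
    using d(2)[of "- h"] that assms(2)
    by (simp add: subspace_neg blinfun.minus_left blinfun.minus_right algebra_simps)
  with d(1) show "\<exists>d>0. \<forall>h\<in>Y. norm h < d \<longrightarrow> g (w - (x + h)) \<le> g (w - x) + blinfun_apply (- \<theta>) h + e * norm h"
    by blast
qed

lemma upper_gradient_at_minimum:
  assumes g: "upper_gradient Y g x \<theta>" and Y: "subspace Y" and x: "x \<in> Y" "x \<in> S"
    and min: "d0 > 0" "\<And>u. u \<in> S \<Longrightarrow> u \<in> Y \<Longrightarrow> norm (u - x) < d0 \<Longrightarrow> g x \<le> g u"
  shows "- \<theta> \<in> frechet_normal_cone x (S \<inter> Y)"
  unfolding frechet_normal_cone_iff
proof safe
  fix e :: real assume "e > 0"
  then obtain d where d: "d > 0" "\<And>h. h \<in> Y \<Longrightarrow> norm h < d \<Longrightarrow> g (x + h) \<le> g x + blinfun_apply \<theta> h + e * norm h"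
    using upper_gradientD[OF g] by blast
  have "blinfun_apply (- \<theta>) (u - x) \<le> e * norm (u - x)"
    if u: "u \<in> S \<inter> Y" "norm (u - x) < min d d0" for u
    using d(2)[of "u - x"] min(2)[of u] u x Y by (simp add: subspace_diff blinfun.minus_left)
  moreover have "min d d0 > 0" using d min by simp
  ultimately show "\<exists>d>0. \<forall>u\<in>S \<inter> Y. norm (u - x) < d \<longrightarrow> blinfun_apply (- \<theta>) (u - x) \<le> e * norm (u - x)"
    by blast
qed (use x in auto)

text \<open>Small multiples of \<open>h\<close> and of \<open>- h\<close> both stay in
  \<open>Y\<close>, and the normal inequality, being homogeneous, extends to all lengths.\<close>

lemma frechet_normal_cone_subspace:
  assumes "xs \<in> frechet_normal_cone x Y" "subspace Y" "x \<in> Y" "h \<in> Y"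
  shows "blinfun_apply xs h = 0"
proof -
  have le: "blinfun_apply xs h \<le> 0" if h: "h \<in> Y" for h
  proof (rule field_le_epsilon)
    fix \<eta> :: real assume \<eta>: "\<eta> > 0"
    define e where "e = \<eta> / (norm h + 1)"
    have e: "e > 0" unfolding e_def using \<eta> by (intro divide_pos_pos add_nonneg_pos) auto
    then obtain d where d: "d > 0"
      "\<And>u. u \<in> Y \<Longrightarrow> norm (u - x) < d \<Longrightarrow> blinfun_apply xs (u - x) \<le> e * norm (u - x)"
      using assms(1) unfolding frechet_normal_cone_iff by meson
    define t where "t = d / (norm h + 1)"
    have n: "norm h + 1 > 0" by (intro add_nonneg_pos) auto
    have t: "t > 0" using d n by (simp add: t_def)
    have "norm (t *\<^sub>R h) < d" using d n by (simp add: t_def field_simps)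
    hence "blinfun_apply xs (t *\<^sub>R h) \<le> e * norm (t *\<^sub>R h)"
      using d(2)[of "x + t *\<^sub>R h"] assms(2,3) h by (simp add: subspace_add subspace_scale)
    hence "t * blinfun_apply xs h \<le> t * (e * norm h)" using t by (simp add: blinfun.scaleR_right mult_ac)
    hence "blinfun_apply xs h \<le> e * norm h" using t by simp
    also have "\<dots> \<le> e * (norm h + 1)" using e by simp
    also have "\<dots> = \<eta>" using n by (simp add: e_def)
    finally show "blinfun_apply xs h \<le> 0 + \<eta>" by simp
  qed
  have "- h \<in> Y" using assms by (simp add: subspace_neg)
  from le[OF assms(4)] le[OF this] show ?thesis by (simp add: blinfun.minus_right)
qed

text \<open>Infinitely many differentiability radii have no common positive bound. Only a finite
  head uses differentiability; the tail is controlled by a crude estimate that is uniform in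
  \<open>k\<close>, multiplied by summable weights.\<close>

lemma upper_gradient_series:
  fixes \<nu> :: "'a::real_normed_vector \<Rightarrow> real"
  assumes \<nu>: "equiv_norm \<nu>" "frechet_smooth_on Y \<nu>" and Y: "subspace Y" and x: "x \<in> Y"
    and w: "\<And>k. w k \<in> Y" and D: "\<And>k. \<nu> (x - w k) \<le> D" and \<mu>: "\<mu> > 0"
  obtains \<theta> where "upper_gradient Y (\<lambda>x. \<Sum>k. \<mu> * (1/2) ^ k * (\<nu> (x - w k))\<^sup>2) x \<theta>" "norm \<theta> \<le> 4 * \<mu> * D"
proof -
  have "\<forall>k. \<exists>f. (\<forall>h. \<bar>blinfun_apply f h\<bar> \<le> \<nu> (x - w k) * \<nu> h) \<and>
      upper_gradient Y (\<lambda>z. (\<nu> z)\<^sup>2) (x - w k) (2 *\<^sub>R f)"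
    using upper_gradient_smooth_norm_sq[OF \<nu>(2)] subspace_diff[OF Y x w] by metis
  then obtain f where f: "\<And>k h. \<bar>blinfun_apply (f k) h\<bar> \<le> \<nu> (x - w k) * \<nu> h"
    "\<And>k. upper_gradient Y (\<lambda>z. (\<nu> z)\<^sup>2) (x - w k) (2 *\<^sub>R f k)"
    by metis
  have D0: "D \<ge> 0" using D[of 0] equiv_norm_nonneg[OF \<nu>(1)] order_trans by blast
  have f_le: "\<bar>blinfun_apply (f k) h\<bar> \<le> D * norm h" for k h
    by (rule order_trans[OF f(1)])
      (intro mult_mono D equiv_norm_le_norm[OF \<nu>(1)] D0 equiv_norm_nonneg[OF \<nu>(1)])
  have f_norm: "norm (f k) \<le> D" for k
    by (rule norm_blinfun_bound[OF D0]) (simp add: f_le)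
  define m where "m = (\<lambda>k. \<mu> * (1/2) ^ k)"
  have m: "m k > 0" for k using \<mu> by (simp add: m_def)
  have m_sums: "m sums (2 * \<mu>)"
    using sums_mult[OF geometric_sums[of "1/2 :: real"], of \<mu>] by (simp add: m_def mult.commute)
  have "(\<lambda>k. 2 * D * m k) sums (2 * D * (2 * \<mu>))" by (intro sums_mult m_sums)
  hence sumsD: "(\<lambda>k. 2 * D * m k) sums (4 * \<mu> * D)" by (simp add: mult_ac)
  have nle: "norm ((2 * m k) *\<^sub>R f k) \<le> 2 * D * m k" for k
    using mult_left_mono[OF f_norm[of k], of "2 * m k"] m[of k] by (simp add: mult_ac)
  have summ_n: "summable (\<lambda>k. norm ((2 * m k) *\<^sub>R f k))"
    by (rule summable_comparison_test[OF _ sums_summable[OF sumsD]]) (use nle in auto)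
  define \<theta> where "\<theta> = (\<Sum>k. (2 * m k) *\<^sub>R f k)"
  have \<theta>_sums: "(\<lambda>k. (2 * m k) *\<^sub>R f k) sums \<theta>"
    unfolding \<theta>_def by (intro summable_sums summable_norm_cancel[OF summ_n])
  have \<theta>_apply: "(\<lambda>k. 2 * m k * blinfun_apply (f k) h) sums blinfun_apply \<theta> h" for h
    using bounded_linear.sums[OF blinfun.bounded_linear_left \<theta>_sums, of h] by (simp add: blinfun.scaleR_left)
  have \<theta>_norm: "norm \<theta> \<le> 4 * \<mu> * D"
  proof -
    have "norm \<theta> \<le> (\<Sum>k. norm ((2 * m k) *\<^sub>R f k))" unfolding \<theta>_def by (rule summable_norm[OF summ_n])
    also have "\<dots> \<le> (\<Sum>k. 2 * D * m k)" by (intro suminf_le nle summ_n sums_summable[OF sumsD])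
    also have "\<dots> = 4 * \<mu> * D" using sumsD by (simp add: sums_iff)
    finally show ?thesis .
  qed
  have summ: "summable (\<lambda>k. m k * (\<nu> (x + h - w k))\<^sup>2)" for h
  proof (rule summable_comparison_test)
    show "summable (\<lambda>k. (D + norm h)\<^sup>2 * m k)" by (intro summable_mult sums_summable[OF m_sums])
    have "norm (m k * (\<nu> (x + h - w k))\<^sup>2) \<le> (D + norm h)\<^sup>2 * m k" for k
    proof -
      have "\<nu> (x + h - w k) \<le> \<nu> (x - w k) + \<nu> h"
        using equiv_norm_triangle[OF \<nu>(1), of "x - w k" h] by (simp add: algebra_simps)
      also have "\<dots> \<le> D + norm h" by (intro add_mono D equiv_norm_le_norm \<nu>)
      finally have "(\<nu> (x + h - w k))\<^sup>2 \<le> (D + norm h)\<^sup>2" by (intro power_mono equiv_norm_nonneg \<nu>)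
      thus ?thesis using m[of k] by (simp add: abs_mult mult.commute)
    qed
    thus "\<exists>N. \<forall>k\<ge>N. norm (m k * (\<nu> (x + h - w k))\<^sup>2) \<le> (D + norm h)\<^sup>2 * m k" by blast
  qed
  have "upper_gradient Y (\<lambda>x. \<Sum>k. m k * (\<nu> (x - w k))\<^sup>2) x \<theta>"
    unfolding upper_gradient_def
  proof (intro allI impI)
    fix e :: real assume e: "e > 0"
    \<comment> \<open>The error \<open>e\<close> is distributed geometrically. The ratio
      \<open>3/4\<close> exceeds the ratio \<open>1/2\<close> of the weights, and
      \<open>1/2 = (2/3) * (3/4)\<close>, so the crude tail error eventually fits into its
      share.\<close>
    define b where "b = (\<lambda>k. e / 4 * (3/4) ^ k)"
    have b_sums: "b sums e"
      using sums_mult[OF geometric_sums[of "3/4 :: real"], of "e / 4"] by (simp add: b_def)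
    have "(\<lambda>k. (4 * D + 1) * \<mu> * (2/3) ^ k) \<longlonglongrightarrow> 0"
      by (intro tendsto_mult_right_zero LIMSEQ_realpow_zero) auto
    hence "eventually (\<lambda>k. (4 * D + 1) * \<mu> * (2/3) ^ k < e / 4) sequentially"
      using e by (intro order_tendstoD(2)) auto
    then obtain K where K: "\<And>k. k \<ge> K \<Longrightarrow> (4 * D + 1) * \<mu> * (2/3) ^ k < e / 4"
      by (auto simp: eventually_sequentially)
    have "\<exists>d>0. \<forall>h\<in>Y. norm h < d \<longrightarrow> (\<nu> (x - w k + h))\<^sup>2 \<le> (\<nu> (x - w k))\<^sup>2 + 2 * blinfun_apply (f k) h + e / (4 * \<mu>) * norm h" for k
    proof -
      have "e / (4 * \<mu>) > 0" using e \<mu> by simp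
      with f(2)[of k] show ?thesis
        unfolding upper_gradient_def blinfun.scaleR_left real_scaleR_def by blast
    qed
    then obtain d where d: "\<And>k. d k > 0" "\<And>k h. h \<in> Y \<Longrightarrow> norm h < d k \<Longrightarrow>
      (\<nu> (x - w k + h))\<^sup>2 \<le> (\<nu> (x - w k))\<^sup>2 + 2 * blinfun_apply (f k) h + e / (4 * \<mu>) * norm h"
      by metis
    \<comment> \<open>The inserted 1 covers an empty head and ensures \<open>norm h \<le> 1\<close>,
      by which the tail estimate replaces \<open>(norm h)\<^sup>2\<close> by
      \<open>norm h\<close>.\<close>
    define d0 where "d0 = Min (insert 1 (d ` {..<K}))"
    have d0: "d0 > 0" "d0 \<le> 1" "\<And>k. k < K \<Longrightarrow> d0 \<le> d k"
      using d(1) by (auto simp: d0_def)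
    show "\<exists>d>0. \<forall>h\<in>Y. norm h < d \<longrightarrow> (\<Sum>k. m k * (\<nu> (x + h - w k))\<^sup>2) \<le>
        (\<Sum>k. m k * (\<nu> (x - w k))\<^sup>2) + blinfun_apply \<theta> h + e * norm h"
    proof (intro exI[of _ d0] conjI ballI impI d0(1))
      fix h assume h: "h \<in> Y" "norm h < d0"
      have eq: "x + h - w k = x - w k + h" for k by simp
      have "m k * (\<nu> (x + h - w k))\<^sup>2 \<le> m k * (\<nu> (x - w k))\<^sup>2 + 2 * m k * blinfun_apply (f k) h + b k * norm h" for k
      proof (cases "k < K")
        case True
        have "(\<nu> (x + h - w k))\<^sup>2 \<le> (\<nu> (x - w k))\<^sup>2 + 2 * blinfun_apply (f k) h + e / (4 * \<mu>) * norm h"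
          unfolding eq using h d0(3)[OF True] by (intro d(2)) auto
        from mult_left_mono[OF this less_imp_le[OF m[of k]]]
        have "m k * (\<nu> (x + h - w k))\<^sup>2 \<le> m k * (\<nu> (x - w k))\<^sup>2 + 2 * m k * blinfun_apply (f k) h + m k * (e / (4 * \<mu>)) * norm h"
          by (simp add: algebra_simps)
        also have "m k * (e / (4 * \<mu>)) = e / 4 * (1/2) ^ k" using \<mu> by (simp add: m_def)
        also have "\<dots> \<le> b k" unfolding b_def using e by (intro mult_left_mono power_mono) auto
        hence "e / 4 * (1/2) ^ k * norm h \<le> b k * norm h" by (intro mult_right_mono) auto
        finally show ?thesis by simp
      next
        case False
        have "\<nu> (x + h - w k) \<le> \<nu> (x - w k) + norm h"
          unfolding eq using equiv_norm_triangle[OF \<nu>(1), of "x - w k" h] equiv_norm_le_norm[OF \<nu>(1), of h] by simp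
        hence "(\<nu> (x + h - w k))\<^sup>2 \<le> (\<nu> (x - w k) + norm h)\<^sup>2"
          by (intro power_mono equiv_norm_nonneg \<nu>)
        also have "\<dots> = (\<nu> (x - w k))\<^sup>2 + 2 * \<nu> (x - w k) * norm h + norm h * norm h"
          by (simp add: power2_eq_square algebra_simps)
        also have "\<dots> \<le> (\<nu> (x - w k))\<^sup>2 + 2 * D * norm h + 1 * norm h"
          using D[of k] h d0(2) by (intro add_mono mult_mono order_refl) (auto simp: D0 equiv_norm_nonneg[OF \<nu>(1)])
        \<comment> \<open>Inserting the derivative costs a further \<open>2 * D * norm h\<close>,
          since it may have the unfavourable sign.\<close>
        also have "\<dots> \<le> (\<nu> (x - w k))\<^sup>2 + 2 * blinfun_apply (f k) h + (4 * D + 1) * norm h"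
          using f_le[of k h] by (simp add: algebra_simps abs_le_iff)
        finally have "m k * (\<nu> (x + h - w k))\<^sup>2 \<le> m k * ((\<nu> (x - w k))\<^sup>2 + 2 * blinfun_apply (f k) h + (4 * D + 1) * norm h)"
          using m[of k] by (intro mult_left_mono) auto
        also have "\<dots> = m k * (\<nu> (x - w k))\<^sup>2 + 2 * m k * blinfun_apply (f k) h + ((4 * D + 1) * m k) * norm h"
          by (simp add: algebra_simps)
        also have "(4 * D + 1) * m k \<le> b k"
        proof -
          have "(4 * D + 1) * m k = ((4 * D + 1) * \<mu> * (2/3) ^ k) * (3/4) ^ k"
            by (simp add: m_def flip: power_mult_distrib)
          also have "\<dots> \<le> (e / 4) * (3/4) ^ k"
            using K[of k] False by (intro mult_right_mono) auto
          finally show ?thesis by (simp add: b_def)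
        qed
        hence "(4 * D + 1) * m k * norm h \<le> b k * norm h" by (intro mult_right_mono) auto
        finally show ?thesis by simp
      qed
      moreover have S: "(\<lambda>k. m k * (\<nu> (x - w k))\<^sup>2 + 2 * m k * blinfun_apply (f k) h + b k * norm h) sums
          ((\<Sum>k. m k * (\<nu> (x - w k))\<^sup>2) + blinfun_apply \<theta> h + e * norm h)"
        using summ[of 0] by (intro sums_add summable_sums \<theta>_apply sums_mult2 b_sums) simp
      ultimately have "(\<Sum>k. m k * (\<nu> (x + h - w k))\<^sup>2) \<le> (\<Sum>k. m k * (\<nu> (x - w k))\<^sup>2 + 2 * m k * blinfun_apply (f k) h + b k * norm h)"
        by (intro suminf_le summ) (auto simp: sums_iff)
      with sums_unique[OF S] show "(\<Sum>k. m k * (\<nu> (x + h - w k))\<^sup>2) \<le> (\<Sum>k. m k * (\<nu> (x - w k))\<^sup>2) + blinfun_apply \<theta> h + e * norm h"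
        by simp
    qed
  qed
  with \<theta>_norm show ?thesis by (intro that[of \<theta>]) (auto simp: m_def)
qed

section \<open>Normals from minimizing a penalty function\<close>

text \<open>Because of the square root, the partial derivatives of the penalty function are normalized:
  \<open>lam\<^sup>2 + (\<Sum>i\<in>I. (c i)\<^sup>2) = 1\<close>. The bound on \<open>c i\<close> says that \<open>c i / 2 - \<tau>\<close> is at most
  the norm of \<open>y i\<close> on \<open>Y\<close>.\<close>

lemma penalty_minimizer:
  fixes \<Omega> :: "'i \<Rightarrow> 'a::banach set" and xs :: "'a \<Rightarrow>\<^sub>L real" and \<rho> r \<tau> :: real
  assumes I: "finite I" and \<nu>: "equiv_norm \<nu>" "frechet_smooth_on Y \<nu>"
    and Y: "subspace Y" "closed Y" and x0: "x0 \<in> Y" and \<rho>: "\<rho> > 0" and r: "r > 0"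
    and \<Omega>: "\<And>i. i \<in> I \<Longrightarrow> x0 \<in> \<Omega> i" "\<And>i. i \<in> I \<Longrightarrow> closed (\<Omega> i \<inter> cball x0 \<rho>)"
    and sep: "\<And>x. x \<in> (\<Inter>i\<in>I. \<Omega> i) \<inter> cball x0 \<rho> \<Longrightarrow> blinfun_apply xs (x - x0) < r"
    and \<tau>: "\<tau> = 512 * r / \<rho>"
  obtains lam :: real and u :: "'i \<Rightarrow> 'a" and y :: "'i \<Rightarrow> 'a \<Rightarrow>\<^sub>L real" and c :: "'i \<Rightarrow> real"
  where "0 \<le> lam" "lam \<le> 1" "lam\<^sup>2 + (\<Sum>i\<in>I. (c i)\<^sup>2) = 1" "\<forall>i. c i \<ge> 0"
    "\<forall>i\<in>I. norm (u i - x0) < \<rho> \<and> u i \<in> Y \<and> y i \<in> frechet_normal_cone (u i) (\<Omega> i \<inter> Y) \<and>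
       (\<forall>h. \<bar>blinfun_apply (y i) h\<bar> \<le> (1 + \<tau>) * norm h)"
    "\<forall>h\<in>Y. \<bar>lam * blinfun_apply xs h - (\<Sum>i\<in>I. blinfun_apply (y i) h)\<bar> \<le> (card I + 1) * \<tau> * norm h"
    "\<forall>i\<in>I. \<forall>B\<ge>0. (\<forall>h\<in>Y. blinfun_apply (y i) h \<le> B * norm h) \<longrightarrow> c i \<le> 2 * (B + \<tau>)"
proof -
  \<comment> \<open>\<open>None\<close> indexes the free point \<open>x\<close>, and
    \<open>Some i\<close> the point \<open>u i\<close> of \<open>\<Omega> i\<close>.\<close>
  define J where "J = insert None (Some ` I)"
  have sumJ: "(\<Sum>j\<in>J. g j) = g None + (\<Sum>i\<in>I. g (Some i))" for g :: "'i option \<Rightarrow> real"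
    unfolding J_def using I by (simp add: sum.reindex)
  define S where "S = (\<lambda>j. (case j of None \<Rightarrow> UNIV | Some i \<Rightarrow> \<Omega> i \<inter> cball x0 \<rho>) \<inter> Y \<inter> cball x0 \<rho>)"
  define hinge where "hinge = (\<lambda>x. (max 0 (r - blinfun_apply xs (x - x0)))\<^sup>2)"
  define Q where "Q = (\<lambda>z. hinge (z None) + (\<Sum>i\<in>I. (\<nu> (z None - z (Some i)))\<^sup>2))"
  define F where "F = (\<lambda>z. sqrt (Q z))"
  have Q_nonneg: "Q z \<ge> 0" for z by (simp add: Q_def hinge_def sum_nonneg)
  \<comment> \<open>All points then stay within \<open>4 * \<sigma> = \<rho> / 2\<close> of
    \<open>x0\<close>, so moves shorter than \<open>\<rho> / 2\<close> cannot leave the ball and its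
    boundary produces no normals.\<close>
  define \<sigma> where "\<sigma> = \<rho> / 8"
  have \<sigma>: "\<sigma> > 0" using \<rho> by (simp add: \<sigma>_def)
  define \<mu> where "\<mu> = 2 * r / \<sigma>\<^sup>2"
  have \<mu>: "\<mu> > 0" using r \<sigma> by (simp add: \<mu>_def)
  \<comment> \<open>Origin of 512: with \<open>\<sigma> = \<rho> / 8\<close> the weight is
    \<open>\<mu> = 128 * r / \<rho>\<^sup>2\<close>, and the derivative of each perturbation series
    is bounded by \<open>4 * \<mu> * \<rho>\<close>.\<close>
  have \<mu>\<tau>: "4 * \<mu> * \<rho> = \<tau>" using \<rho> by (simp add: \<mu>_def \<sigma>_def \<tau> power2_eq_square field_simps)
  have \<tau>_nonneg: "\<tau> \<ge> 0" using r \<rho> by (simp add: \<tau>)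
  obtain z zs where z: "\<And>j. j \<in> J \<Longrightarrow> z j \<in> S j" and zs: "\<And>j k. j \<in> J \<Longrightarrow> zs k j \<in> S j"
    and z_bd: "\<And>j. j \<in> J \<Longrightarrow> norm (z j - x0) \<le> 4 * \<sigma>" and zs_bd: "\<And>j k. j \<in> J \<Longrightarrow> norm (zs k j - x0) \<le> 4 * \<sigma>"
    and min: "\<And>z'. (\<And>j. j \<in> J \<Longrightarrow> z' j \<in> S j) \<Longrightarrow>
       F z + (\<Sum>j\<in>J. \<Sum>k. \<mu> * (1/2) ^ k * (\<nu> (z j - zs k j))\<^sup>2) \<le>
       F z' + (\<Sum>j\<in>J. \<Sum>k. \<mu> * (1/2) ^ k * (\<nu> (z' j - zs k j))\<^sup>2)"
  proof (rule variational_principle[of J S "\<lambda>_. x0" \<nu> F r \<sigma>])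
    show "finite J" using I by (simp add: J_def)
    show "closed (S j)" if j: "j \<in> J" for j
    proof -
      have "closed (case j of None \<Rightarrow> UNIV | Some i \<Rightarrow> \<Omega> i \<inter> cball x0 \<rho>)"
        using j \<Omega>(2) by (auto simp: J_def)
      thus ?thesis unfolding S_def using Y(2) by (intro closed_Int closed_cball)
    qed
    show "x0 \<in> S j" if "j \<in> J" for j
      using that \<Omega>(1) x0 \<rho> by (auto simp: S_def J_def)
    show "F z \<ge> 0" for z using Q_nonneg by (simp add: F_def)
    show "(\<lambda>k. F (zs k)) \<longlonglongrightarrow> F z" if "\<And>j. j \<in> J \<Longrightarrow> (\<lambda>k. zs k j) \<longlonglongrightarrow> z j" for zs z
      unfolding F_def Q_def hinge_def
      by (intro tendsto_intros equiv_norm_tendsto[OF \<nu>(1)] that) (auto simp: J_def)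
    show "F (\<lambda>_. x0) \<le> r"
      using r by (simp add: F_def Q_def hinge_def equiv_norm_zero[OF \<nu>(1)] blinfun.zero_right)
    fix z zs
    assume h: "\<And>j. j \<in> J \<Longrightarrow> z j \<in> S j" "\<And>j k. j \<in> J \<Longrightarrow> zs k j \<in> S j"
      "\<And>j. j \<in> J \<Longrightarrow> norm (z j - x0) \<le> 4 * \<sigma>" "\<And>j k. j \<in> J \<Longrightarrow> norm (zs k j - x0) \<le> 4 * \<sigma>"
      "\<And>z'. (\<And>j. j \<in> J \<Longrightarrow> z' j \<in> S j) \<Longrightarrow>
         F z + (\<Sum>j\<in>J. \<Sum>k. 2 * r / \<sigma>\<^sup>2 * (1/2) ^ k * (\<nu> (z j - zs k j))\<^sup>2) \<le>
         F z' + (\<Sum>j\<in>J. \<Sum>k. 2 * r / \<sigma>\<^sup>2 * (1/2) ^ k * (\<nu> (z' j - zs k j))\<^sup>2)"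
    show thesis by (rule that[of z zs]) (fact h(1-4) h(5)[folded \<mu>_def])+
  qed (rule \<nu>(1) r \<sigma>)+
  define x where "x = z None"
  define u where "u = (\<lambda>i. z (Some i))"
  have NJ: "None \<in> J" and SJ: "\<And>i. i \<in> I \<Longrightarrow> Some i \<in> J" by (auto simp: J_def)
  have xY: "x \<in> Y" and uY: "\<And>i. i \<in> I \<Longrightarrow> u i \<in> Y"
    using z[OF NJ] z[OF SJ] by (auto simp: S_def x_def u_def)
  have zY: "z j \<in> Y" "zs k j \<in> Y" if "j \<in> J" for j k using z[OF that] zs[OF that] by (auto simp: S_def)
  have u\<Omega>: "u i \<in> \<Omega> i" if "i \<in> I" for i using z[OF SJ[OF that]] by (auto simp: S_def u_def)
  have half: "norm (z j - x0) \<le> \<rho> / 2" if "j \<in> J" for j using z_bd[OF that] by (simp add: \<sigma>_def)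
  have in_ball: "w \<in> cball x0 \<rho>" if "j \<in> J" "norm (w - z j) < \<rho> / 2" for w j
  proof -
    have "norm (w - x0) \<le> norm (w - z j) + norm (z j - x0)"
      using norm_triangle_ineq[of "w - z j" "z j - x0"] by simp
    also have "\<dots> \<le> \<rho>" using that(2) half[OF that(1)] by simp
    finally show ?thesis by (simp add: dist_norm norm_minus_commute)
  qed
  define s where "s = F z"
  define a where "a = max 0 (r - blinfun_apply xs (x - x0))"
  \<comment> \<open>If \<open>Q z\<close> vanished, all \<open>u i\<close> would coincide with
    \<open>x\<close>, a point of the intersection in the ball, and the vanishing hinge would
    contradict \<open>sep\<close>. Positivity is what makes the root differentiable.\<close>
  have Qpos: "Q z > 0"
  proof (rule ccontr)
    assume "\<not> Q z > 0"
    hence "Q z = 0" using Q_nonneg[of z] by simp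
    hence h0: "hinge x = 0" and s0: "(\<Sum>i\<in>I. (\<nu> (x - u i))\<^sup>2) = 0"
      by (simp_all add: Q_def hinge_def x_def u_def add_nonneg_eq_0_iff sum_nonneg)
    have "x = u i" if "i \<in> I" for i
    proof -
      have "\<nu> (x - u i) = 0" using s0 I that by (simp add: sum_nonneg_eq_0_iff)
      thus ?thesis using norm_le_2_equiv_norm[OF \<nu>(1), of "x - u i"] by simp
    qed
    hence "x \<in> (\<Inter>i\<in>I. \<Omega> i)" using u\<Omega> by auto
    moreover have "x \<in> cball x0 \<rho>" using z[OF NJ] by (simp add: x_def S_def)
    ultimately have "blinfun_apply xs (x - x0) < r" by (intro sep) auto
    with h0 show False by (simp add: hinge_def)
  qed
  have s: "s > 0" "s\<^sup>2 = Q z" using Qpos by (auto simp: s_def F_def)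
  have xuY: "x - u i \<in> Y" if "i \<in> I" for i using xY uY[OF that] Y(1) by (simp add: subspace_diff)
  have "\<forall>i\<in>I. \<exists>f. blinfun_apply f (x - u i) = (\<nu> (x - u i))\<^sup>2 \<and> (\<forall>h. \<bar>blinfun_apply f h\<bar> \<le> \<nu> (x - u i) * \<nu> h) \<and>
    upper_gradient Y (\<lambda>z. (\<nu> z)\<^sup>2) (x - u i) (2 *\<^sub>R f)"
    using upper_gradient_smooth_norm_sq[OF \<nu>(2) xuY] by metis
  then obtain f where f: "\<And>i. i \<in> I \<Longrightarrow> blinfun_apply (f i) (x - u i) = (\<nu> (x - u i))\<^sup>2"
    "\<And>i h. i \<in> I \<Longrightarrow> \<bar>blinfun_apply (f i) h\<bar> \<le> \<nu> (x - u i) * \<nu> h"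
    "\<And>i. i \<in> I \<Longrightarrow> upper_gradient Y (\<lambda>z. (\<nu> z)\<^sup>2) (x - u i) (2 *\<^sub>R f i)"
    by metis
  define pert where "pert = (\<lambda>j w. \<Sum>k. \<mu> * (1/2) ^ k * (\<nu> (w - zs k j))\<^sup>2)"
  have "\<exists>\<theta>. upper_gradient Y (pert j) (z j) \<theta> \<and> norm \<theta> \<le> \<tau>" if j: "j \<in> J" for j
  proof -
    have bd: "\<nu> (z j - zs k j) \<le> \<rho>" for k
      using equiv_norm_le_norm[OF \<nu>(1), of "z j - zs k j"] norm_triangle_ineq4[of "z j - x0" "zs k j - x0"]
        z_bd[OF j] zs_bd[OF j, of k] by (simp add: \<sigma>_def)
    obtain \<theta> where "upper_gradient Y (pert j) (z j) \<theta>" "norm \<theta> \<le> 4 * \<mu> * \<rho>"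
      unfolding pert_def by (rule upper_gradient_series[OF \<nu> Y(1) zY(1)[OF j] zY(2)[OF j] bd \<mu>])
    thus ?thesis using \<mu>\<tau> by auto
  qed
  then obtain \<theta> where \<theta>: "\<And>j. j \<in> J \<Longrightarrow> upper_gradient Y (pert j) (z j) (\<theta> j)" "\<And>j. j \<in> J \<Longrightarrow> norm (\<theta> j) \<le> \<tau>"
    by metis
  have \<theta>_le: "\<bar>blinfun_apply (\<theta> j) h\<bar> \<le> \<tau> * norm h" if "j \<in> J" for j h
    using norm_blinfun[of "\<theta> j" h] mult_right_mono[OF \<theta>(2)[OF that] norm_ge_zero[of h]] by simp
  have min': "F z + (pert None x + (\<Sum>i\<in>I. pert (Some i) (u i))) \<le> F z' + (pert None (z' None) + (\<Sum>i\<in>I. pert (Some i) (z' (Some i))))"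
    if "\<And>j. j \<in> J \<Longrightarrow> z' j \<in> S j" for z'
    using min[OF that] by (simp add: sumJ pert_def x_def u_def)
  \<comment> \<open>The derivative in the free variable \<open>x\<close>. The only constraints on
    \<open>x\<close> are \<open>Y\<close> and the ball, whose boundary is not reached, so
    \<open>\<Theta>\<close> vanishes on \<open>Y\<close>.\<close>
  define \<Theta> where "\<Theta> = (1 / (2 * s)) *\<^sub>R (((- 2 * a) *\<^sub>R xs) + (\<Sum>i\<in>I. 2 *\<^sub>R f i)) + \<theta> None"
  have \<Theta>0: "blinfun_apply \<Theta> h = 0" if h: "h \<in> Y" for h
  proof -
    have "upper_gradient Y (\<lambda>w. hinge w + (\<Sum>i\<in>I. (\<nu> (w - u i))\<^sup>2)) x (((- 2 * a) *\<^sub>R xs) + (\<Sum>i\<in>I. 2 *\<^sub>R f i))"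
      unfolding hinge_def a_def
      by (intro upper_gradient_add upper_gradient_sum upper_gradient_hinge_sq upper_gradient_shift f)
    hence "upper_gradient Y (\<lambda>w. sqrt (hinge w + (\<Sum>i\<in>I. (\<nu> (w - u i))\<^sup>2))) x
        ((1 / (2 * sqrt (hinge x + (\<Sum>i\<in>I. (\<nu> (x - u i))\<^sup>2)))) *\<^sub>R (((- 2 * a) *\<^sub>R xs) + (\<Sum>i\<in>I. 2 *\<^sub>R f i)))"
    proof (rule upper_gradient_sqrt)
      show "0 \<le> hinge w + (\<Sum>i\<in>I. (\<nu> (w - u i))\<^sup>2)" for w by (simp add: hinge_def sum_nonneg)
      show "0 < hinge x + (\<Sum>i\<in>I. (\<nu> (x - u i))\<^sup>2)" using Qpos by (simp add: Q_def x_def u_def)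
    qed
    moreover have "sqrt (hinge x + (\<Sum>i\<in>I. (\<nu> (x - u i))\<^sup>2)) = s" by (simp add: s_def F_def Q_def x_def u_def)
    ultimately have ug: "upper_gradient Y (\<lambda>w. sqrt (hinge w + (\<Sum>i\<in>I. (\<nu> (w - u i))\<^sup>2)) + pert None w) x \<Theta>"
      unfolding \<Theta>_def using upper_gradient_add[OF _ \<theta>(1)[OF NJ]] by (simp add: x_def)
    have "- \<Theta> \<in> frechet_normal_cone x (UNIV \<inter> Y)"
    proof (rule upper_gradient_at_minimum[OF ug Y(1) xY UNIV_I])
      show "\<rho> / 2 > 0" using \<rho> by simp
      fix w assume w: "w \<in> Y" "norm (w - x) < \<rho> / 2"
      define z' where "z' = z(None := w)"
      have "z' j \<in> S j" if "j \<in> J" for j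
        using z[OF that] w in_ball[OF NJ, of w] by (auto simp: z'_def S_def x_def)
      from min'[OF this] show "sqrt (hinge x + (\<Sum>i\<in>I. (\<nu> (x - u i))\<^sup>2)) + pert None x
          \<le> sqrt (hinge w + (\<Sum>i\<in>I. (\<nu> (w - u i))\<^sup>2)) + pert None w"
        by (simp add: F_def Q_def z'_def x_def u_def)
    qed
    hence "blinfun_apply (- \<Theta>) h = 0" using Y xY h by (intro frechet_normal_cone_subspace[of _ x Y]) auto
    thus ?thesis by (simp add: blinfun.minus_left)
  qed
  \<comment> \<open>Minus the derivative in the variable \<open>u i\<close>; summing over
    \<open>i\<close> compares with \<open>\<Theta>\<close> because the penalty depends on
    \<open>x - u i\<close>.\<close>
  define y where "y = (\<lambda>i. (1 / s) *\<^sub>R f i - \<theta> (Some i))"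
  have y_normal: "y i \<in> frechet_normal_cone (u i) (\<Omega> i \<inter> Y)" if i: "i \<in> I" for i
  proof -
    define C where "C = hinge x + (\<Sum>k\<in>I - {i}. (\<nu> (x - u k))\<^sup>2)"
    have C: "C \<ge> 0" by (simp add: C_def hinge_def sum_nonneg)
    have QC: "Q (z(Some i := w)) = C + (\<nu> (x - w))\<^sup>2" for w
    proof -
      have "(\<Sum>k\<in>I. (\<nu> (x - (z(Some i := w)) (Some k)))\<^sup>2) = (\<nu> (x - w))\<^sup>2 + (\<Sum>k\<in>I - {i}. (\<nu> (x - u k))\<^sup>2)"
        by (subst sum.remove[OF I i]) (auto simp: u_def intro!: sum.cong)
      thus ?thesis by (simp add: Q_def C_def x_def)
    qed
    have Qz: "Q z = C + (\<nu> (x - u i))\<^sup>2" using QC[of "u i"] by (simp add: u_def fun_upd_idem)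
    have "upper_gradient Y (\<lambda>w. C + (\<nu> (x - w))\<^sup>2) (u i) (0 + - (2 *\<^sub>R f i))"
      by (intro upper_gradient_add upper_gradient_const upper_gradient_reflect[OF f(3)[OF i] Y(1)])
    hence "upper_gradient Y (\<lambda>w. sqrt (C + (\<nu> (x - w))\<^sup>2)) (u i) ((1 / (2 * sqrt (C + (\<nu> (x - u i))\<^sup>2))) *\<^sub>R (0 + - (2 *\<^sub>R f i)))"
      using C Qpos Qz by (intro upper_gradient_sqrt) auto
    moreover have "sqrt (C + (\<nu> (x - u i))\<^sup>2) = s" by (simp add: s_def F_def Qz)
    moreover have "upper_gradient Y (pert (Some i)) (u i) (\<theta> (Some i))" using \<theta>(1)[OF SJ[OF i]] by (simp add: u_def)
    ultimately have "upper_gradient Y (\<lambda>w. sqrt (C + (\<nu> (x - w))\<^sup>2) + pert (Some i) w) (u i)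
        ((1 / (2 * s)) *\<^sub>R (0 + - (2 *\<^sub>R f i)) + \<theta> (Some i))"
      using upper_gradient_add by force
    also have "(1 / (2 * s)) *\<^sub>R (0 + - (2 *\<^sub>R f i)) + \<theta> (Some i) = - y i"
      using s by (simp add: y_def)
    finally have ug: "upper_gradient Y (\<lambda>w. sqrt (C + (\<nu> (x - w))\<^sup>2) + pert (Some i) w) (u i) (- y i)" .
    have "- (- y i) \<in> frechet_normal_cone (u i) (\<Omega> i \<inter> Y)"
    proof (rule upper_gradient_at_minimum[OF ug Y(1) uY[OF i] u\<Omega>[OF i]])
      show "\<rho> / 2 > 0" using \<rho> by simp
      fix w assume w: "w \<in> \<Omega> i" "w \<in> Y" "norm (w - u i) < \<rho> / 2"
      define z' where "z' = z(Some i := w)"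
      have "z' j \<in> S j" if "j \<in> J" for j
        using z[OF that] w in_ball[OF SJ[OF i], of w] by (auto simp: z'_def S_def u_def)
      note le = min'[OF this]
      have "z' None = x" by (simp add: z'_def x_def)
      with le have "F z + (\<Sum>k\<in>I. pert (Some k) (u k)) \<le> F z' + (\<Sum>k\<in>I. pert (Some k) (z' (Some k)))"
        by simp
      moreover have "(\<Sum>k\<in>I. pert (Some k) (z' (Some k))) = pert (Some i) w + (\<Sum>k\<in>I - {i}. pert (Some k) (u k))"
        by (subst sum.remove[OF I i]) (auto simp: z'_def u_def intro!: sum.cong)
      moreover have "(\<Sum>k\<in>I. pert (Some k) (u k)) = pert (Some i) (u i) + (\<Sum>k\<in>I - {i}. pert (Some k) (u k))"
        by (rule sum.remove[OF I i])
      ultimately show "sqrt (C + (\<nu> (x - u i))\<^sup>2) + pert (Some i) (u i) \<le> sqrt (C + (\<nu> (x - w))\<^sup>2) + pert (Some i) w"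
        by (simp add: F_def Qz QC z'_def)
    qed
    thus ?thesis by simp
  qed
  define lam where "lam = a / s"
  define c where "c = (\<lambda>i. \<nu> (x - u i) / s)"
  have c_nonneg: "c i \<ge> 0" for i using equiv_norm_nonneg[OF \<nu>(1)] s by (simp add: c_def)
  have one: "lam\<^sup>2 + (\<Sum>i\<in>I. (c i)\<^sup>2) = 1"
  proof -
    have "lam\<^sup>2 + (\<Sum>i\<in>I. (c i)\<^sup>2) = (a\<^sup>2 + (\<Sum>i\<in>I. (\<nu> (x - u i))\<^sup>2)) / s\<^sup>2"
      by (simp add: lam_def c_def power_divide sum_divide_distrib add_divide_distrib)
    also have "a\<^sup>2 + (\<Sum>i\<in>I. (\<nu> (x - u i))\<^sup>2) = s\<^sup>2"
      unfolding s(2) by (simp add: Q_def hinge_def a_def x_def u_def)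
    finally show ?thesis using s(1) by simp
  qed
  have c_le: "c i \<le> 1" if "i \<in> I" for i
  proof -
    have "(c i)\<^sup>2 \<le> (\<Sum>i\<in>I. (c i)\<^sup>2)" using I that by (intro member_le_sum) auto
    also have "\<dots> \<le> 1\<^sup>2" unfolding power_one using one zero_le_power2[of lam] by linarith
    finally show ?thesis by (rule power2_le_imp_le) simp
  qed
  have lam: "0 \<le> lam" "lam \<le> 1"
  proof -
    show "0 \<le> lam" using s by (simp add: lam_def a_def)
    have "lam\<^sup>2 \<le> 1\<^sup>2" unfolding power_one using one sum_nonneg[of I "\<lambda>i. (c i)\<^sup>2"] by auto
    thus "lam \<le> 1" by (rule power2_le_imp_le) simp
  qed
  have y_le: "\<bar>blinfun_apply (y i) h\<bar> \<le> (1 + \<tau>) * norm h" if i: "i \<in> I" for i h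
  proof -
    have "\<bar>blinfun_apply (f i) h\<bar> / s \<le> c i * \<nu> h"
      using f(2)[OF i, of h] s by (simp add: c_def field_simps)
    also have "\<dots> \<le> 1 * norm h"
      using c_le[OF i] c_nonneg equiv_norm_le_norm[OF \<nu>(1)] equiv_norm_nonneg[OF \<nu>(1)] by (intro mult_mono) auto
    finally have "\<bar>blinfun_apply (f i) h / s\<bar> \<le> norm h" using s by simp
    moreover have "blinfun_apply (y i) h = blinfun_apply (f i) h / s - blinfun_apply (\<theta> (Some i)) h"
      by (simp add: y_def blinfun.diff_left blinfun.scaleR_left)
    moreover have "(1 + \<tau>) * norm h = norm h + \<tau> * norm h" by (simp add: algebra_simps)
    ultimately show ?thesis using \<theta>_le[OF SJ[OF i], of h] by linarith
  qed
  have sum_y: "\<bar>lam * blinfun_apply xs h - (\<Sum>i\<in>I. blinfun_apply (y i) h)\<bar> \<le> (card I + 1) * \<tau> * norm h"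
    if h: "h \<in> Y" for h
  proof -
    have "0 = blinfun_apply \<Theta> h" using \<Theta>0[OF h] by simp
    also have "\<dots> = (1 / (2 * s)) * ((- 2 * a) * blinfun_apply xs h + (\<Sum>i\<in>I. 2 * blinfun_apply (f i) h)) + blinfun_apply (\<theta> None) h"
      unfolding \<Theta>_def blinfun.add_left blinfun.scaleR_left blinfun.sum_left real_scaleR_def ..
    also have "\<dots> = (- a * blinfun_apply xs h + (\<Sum>i\<in>I. blinfun_apply (f i) h)) / s + blinfun_apply (\<theta> None) h"
      using s(1) by (simp add: field_simps flip: sum_distrib_left)
    finally have "lam * blinfun_apply xs h - (\<Sum>i\<in>I. blinfun_apply (f i) h / s) = blinfun_apply (\<theta> None) h"
      using s by (simp add: lam_def field_simps flip: sum_divide_distrib)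
    hence "lam * blinfun_apply xs h - (\<Sum>i\<in>I. blinfun_apply (y i) h) = blinfun_apply (\<theta> None) h + (\<Sum>i\<in>I. blinfun_apply (\<theta> (Some i)) h)"
      by (simp add: y_def blinfun.diff_left blinfun.scaleR_left sum_subtractf)
    also have "\<bar>\<dots>\<bar> \<le> \<tau> * norm h + (\<Sum>i\<in>I. \<tau> * norm h)"
      by (intro order_trans[OF abs_triangle_ineq] add_mono \<theta>_le NJ order_trans[OF sum_abs] sum_mono SJ)
    finally show ?thesis by (simp add: algebra_simps)
  qed
  \<comment> \<open>Testing \<open>y i\<close> at \<open>x - u i\<close> recovers the full size of
    \<open>f i\<close>, as \<open>f i\<close> takes the value \<open>\<nu>\<^sup>2\<close> there.
    The factor 2 comes from returning from the original norm to \<open>\<nu>\<close>.\<close>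
  have c_bound: "c i \<le> 2 * (B + \<tau>)" if i: "i \<in> I" and B: "B \<ge> 0" "\<And>h. h \<in> Y \<Longrightarrow> blinfun_apply (y i) h \<le> B * norm h" for i B
  proof (cases "\<nu> (x - u i) = 0")
    case True
    thus ?thesis using B(1) \<tau>_nonneg by (simp add: c_def)
  next
    case False
    hence pos: "\<nu> (x - u i) > 0" using equiv_norm_nonneg[OF \<nu>(1), of "x - u i"] by simp
    let ?h = "x - u i"
    have "c i * \<nu> ?h = blinfun_apply (y i) ?h + blinfun_apply (\<theta> (Some i)) ?h"
      using f(1)[OF i] s by (simp add: c_def y_def blinfun.diff_left blinfun.scaleR_left power2_eq_square)
    also have "\<dots> \<le> B * norm ?h + \<tau> * norm ?h"
      using B(2)[OF xuY[OF i]] \<theta>_le[OF SJ[OF i], of ?h] by (simp add: abs_le_iff)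
    also have "\<dots> = (B + \<tau>) * norm ?h" by (simp add: algebra_simps)
    also have "\<dots> \<le> (B + \<tau>) * (2 * \<nu> ?h)"
      using B(1) \<tau>_nonneg by (intro mult_left_mono norm_le_2_equiv_norm \<nu>) auto
    finally have "c i * \<nu> ?h \<le> (2 * (B + \<tau>)) * \<nu> ?h" by (simp only: mult_ac)
    thus ?thesis using pos by simp
  qed
  have u_near: "norm (u i - x0) < \<rho>" if "i \<in> I" for i
    using half[OF SJ[OF that]] \<rho> by (simp add: u_def)
  show ?thesis
    by (rule that[of lam c u y]) (use lam u_near uY y_normal y_le sum_y one c_nonneg c_bound in blast)+
qed

text \<open>With \<open>n = |I| + 1\<close> and \<open>\<rho> = min (r * R r) \<eta>\<close>, the
  total error \<open>n * \<tau>\<close> is of order \<open>n / R r\<close> or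
  \<open>n * r / \<eta>\<close>. The first is small by the growth condition on \<open>I\<close>, the
  second because moreover \<open>r * R r\<close> is bounded.\<close>

lemma R_normal_approx:
  fixes \<Omega> :: "'i \<Rightarrow> 'a::banach set" and xs :: "'a \<Rightarrow>\<^sub>L real"
  assumes asp: "asplund_space TYPE('a)"
    and \<delta>: "\<delta> > 0" "\<And>i. i \<in> T \<Longrightarrow> closed (\<Omega> i \<inter> cball x0 \<delta>)"
    and R: "rate_function R" "R_normal R T \<Omega> x0 xs" and \<epsilon>: "\<epsilon> > 0"
  obtains I :: "'i set" and x :: "'i \<Rightarrow> 'a" and ys :: "'i \<Rightarrow> 'a \<Rightarrow>\<^sub>L real" and lam :: real
  where "finite I" "I \<subseteq> T"
    "\<forall>i\<in>I. ys i \<in> frechet_normal_cone (x i) (\<Omega> i) \<and> norm (x i - x0) < \<epsilon> \<and> norm (ys i) \<le> 2"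
    "0 \<le> lam" "lam \<le> 1"
    "norm (lam *\<^sub>R xs - (\<Sum>i\<in>I. ys i)) \<le> \<epsilon>" "lam\<^sup>2 + (\<Sum>i\<in>I. (norm (ys i))\<^sup>2) \<ge> 1/16"
proof -
  obtain M0 where R0: "\<And>r. r \<ge> 0 \<Longrightarrow> R r \<ge> 0" and M0: "\<And>r. r \<ge> 0 \<Longrightarrow> r * R r \<le> M0"
    and Rlim: "filterlim R at_top (at_right 0)"
    using R(1) unfolding rate_function_def by blast
  have M0_nonneg: "M0 \<ge> 0" using M0[of 0] by simp
  obtain Ir where Ir: "(\<lambda>r. real (card (Ir r)) powr (3/2)) \<in> o[at_right 0](R)"
    "\<forall>\<^sub>F r in at_right 0. finite (Ir r) \<and> Ir r \<subseteq> T \<and>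
           (\<forall>x \<in> (\<Inter>i\<in>Ir r. \<Omega> i) \<inter> cball x0 (r * R r). blinfun_apply xs (x - x0) - r * norm (x - x0) < r)"
    and x0: "x0 \<in> (\<Inter>i\<in>T. \<Omega> i)"
    using R(2) unfolding R_normal_def by blast
  define C where "C = 512 * (1 + M0)"
  have C: "C > 0" using M0_nonneg by (simp add: C_def)
  define \<kappa> where "\<kappa> = min \<epsilon> (1/4)"
  have \<kappa>: "\<kappa> > 0" using \<epsilon> by (simp add: \<kappa>_def)
  define \<eta> where "\<eta> = min \<epsilon> \<delta>"
  have \<eta>: "\<eta> > 0" using \<epsilon> \<delta> by (simp add: \<eta>_def)
  \<comment> \<open>The two bounds correspond to the two alternatives in the minimum defining
    \<open>\<rho>\<close> below.\<close>
  define \<beta> where "\<beta> = min (\<kappa> / C) (\<kappa> * \<eta> / (C * (M0 + 1)))"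
  have \<beta>: "\<beta> > 0" using \<kappa> C \<eta> M0_nonneg by (simp add: \<beta>_def)
  have ev1: "\<forall>\<^sub>F r in at_right 0. norm (real (card (Ir r)) powr (3/2)) \<le> \<beta> / 2 * norm (R r)"
    using landau_o.smallD[OF Ir(1), of "\<beta> / 2"] \<beta> by simp
  have ev2: "\<forall>\<^sub>F r in at_right 0. R r \<ge> 2 / \<beta>"
    using Rlim unfolding filterlim_at_top by blast
  have ev3: "\<forall>\<^sub>F r in at_right (0::real). r > 0" by (rule eventually_at_right_less)
  obtain r where r: "r > 0" "R r \<ge> 2 / \<beta>" "norm (real (card (Ir r)) powr (3/2)) \<le> \<beta> / 2 * norm (R r)"
    "finite (Ir r)" "Ir r \<subseteq> T"
    "\<And>x. x \<in> (\<Inter>i\<in>Ir r. \<Omega> i) \<inter> cball x0 (r * R r) \<Longrightarrow> blinfun_apply xs (x - x0) - r * norm (x - x0) < r"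
    using eventually_happens'[OF trivial_limit_at_right_real eventually_conj[OF ev3 eventually_conj[OF ev2 eventually_conj[OF ev1 Ir(2)]]]]
    by blast
  define I where "I = Ir r"
  define n where "n = real (card I) + 1"
  have Rpos: "R r > 0" using r(2) \<beta> by (smt (verit) divide_pos_pos)
  have n_le: "n \<le> \<beta> * R r"
  proof -
    \<comment> \<open>A natural number is at most its power with exponent \<open>3/2\<close>; one
      half of \<open>\<beta>\<close> pays for \<open>card I\<close>, the other for the added
      1.\<close>
    have "real (card I) \<le> real (card I) powr (3/2)"
      using powr_mono[of 1 "3/2" "real (card I)"] by (cases "card I = 0") auto
    also have "\<dots> \<le> \<beta> / 2 * R r" using r(3) Rpos by (simp add: I_def)
    moreover have "1 \<le> \<beta> / 2 * R r" using r(2) \<beta> by (simp add: field_simps)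
    ultimately show ?thesis by (simp add: n_def)
  qed
  define \<rho> where "\<rho> = min (r * R r) \<eta>"
  have \<rho>: "\<rho> > 0" "\<rho> \<le> r * R r" "\<rho> \<le> \<epsilon>" "\<rho> \<le> \<delta>" using r(1) Rpos \<eta> by (auto simp: \<rho>_def \<eta>_def)
  \<comment> \<open>On the ball \<open>norm (x - x0) \<le> r * R r \<le> M0\<close>, so the term
    \<open>r * norm (x - x0)\<close> is at most \<open>r * M0\<close>.\<close>
  define r' where "r' = r * (1 + M0)"
  have r': "r' > 0" using r(1) M0_nonneg by (simp add: r'_def)
  define \<tau> where "\<tau> = 512 * r' / \<rho>"
  have \<tau>_nonneg: "\<tau> \<ge> 0" using r' \<rho> by (simp add: \<tau>_def)
  have n\<tau>: "n * \<tau> \<le> \<kappa>"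
  proof -
    have "C * n \<le> \<kappa> * R r"
    proof -
      have "C * n \<le> C * (\<beta> * R r)" using n_le C by simp
      also have "\<dots> \<le> C * ((\<kappa> / C) * R r)" using C Rpos by (intro mult_left_mono mult_right_mono) (auto simp: \<beta>_def)
      finally show ?thesis using C by simp
    qed
    hence 1: "C * n * r \<le> \<kappa> * (r * R r)" using mult_right_mono[of "C * n" "\<kappa> * R r" r] r(1) by (simp add: mult_ac)
    have 2: "C * n * r \<le> \<kappa> * \<eta>"
    proof -
      have "n * r \<le> \<beta> * R r * r" using n_le r(1) by (intro mult_right_mono) auto
      also have "\<dots> = \<beta> * (r * R r)" by simp
      also have "\<dots> \<le> \<beta> * (M0 + 1)" using M0[of r] r(1) \<beta> by (intro mult_left_mono) auto
      also have "\<dots> \<le> \<kappa> * \<eta> / (C * (M0 + 1)) * (M0 + 1)" using M0_nonneg by (intro mult_right_mono) (auto simp: \<beta>_def)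
      also have "\<dots> = \<kappa> * \<eta> / C" using M0_nonneg C by simp
      finally show ?thesis using C by (simp add: field_simps)
    qed
    have "C * n * r \<le> \<kappa> * \<rho>" using 1 2 by (simp add: \<rho>_def min_def)
    thus ?thesis using \<rho>(1) by (simp add: \<tau>_def r'_def C_def field_simps)
  qed
  have n1: "n \<ge> 1" by (simp add: n_def)
  have \<tau>_small: "\<tau> \<le> 1/4" "n * \<tau> \<le> \<epsilon>" "n * \<tau> \<le> 1/4"
    using n\<tau> mult_right_mono[OF n1 \<tau>_nonneg] by (auto simp: \<kappa>_def)
  have fin: "finite I" and IT: "I \<subseteq> T" using r by (auto simp: I_def)
  obtain Y and L :: "('a \<Rightarrow>\<^sub>L real) \<Rightarrow> ('a \<Rightarrow>\<^sub>L real)" where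
    Y: "{x0} \<subseteq> Y" "closed Y" "subspace Y" "separable_space (top_of_set Y)" and L: "linear L" "L xs = xs"
    "\<And>g y. y \<in> Y \<Longrightarrow> blinfun_apply (L g) y = blinfun_apply g y"
    "\<And>g c. c \<ge> 0 \<Longrightarrow> (\<And>y. y \<in> Y \<Longrightarrow> \<bar>blinfun_apply g y\<bar> \<le> c * norm y) \<Longrightarrow> norm (L g) \<le> c"
    "\<And>g i x. i \<in> I \<Longrightarrow> x \<in> Y \<Longrightarrow> g \<in> frechet_normal_cone x (\<Omega> i \<inter> Y) \<Longrightarrow> L g \<in> frechet_normal_cone x (\<Omega> i)"
    by (rule separable_reduction[of I "{x0}" xs \<Omega>]) (use fin in \<open>auto intro: countable_finite\<close>)
  have "separable_subspace_dual Y" using asp Y unfolding asplund_space_def by blast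
  then obtain \<nu> where \<nu>: "equiv_norm \<nu>" "frechet_smooth_on Y \<nu>"
    using smooth_norm_exists[OF Y(3)] by blast
  have sep: "blinfun_apply xs (x - x0) < r'" if x: "x \<in> (\<Inter>i\<in>I. \<Omega> i) \<inter> cball x0 \<rho>" for x
  proof -
    have nx: "norm (x - x0) \<le> \<rho>" using x by (simp add: dist_norm norm_minus_commute)
    have "blinfun_apply xs (x - x0) < r + r * norm (x - x0)"
      using r(6)[of x] x \<rho>(2) by (auto simp: I_def)
    also have "norm (x - x0) \<le> M0" using nx \<rho>(2) M0[of r] r(1) by simp
    hence "r * norm (x - x0) \<le> r * M0" using r(1) by simp
    finally show ?thesis by (simp add: r'_def algebra_simps)
  qed
  have cl: "closed (\<Omega> i \<inter> cball x0 \<rho>)" if "i \<in> I" for i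
  proof -
    have "\<Omega> i \<inter> cball x0 \<rho> = (\<Omega> i \<inter> cball x0 \<delta>) \<inter> cball x0 \<rho>" using \<rho>(4) by auto
    moreover have "closed (\<Omega> i \<inter> cball x0 \<delta>)" using \<delta>(2) that IT by blast
    ultimately show ?thesis by (metis closed_Int closed_cball)
  qed
  have x0\<Omega>: "x0 \<in> \<Omega> i" if "i \<in> I" for i using x0 that IT by blast
  have x0Y: "x0 \<in> Y" using Y(1) by simp
  obtain lam :: real and u :: "'i \<Rightarrow> 'a" and y :: "'i \<Rightarrow> 'a \<Rightarrow>\<^sub>L real" and c :: "'i \<Rightarrow> real"
  where lam: "0 \<le> lam" "lam \<le> 1" and c1: "lam\<^sup>2 + (\<Sum>i\<in>I. (c i)\<^sup>2) = 1" "\<forall>i. c i \<ge> 0"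
    and uy: "\<forall>i\<in>I. norm (u i - x0) < \<rho> \<and> u i \<in> Y \<and> y i \<in> frechet_normal_cone (u i) (\<Omega> i \<inter> Y) \<and>
       (\<forall>h. \<bar>blinfun_apply (y i) h\<bar> \<le> (1 + \<tau>) * norm h)"
    and sum_y: "\<forall>h\<in>Y. \<bar>lam * blinfun_apply xs h - (\<Sum>i\<in>I. blinfun_apply (y i) h)\<bar> \<le> (card I + 1) * \<tau> * norm h"
    and c_bound: "\<forall>i\<in>I. \<forall>B\<ge>0. (\<forall>h\<in>Y. blinfun_apply (y i) h \<le> B * norm h) \<longrightarrow> c i \<le> 2 * (B + \<tau>)"
    by (rule penalty_minimizer[where \<Omega> = \<Omega>, OF fin \<nu> Y(3,2) x0Y \<rho>(1) r' x0\<Omega> cl sep \<tau>_def])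
  note u = bspec[OF uy, THEN conjunct1] bspec[OF uy, THEN conjunct2, THEN conjunct1]
  have y: "y i \<in> frechet_normal_cone (u i) (\<Omega> i \<inter> Y)" "\<bar>blinfun_apply (y i) h\<bar> \<le> (1 + \<tau>) * norm h"
    if "i \<in> I" for i h
    using uy that by blast+
  define ys where "ys = (\<lambda>i. L (y i))"
  have cb: "c i \<le> 2 * (norm (ys i) + \<tau>)" if "i \<in> I" for i
  proof (rule c_bound[rule_format, OF that norm_ge_zero])
    fix h assume "h \<in> Y"
    hence "blinfun_apply (y i) h = blinfun_apply (ys i) h" by (simp add: ys_def L(3))
    also have "\<dots> \<le> norm (ys i) * norm h" using norm_blinfun[of "ys i" h] by simp
    finally show "blinfun_apply (y i) h \<le> norm (ys i) * norm h" .
  qed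
  \<comment> \<open>Squaring \<open>c i \<le> 2 * (norm (ys i) + \<tau>)\<close> gives the factor 8,
    and the \<open>\<tau>\<close> terms sum to at most \<open>8 * (1/4)\<^sup>2 = 1/2\<close>. At
    least one half of the normalization 1 remains, which yields the bound
    \<open>1/16\<close>.\<close>
  have "(\<Sum>i\<in>I. (c i)\<^sup>2) \<le> (\<Sum>i\<in>I. 8 * (norm (ys i))\<^sup>2 + 8 * \<tau>\<^sup>2)"
  proof (rule sum_mono)
    fix i assume i: "i \<in> I"
    have "(c i)\<^sup>2 \<le> (2 * (norm (ys i) + \<tau>))\<^sup>2" using cb[OF i] c1(2) by (intro power_mono) auto
    also have "\<dots> \<le> 8 * (norm (ys i))\<^sup>2 + 8 * \<tau>\<^sup>2"
      using zero_le_power2[of "norm (ys i) - \<tau>"] by (simp add: power2_eq_square algebra_simps)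
    finally show "(c i)\<^sup>2 \<le> 8 * (norm (ys i))\<^sup>2 + 8 * \<tau>\<^sup>2" .
  qed
  also have "\<dots> = 8 * (\<Sum>i\<in>I. (norm (ys i))\<^sup>2) + 8 * (real (card I) * \<tau>\<^sup>2)"
    by (simp add: sum.distrib sum_distrib_left)
  also have "real (card I) * \<tau>\<^sup>2 \<le> (n * \<tau>)\<^sup>2"
  proof -
    have "real (card I) \<le> n\<^sup>2" using n1 by (simp add: n_def power2_eq_square algebra_simps)
    thus ?thesis by (simp add: power_mult_distrib mult_right_mono)
  qed
  also have "(n * \<tau>)\<^sup>2 \<le> (1/4)\<^sup>2" using \<tau>_small \<tau>_nonneg n1 by (intro power_mono) auto
  finally have lower: "(\<Sum>i\<in>I. (c i)\<^sup>2) \<le> 8 * (\<Sum>i\<in>I. (norm (ys i))\<^sup>2) + 1/2"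
    by (simp add: power2_eq_square)
  show ?thesis
  proof (rule that[of I ys u lam])
    show "\<forall>i\<in>I. ys i \<in> frechet_normal_cone (u i) (\<Omega> i) \<and> norm (u i - x0) < \<epsilon> \<and> norm (ys i) \<le> 2"
    proof (intro ballI conjI)
      fix i assume i: "i \<in> I"
      show "ys i \<in> frechet_normal_cone (u i) (\<Omega> i)"
        unfolding ys_def by (rule L(5)[OF i u(2)[OF i] y(1)[OF i]])
      show "norm (u i - x0) < \<epsilon>" using u(1)[OF i] \<rho>(3) by simp
      have "norm (ys i) \<le> 1 + \<tau>" unfolding ys_def using \<tau>_nonneg y(2)[OF i] by (intro L(4)) auto
      thus "norm (ys i) \<le> 2" using \<tau>_small by simp
    qed
    \<comment> \<open>The residual is controlled on \<open>Y\<close> only; applying the linear map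
      \<open>L\<close> to it as a whole turns this into a norm bound on the entire space.\<close>
    have "norm (L (lam *\<^sub>R xs - (\<Sum>i\<in>I. y i))) \<le> n * \<tau>"
    proof (rule L(4))
      show "0 \<le> n * \<tau>" using n1 \<tau>_nonneg by simp
      show "\<bar>blinfun_apply (lam *\<^sub>R xs - (\<Sum>i\<in>I. y i)) h\<bar> \<le> n * \<tau> * norm h" if "h \<in> Y" for h
        using bspec[OF sum_y that] by (simp add: n_def blinfun.diff_left blinfun.scaleR_left blinfun.sum_left add.commute)
    qed
    also have "L (lam *\<^sub>R xs - (\<Sum>i\<in>I. y i)) = lam *\<^sub>R xs - (\<Sum>i\<in>I. ys i)"
      by (simp add: linear_diff[OF L(1)] linear_scale[OF L(1)] linear_sum[OF L(1)] L(2) ys_def)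
    finally show "norm (lam *\<^sub>R xs - (\<Sum>i\<in>I. ys i)) \<le> \<epsilon>" using \<tau>_small by simp
    have "1 \<le> lam\<^sup>2 + (8 * (\<Sum>i\<in>I. (norm (ys i))\<^sup>2) + 1/2)" using c1(1) lower by linarith
    moreover have "0 \<le> lam\<^sup>2" by simp
    ultimately show "1/16 \<le> lam\<^sup>2 + (\<Sum>i\<in>I. (norm (ys i))\<^sup>2)" by linarith
  qed (fact fin IT lam)+
qed

section \<open>Passage to the limit\<close>

text \<open>Baire's theorem gives a ball on which the sequence is uniformly bounded; subtracting the
  value at its centre bounds the norms.\<close>

lemma banach_steinhaus_sequence:
  fixes f :: "nat \<Rightarrow> 'a::banach \<Rightarrow>\<^sub>L real"
  assumes conv: "\<And>x. Bseq (\<lambda>n. blinfun_apply (f n) x)"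
  obtains B where "\<And>n. norm (f n) \<le> B"
proof -
  define C where "C = (\<lambda>m::nat. {x. \<forall>n. \<bar>blinfun_apply (f n) x\<bar> \<le> m})"
  have closed: "closed (C m)" for m
    unfolding C_def by (intro closed_Collect_all closed_Collect_le continuous_intros)
  have "(\<Union>m. C m) = UNIV"
  proof safe
    fix x
    obtain K where K: "\<And>n. norm (blinfun_apply (f n) x) \<le> K" using conv[of x] unfolding Bseq_def by blast
    obtain m :: nat where "K \<le> m" using real_arch_simple by blast
    with K have "x \<in> C m" by (auto simp: C_def intro: order_trans)
    thus "x \<in> (\<Union>m. C m)" by blast
  qed auto
  have "\<exists>m. interior (C m) \<noteq> {}"
  proof (rule ccontr)
    assume *: "\<not> ?thesis"
    have interior_eq: "euclidean interior_of S = interior S" for S :: "'a set"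
      by (auto simp: interior_of_def interior_def)
    have "(euclidean :: 'a topology) interior_of (\<Union>(range C)) = {}"
    proof (rule Baire_category_alt)
      show "completely_metrizable_space (euclidean :: 'a topology) \<or>
          locally_compact_space (euclidean :: 'a topology) \<and> regular_space (euclidean :: 'a topology)"
        using completely_metrizable_space_euclidean by blast
    qed (use * closed in \<open>auto simp: interior_eq\<close>)
    with \<open>(\<Union>m. C m) = UNIV\<close> show False by simp
  qed
  then obtain m x where "x \<in> interior (C m)" by blast
  then obtain e where e: "e > 0" "cball x e \<subseteq> C m"
    unfolding mem_interior_cball by blast
  have "norm (f n) \<le> 2 * real m / e" for n
  proof (rule norm_blinfun_bound)
    show "0 \<le> 2 * real m / e" using e by simp
    fix y
    show "norm (blinfun_apply (f n) y) \<le> 2 * real m / e * norm y"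
    proof (cases "y = 0")
      case False
      define t where "t = e / norm y"
      have t: "t > 0" using e False by (simp add: t_def)
      have "x + t *\<^sub>R y \<in> C m" "x \<in> C m" using e False by (auto simp: t_def subset_eq dist_norm)
      hence "\<bar>blinfun_apply (f n) (x + t *\<^sub>R y)\<bar> \<le> m" "\<bar>blinfun_apply (f n) x\<bar> \<le> m"
        by (auto simp: C_def)
      hence "\<bar>t * blinfun_apply (f n) y\<bar> \<le> 2 * m"
        by (simp add: blinfun.add_right blinfun.scaleR_right)
      hence "t * \<bar>blinfun_apply (f n) y\<bar> \<le> 2 * m" using t by (simp add: abs_mult)
      thus ?thesis using e False by (simp add: t_def field_simps)
    qed (simp add: blinfun.zero_right)
  qed
  thus ?thesis by (rule that)
qed

text \<open>Weak-star convergence bounds \<open>xsk\<close>, so \<open>lam j \<rightarrow> 0\<close>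
  would make the sums of normals vanish while the lower bound \<open>1/16\<close> keeps their
  squares away from 0, against AQC. Where \<open>lam j\<close> is bounded below, division by it
  represents \<open>xsk (k j)\<close> as an approximating sum.\<close>

lemma limiting_R_normal_approx:
  fixes T :: "'i set" and \<Omega> :: "'i \<Rightarrow> 'a::banach set" and xbar :: 'a
  assumes asp: "asplund_space TYPE('a)" and closed: "closed_system_around T \<Omega> xbar"
    and aqc: "AQC T \<Omega> xbar" and lim: "limiting_R_normal T \<Omega> xbar xs" and \<epsilon>: "\<epsilon> > 0"
  shows "xs \<in> weak_star_topology closure_of approx_normal_sums T \<Omega> xbar \<epsilon>"
proof -
  obtain x xsk R where x: "x \<longlonglongrightarrow> xbar" and xsk: "limitin weak_star_topology xsk xs sequentially"
    and R: "\<And>k. rate_function (R k)" "\<And>k. R_normal (R k) T \<Omega> (x k) (xsk k)"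
    using lim unfolding limiting_R_normal_def by metis
  obtain \<delta> where \<delta>: "\<delta> > 0" "\<And>i. i \<in> T \<Longrightarrow> closed (\<Omega> i \<inter> cball xbar \<delta>)"
    using closed unfolding closed_system_around_def by blast
  have ptw: "(\<lambda>k. blinfun_apply (xsk k) v) \<longlonglongrightarrow> blinfun_apply xs v" for v
    using continuous_map_limit[OF strong_operator_topology_continuous_evaluation xsk, of v]
    by (simp add: o_def)
  obtain B where B: "\<And>k. norm (xsk k) \<le> B"
    using banach_steinhaus_sequence[of xsk] convergent_imp_Bseq[OF convergentI[OF ptw]] by blast
  have "\<exists>k\<ge>j. norm (x k - xbar) < min (\<delta> / 2) (1 / Suc j)" for j
  proof -
    have "eventually (\<lambda>k. dist (x k) xbar < min (\<delta> / 2) (1 / Suc j)) sequentially"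
      using \<delta>(1) by (intro tendstoD[OF x]) auto
    hence "eventually (\<lambda>k. k \<ge> j \<and> dist (x k) xbar < min (\<delta> / 2) (1 / Suc j)) sequentially"
      using eventually_ge_at_top by (rule eventually_conj[rotated])
    from eventually_happens'[OF sequentially_bot this] show ?thesis by (auto simp: dist_norm)
  qed
  \<comment> \<open>Distance below \<open>\<delta> / 2\<close> places the ball of radius
    \<open>\<delta> / 2\<close> around \<open>x (k j)\<close> inside the common ball of
    closedness.\<close>
  then obtain k where k: "\<And>j. k j \<ge> j" "\<And>j. norm (x (k j) - xbar) < min (\<delta> / 2) (1 / Suc j)" by metis
  have ball: "closed (\<Omega> i \<inter> cball (x (k j)) (\<delta> / 2))" if "i \<in> T" for i j
  proof -
    have "cball (x (k j)) (\<delta> / 2) \<subseteq> cball xbar \<delta>"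
    proof
      fix y assume "y \<in> cball (x (k j)) (\<delta> / 2)"
      thus "y \<in> cball xbar \<delta>"
        using k(2)[of j] dist_triangle[of xbar y "x (k j)"] by (simp add: dist_norm norm_minus_commute)
    qed
    hence "\<Omega> i \<inter> cball (x (k j)) (\<delta> / 2) = (\<Omega> i \<inter> cball xbar \<delta>) \<inter> cball (x (k j)) (\<delta> / 2)" by blast
    thus ?thesis using \<delta>(2)[OF that] by (metis closed_Int closed_cball)
  qed
  define good where "good = (\<lambda>j I (u :: 'i \<Rightarrow> 'a) ys (lam :: real). finite I \<and> I \<subseteq> T \<and>
      (\<forall>i\<in>I. ys i \<in> frechet_normal_cone (u i) (\<Omega> i) \<and> norm (u i - x (k j)) < 1 / Suc j \<and> norm (ys i) \<le> 2) \<and>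
      0 \<le> lam \<and> lam \<le> 1 \<and>
      norm (lam *\<^sub>R xsk (k j) - (\<Sum>i\<in>I. ys i)) \<le> 1 / Suc j \<and> lam\<^sup>2 + (\<Sum>i\<in>I. (norm (ys i))\<^sup>2) \<ge> 1/16)"
  have "\<exists>I u ys lam. good j I u ys lam" for j
  proof -
    have pos: "\<delta> / 2 > 0" "1 / real (Suc j) > 0" using \<delta> by auto
    obtain I u ys lam where h: "finite I" "I \<subseteq> T"
      "\<forall>i\<in>I. ys i \<in> frechet_normal_cone (u i) (\<Omega> i) \<and> norm (u i - x (k j)) < 1 / Suc j \<and> norm (ys i) \<le> 2"
      "0 \<le> lam" "lam \<le> 1"
      "norm (lam *\<^sub>R xsk (k j) - (\<Sum>i\<in>I. ys i)) \<le> 1 / Suc j" "lam\<^sup>2 + (\<Sum>i\<in>I. (norm (ys i))\<^sup>2) \<ge> 1/16"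
      by (rule R_normal_approx[where \<Omega> = \<Omega>, OF asp pos(1) ball R(1,2) pos(2)])
    hence "good j I u ys lam" unfolding good_def by blast
    thus ?thesis by blast
  qed
  then obtain I u ys lam where good: "\<And>j. good j (I j) (u j) (ys j) (lam j)" by metis
  have I: "finite (I j)" "I j \<subseteq> T" and lam: "0 \<le> lam j" "lam j \<le> 1"
    and sum: "norm (lam j *\<^sub>R xsk (k j) - (\<Sum>i\<in>I j. ys j i)) \<le> 1 / Suc j"
    and lower: "(lam j)\<^sup>2 + (\<Sum>i\<in>I j. (norm (ys j i))\<^sup>2) \<ge> 1/16" for j
    using good[of j] unfolding good_def by blast+
  have ys: "ys j i \<in> frechet_normal_cone (u j i) (\<Omega> i)" "norm (u j i - x (k j)) < 1 / Suc j" "norm (ys j i) \<le> 2"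
    if "i \<in> I j" for j i
    using good[of j] that unfolding good_def by blast+
  have near: "norm (u j i - xbar) < 2 / Suc j" if "i \<in> I j" for i j
    using norm_triangle_ineq[of "u j i - x (k j)" "x (k j) - xbar"] ys(2)[OF that] k(2)[of j]
    by (simp add: add_divide_distrib[symmetric])
  have not0: "\<not> lam \<longlonglongrightarrow> 0"
  proof
    assume lam0: "lam \<longlonglongrightarrow> 0"
    have inv0: "(\<lambda>j. 1 / real (Suc j)) \<longlonglongrightarrow> 0"
      using LIMSEQ_inverse_real_of_nat by (simp add: inverse_eq_divide)
    \<comment> \<open>The normals have norm at most 2 and AQC concerns the unit ball, hence the
      halves; the factor 4 below undoes them after squaring.\<close>
    have "(\<lambda>j. norm (\<Sum>i\<in>I j. (1/2) *\<^sub>R ys j i)) \<longlonglongrightarrow> 0"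
    proof (rule Lim_null_comparison)
      have "norm (\<Sum>i\<in>I j. (1/2) *\<^sub>R ys j i) \<le> lam j * B + 1 / Suc j" for j
      proof -
        have "norm (\<Sum>i\<in>I j. ys j i) \<le> norm (lam j *\<^sub>R xsk (k j)) + norm (lam j *\<^sub>R xsk (k j) - (\<Sum>i\<in>I j. ys j i))"
          using norm_triangle_ineq4[of "lam j *\<^sub>R xsk (k j)" "lam j *\<^sub>R xsk (k j) - (\<Sum>i\<in>I j. ys j i)"] by simp
        also have "norm (lam j *\<^sub>R xsk (k j)) \<le> lam j * B" using lam(1) B by (simp add: mult_left_mono)
        finally have "norm (\<Sum>i\<in>I j. ys j i) \<le> lam j * B + 1 / Suc j" using sum[of j] by linarith
        moreover have "norm (\<Sum>i\<in>I j. (1/2) *\<^sub>R ys j i) \<le> norm (\<Sum>i\<in>I j. ys j i)"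
          by (simp flip: scaleR_right.sum)
        ultimately show ?thesis by linarith
      qed
      thus "\<forall>\<^sub>F j in sequentially. norm (norm (\<Sum>i\<in>I j. (1/2) *\<^sub>R ys j i)) \<le> lam j * B + 1 / Suc j" by simp
      show "(\<lambda>j. lam j * B + 1 / Suc j) \<longlonglongrightarrow> 0"
        using tendsto_add[OF tendsto_mult_left_zero[OF lam0, of B] inv0] by simp
    qed
    moreover have "decreasing_to_zero (\<lambda>j. 2 / Suc j)"
      unfolding decreasing_to_zero_def
    proof (intro conjI allI)
      show "decseq (\<lambda>j. 2 / real (Suc j))" by (auto simp: decseq_def intro!: divide_left_mono)
      show "(\<lambda>j. 2 / real (Suc j)) \<longlonglongrightarrow> 0" using tendsto_mult_right_zero[OF inv0, of 2] by simp
    qed simp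
    moreover have "(1/2) *\<^sub>R ys j i \<in> frechet_normal_cone (u j i) (\<Omega> i) \<inter> cball 0 1 \<and> norm (u j i - xbar) \<le> 2 / Suc j"
      if "i \<in> I j" for i j
      using frechet_normal_cone_scale[OF ys(1)[OF that], of "1/2"] ys(3)[OF that] near[OF that] by simp
    ultimately have "(\<lambda>j. \<Sum>i\<in>I j. (norm ((1/2) *\<^sub>R ys j i))\<^sup>2) \<longlonglongrightarrow> 0"
      using aqc[unfolded AQC_def, rule_format, of "\<lambda>j. 2 / Suc j" I "\<lambda>j i. (1/2) *\<^sub>R ys j i" u] I by blast
    hence "(\<lambda>j. (lam j)\<^sup>2 + 4 * (\<Sum>i\<in>I j. (norm ((1/2) *\<^sub>R ys j i))\<^sup>2)) \<longlonglongrightarrow> 0\<^sup>2 + 4 * 0"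
      by (intro tendsto_intros lam0)
    moreover have "4 * (\<Sum>i\<in>I j. (norm ((1/2) *\<^sub>R ys j i))\<^sup>2) = (\<Sum>i\<in>I j. (norm (ys j i))\<^sup>2)" for j
      by (simp add: sum_distrib_left power_mult_distrib power2_eq_square)
    ultimately have "(\<lambda>j. (lam j)\<^sup>2 + (\<Sum>i\<in>I j. (norm (ys j i))\<^sup>2)) \<longlonglongrightarrow> 0" by simp
    hence "1/16 \<le> (0::real)" using lower by (intro LIMSEQ_le_const[of _ 0 "1/16"]) auto
    thus False by simp
  qed
  obtain c where c: "c > 0" "\<And>m. \<exists>j\<ge>m. lam j \<ge> c"
  proof -
    have "\<exists>c>0. \<forall>m. \<exists>j\<ge>m. lam j \<ge> c"
    proof (rule ccontr)
      assume "\<not> ?thesis"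
      hence "\<And>c. c > 0 \<Longrightarrow> \<exists>m. \<forall>j\<ge>m. lam j < c" by (meson not_le)
      hence "lam \<longlonglongrightarrow> 0" using lam(1) unfolding LIMSEQ_iff by auto
      with not0 show False ..
    qed
    thus ?thesis using that by blast
  qed
  show ?thesis
    unfolding in_closure_of
  proof (intro conjI allI impI)
    show "xs \<in> topspace weak_star_topology" by (simp add: strong_operator_topology_topspace)
    fix U assume U: "xs \<in> U \<and> openin weak_star_topology U"
    hence "eventually (\<lambda>m. xsk m \<in> U) sequentially" using xsk by (auto simp: limitin_def)
    then obtain m1 where m1: "\<And>m. m \<ge> m1 \<Longrightarrow> xsk m \<in> U" by (auto simp: eventually_sequentially)
    \<comment> \<open>The bound \<open>\<epsilon> * c\<close> leaves an error of at most
      \<open>\<epsilon>\<close> after division by \<open>lam j \<ge> c\<close>; the bound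
      \<open>\<epsilon> / 2\<close> keeps the base points, at distance below
      \<open>2 / Suc j\<close>, within \<open>\<epsilon>\<close> of \<open>xbar\<close>.\<close>
    define e where "e = min (\<epsilon> * c) (\<epsilon> / 2)"
    have e: "e > 0" using \<epsilon> c by (simp add: e_def)
    obtain m2 where m2: "1 / real (Suc m2) < e" by (rule nat_approx_posE[OF e])
    obtain j where j: "j \<ge> max m1 m2" "lam j \<ge> c" using c(2) by blast
    have "1 / real (Suc j) \<le> 1 / real (Suc m2)" using j by (simp add: frac_le)
    hence small: "1 / real (Suc j) < e" using m2 by simp
    have lpos: "lam j > 0" using c j by simp
    have inU: "xsk (k j) \<in> U" using m1 k(1)[of j] j by simp
    define b where "b = (1 / \<epsilon>) *\<^sub>R (xsk (k j) - (\<Sum>i\<in>I j. (1 / lam j) *\<^sub>R ys j i))"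
    have "norm b \<le> 1"
    proof -
      have "lam j *\<^sub>R (xsk (k j) - (\<Sum>i\<in>I j. (1 / lam j) *\<^sub>R ys j i)) = lam j *\<^sub>R xsk (k j) - (\<Sum>i\<in>I j. ys j i)"
        using lpos by (simp add: scaleR_diff_right scaleR_right.sum)
      hence "lam j * norm (xsk (k j) - (\<Sum>i\<in>I j. (1 / lam j) *\<^sub>R ys j i)) \<le> 1 / Suc j"
        using sum[of j] lpos by (metis abs_of_pos norm_scaleR)
      also have "\<dots> \<le> \<epsilon> * c" using small by (simp add: e_def)
      also have "\<dots> \<le> \<epsilon> * lam j" using j \<epsilon> by simp
      finally have "norm (xsk (k j) - (\<Sum>i\<in>I j. (1 / lam j) *\<^sub>R ys j i)) \<le> \<epsilon>" using lpos by simp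
      thus ?thesis using \<epsilon> by (simp add: b_def)
    qed
    moreover have "xsk (k j) = (\<Sum>i\<in>I j. (1 / lam j) *\<^sub>R ys j i) + \<epsilon> *\<^sub>R b" using \<epsilon> by (simp add: b_def)
    moreover have "(1 / lam j) *\<^sub>R ys j i \<in> frechet_normal_cone (u j i) (\<Omega> i) \<and> norm (u j i - xbar) < \<epsilon>"
      if "i \<in> I j" for i
    proof
      show "(1 / lam j) *\<^sub>R ys j i \<in> frechet_normal_cone (u j i) (\<Omega> i)"
        using lpos by (intro frechet_normal_cone_scale ys(1) that) simp
      have "2 / real (Suc j) < \<epsilon>" using small by (simp add: e_def)
      with near[OF that] show "norm (u j i - xbar) < \<epsilon>" by simp
    qed
    ultimately have "xsk (k j) \<in> approx_normal_sums T \<Omega> xbar \<epsilon>"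
      unfolding approx_normal_sums_def using I[of j]
      by (intro CollectI exI[of _ "I j"] exI[of _ "u j"] exI[of _ "\<lambda>i. (1 / lam j) *\<^sub>R ys j i"] exI[of _ b]) simp
    with inU show "\<exists>y. y \<in> approx_normal_sums T \<Omega> xbar \<epsilon> \<and> y \<in> U" by blast
  qed
qed

theorem theorem5p12:
  fixes T :: "'i set" and \<Omega> :: "'i \<Rightarrow> 'a::banach set" and xbar :: 'a
  assumes "asplund_space TYPE('a)"
    and "closed_system_around T \<Omega> xbar"
    and "xbar \<in> (\<Inter>i\<in>T. \<Omega> i)"
    and "AQC T \<Omega> xbar"
  shows "(\<forall>xs. limiting_R_normal T \<Omega> xbar xs \<longrightarrow>
            (\<forall>\<epsilon>>0. xs \<in> weak_star_topology closure_of approx_normal_sums T \<Omega> xbar \<epsilon>)) \<and>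
         ((\<forall>xs \<in> basic_normal_cone xbar (\<Inter>i\<in>T. \<Omega> i). limiting_R_normal T \<Omega> xbar xs) \<longrightarrow>
            basic_normal_cone xbar (\<Inter>i\<in>T. \<Omega> i) \<subseteq>
              (\<Inter>\<epsilon>\<in>{0<..}. weak_star_topology closure_of approx_normal_sums T \<Omega> xbar \<epsilon>))"
  using limiting_R_normal_approx[OF assms(1,2,4)] by blast

end
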